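(* Let $\Gamma\subseteq\mathrm{SL}(2,\mathbb{Z})$ be a finitely generated Fuchsian group of the first kind with at least one parabolic class. Let $k$ be any real number, $\chi$ a multiplier system of weight $-k$ on $\Gamma$ and $\rho$ a $p$-dimensional unitary representation of $\Gamma$. Suppose $\{g_\gamma\}_{\gamma\in\Gamma}$ is a parabolic cocycle of weight $-k$, multiplier system $\chi$ and type $\rho$ on $\Gamma$ in $\mathcal{P}$. Then there exists a vector-valued function $\Phi:\mathbb{H}\to\mathbb{C}^p$, holomorphic in $\mathbb{H}$, such that $(\Phi|_{-k,\chi,\rho}\gamma)(\tau)-\Phi(\tau)=g_\gamma(\tau)$ for all $\gamma\in\Gamma$.
   Context: $\tau=u+iv\in\mathbb{H}$; real powers use a fixed standard branch. A multiplier system of weight $w$ on $\Gamma$ is $\chi:\Gamma\to\mathbb{C}$ with $|\chi|=1$, $\chi(\gamma_1\gamma_2)(c_3\tau+d_3)^w=\chi(\gamma_1)\chi(\gamma_2)(c_1\gamma_2\tau+d_1)^w(c_2\tau+d_2)^w$ and $\chi(-I)=e^{\pi iw}$. Slash operator: $(f|_{-k,\chi,\rho}\gamma)(\tau)=\chi(\gamma)^{-1}(c\tau+d)^{k}\rho(\gamma)^{-1}f(\gamma\tau)$ for $\gamma=\begin{pmatrix}a&b\\c&d\end{pmatrix}$. $\mathcal{P}$ is the space of holomorphic $G=\sum_{j=1}^p G_j\mathbf{e}_j:\mathbb{H}\to\mathbb{C}^p$ with $|G_j(\tau)|<K(|\tau|^{\alpha}+v^{-\sigma})$ for some positive constants $K,\alpha,\sigma$.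 A cocycle is a family $\{g_\gamma\}\subset\mathcal{P}$ with $g_{\gamma_1\gamma_2}=g_{\gamma_2}+g_{\gamma_1}|_{-k,\chi,\rho}\gamma_2$; it is parabolic if for every parabolic $B\in\Gamma$ there is $Q_B\in\mathcal{P}$ with $g_B=Q_B|_{-k,\chi,\rho}B-Q_B$. *)

theory Defs
  imports
    "HOL-Complex_Analysis.Complex_Analysis"
    "HOL-Algebra.Generated_Groups"
begin

subsection \<open>Subgroups of SL(2,R) acting on the upper half-plane\<close>

definition upper_half_plane :: "complex set" where
  "upper_half_plane = {\<tau>. Im \<tau> > 0}"

definition SL2R :: "(real^2^2) monoid" where
  "SL2R = \<lparr>carrier = {A. det A = 1}, mult = (**), one = mat 1\<rparr>"

lemma group_SL2R: "group SL2R"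
proof (rule groupI)
  fix A assume A: "A \<in> carrier SL2R"
  then have "invertible A" by (simp add: SL2R_def invertible_det_nz)
  then obtain B where B: "A ** B = mat 1" "B ** A = mat 1"
    unfolding invertible_def by blast
  have "det B * det A = 1" using B(2) by (metis det_I det_mul)
  then have "det B = 1" using A by (simp add: SL2R_def)
  then show "\<exists>B\<in>carrier SL2R. B \<otimes>\<^bsub>SL2R\<^esub> A = \<one>\<^bsub>SL2R\<^esub>"
    using B by (auto simp: SL2R_def)
qed (auto simp: SL2R_def det_mul matrix_mul_assoc)

definition SL2Z :: "(real^2^2) set" where
  "SL2Z = {A \<in> carrier SL2R. \<forall>i j. A $ i $ j \<in> \<int>}"

definition aut_factor :: "real^2^2 \<Rightarrow> complex \<Rightarrow> complex" where
  "aut_factor A \<tau> = of_real (A$2$1) * \<tau> + of_real (A$2$2)"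

definition moebius_action :: "real^2^2 \<Rightarrow> complex \<Rightarrow> complex" where
  "moebius_action A =
     moebius (of_real (A$1$1)) (of_real (A$1$2)) (of_real (A$2$1)) (of_real (A$2$2))"

definition fuchsian_group :: "(real^2^2) set \<Rightarrow> bool" where
  "fuchsian_group \<Gamma> \<longleftrightarrow> subgroup \<Gamma> SL2R \<and> discrete \<Gamma>"

text \<open>
  First kind: the limit set, i.e. the set of accumulation points of orbits of points of the
  upper half-plane, is the whole of the real line together with the point at infinity. An orbit
  accumulates at infinity iff it is unbounded.
\<close>

definition first_kind :: "(real^2^2) set \<Rightarrow> bool" where
  "first_kind \<Gamma> \<longleftrightarrow>
     (\<forall>x::real. \<exists>z\<in>upper_half_plane. of_real x islimpt (\<lambda>A. moebius_action A z) ` \<Gamma>) \<and>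
     (\<exists>z\<in>upper_half_plane. \<not> bounded ((\<lambda>A. moebius_action A z) ` \<Gamma>))"

definition finitely_generated :: "(real^2^2) set \<Rightarrow> bool" where
  "finitely_generated \<Gamma> \<longleftrightarrow> (\<exists>S. finite S \<and> S \<subseteq> carrier SL2R \<and> \<Gamma> = generate SL2R S)"

definition parabolic :: "real^2^2 \<Rightarrow> bool" where
  "parabolic A \<longleftrightarrow> A \<in> carrier SL2R \<and> \<bar>trace A\<bar> = 2 \<and> A \<noteq> mat 1 \<and> A \<noteq> - mat 1"

definition parabolic_classes :: "(real^2^2) set \<Rightarrow> (real^2^2) set set" where
  "parabolic_classes \<Gamma> =
     (\<lambda>B. {A ** B ** inv\<^bsub>SL2R\<^esub> A | A. A \<in> \<Gamma>}) ` {B \<in> \<Gamma>. parabolic B}"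


subsection \<open>Real powers and multiplier systems\<close>

text \<open>
  The branch is \<open>z\<^sup>r = \<bar>z\<bar>\<^sup>r e\<^sup>i\<^sup>r\<^sup>\<theta>\<close> with \<open>\<theta> = arg z\<close> normalised to
  \<open>- \<pi> \<le> \<theta> < \<pi>\<close>, whereas \<^const>\<open>Arg\<close> takes values in \<open>(- \<pi>, \<pi>]\<close>. The two differ on the negative
  real axis, and only the former is compatible with the normalisation \<open>v(-I) = e\<^sup>\<pi>\<^sup>i\<^sup>w\<close>
  for arbitrary real weights \<open>w\<close>: the consistency condition for \<open>A = B = -I\<close> reads
  \<open>1 = v(-I)\<^sup>2 ((-1)\<^sup>w)\<^sup>2\<close>.
\<close>

definition arg_branch :: "complex \<Rightarrow> real" where
  "arg_branch z = (if Arg z = pi then - pi else Arg z)"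

definition real_power :: "complex \<Rightarrow> real \<Rightarrow> complex" where
  "real_power z r = of_real (norm z powr r) * cis (r * arg_branch z)"

definition multiplier_system ::
    "(real^2^2) set \<Rightarrow> real \<Rightarrow> (real^2^2 \<Rightarrow> complex) \<Rightarrow> bool" where
  "multiplier_system \<Gamma> w v \<longleftrightarrow>
     (\<forall>A\<in>\<Gamma>. norm (v A) = 1) \<and>
     (\<forall>A\<in>\<Gamma>. \<forall>B\<in>\<Gamma>. \<forall>\<tau>\<in>upper_half_plane.
        v (A ** B) * real_power (aut_factor (A ** B) \<tau>) w =
        v A * v B * real_power (aut_factor A (moebius_action B \<tau>)) w * real_power (aut_factor B \<tau>) w) \<and>
     (- mat 1 \<in> \<Gamma> \<longrightarrow> v (- mat 1) = exp (\<i> * of_real (pi * w)))"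


subsection \<open>Unitary representations\<close>

definition conj_transpose :: "complex^'p^'p \<Rightarrow> complex^'p^'p" where
  "conj_transpose A = (\<chi> i j. cnj (A $ j $ i))"

definition unitary_group :: "(complex^'p^'p) monoid" where
  "unitary_group =
     \<lparr>carrier = {U. U ** conj_transpose U = mat 1 \<and> conj_transpose U ** U = mat 1},
      mult = (**), one = mat 1\<rparr>"

lemma conj_transpose_mult: "conj_transpose (A ** B) = conj_transpose B ** conj_transpose A"
  by (simp add: conj_transpose_def matrix_matrix_mult_def vec_eq_iff mult.commute)

lemma conj_transpose_mat_1: "conj_transpose (mat 1) = mat 1"
  by (simp add: conj_transpose_def mat_def vec_eq_iff)

lemma group_unitary_group: "group (unitary_group :: (complex^'p^'p) monoid)"
proof (rule groupI)
  fix A B :: "complex^'p^'p"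
  assume A: "A \<in> carrier unitary_group" and B: "B \<in> carrier unitary_group"
  have "A ** B ** (conj_transpose B ** conj_transpose A) =
        A ** (B ** conj_transpose B) ** conj_transpose A"
    by (simp add: matrix_mul_assoc)
  moreover have "conj_transpose B ** conj_transpose A ** (A ** B) =
        conj_transpose B ** (conj_transpose A ** A) ** B"
    by (simp add: matrix_mul_assoc)
  ultimately show "A \<otimes>\<^bsub>unitary_group\<^esub> B \<in> carrier unitary_group"
    using A B by (simp add: unitary_group_def conj_transpose_mult)
next
  show "\<one>\<^bsub>unitary_group\<^esub> \<in> carrier (unitary_group :: (complex^'p^'p) monoid)"
    by (simp add: unitary_group_def conj_transpose_mat_1)
next
  fix A :: "complex^'p^'p" assume A: "A \<in> carrier unitary_group"
  have "conj_transpose (conj_transpose A) = A" by (simp add: conj_transpose_def vec_eq_iff)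
  then show "\<exists>B\<in>carrier unitary_group. B \<otimes>\<^bsub>unitary_group\<^esub> A = \<one>\<^bsub>unitary_group\<^esub>"
    using A by (intro bexI[of _ "conj_transpose A"]) (auto simp: unitary_group_def)
qed (auto simp: unitary_group_def matrix_mul_assoc)

definition unitary_representation ::
    "(real^2^2) set \<Rightarrow> (real^2^2 \<Rightarrow> complex^'p^'p) \<Rightarrow> bool" where
  "unitary_representation \<Gamma> \<rho> \<longleftrightarrow> \<rho> \<in> hom (SL2R\<lparr>carrier := \<Gamma>\<rparr>) unitary_group"


subsection \<open>Parabolic cocycles\<close>

text \<open>
  Vector-valued functions on the upper half-plane are total functions on the complex numbers of
  which only the values on the upper half-plane matter.
\<close>

definition vholomorphic :: "(complex \<Rightarrow> complex^'p) \<Rightarrow> bool" where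
  "vholomorphic G \<longleftrightarrow> (\<forall>j. (\<lambda>\<tau>. G \<tau> $ j) holomorphic_on upper_half_plane)"

definition slash ::
    "real \<Rightarrow> (real^2^2 \<Rightarrow> complex) \<Rightarrow> (real^2^2 \<Rightarrow> complex^'p^'p) \<Rightarrow>
     (complex \<Rightarrow> complex^'p) \<Rightarrow> real^2^2 \<Rightarrow> complex \<Rightarrow> complex^'p" where
  "slash w v \<rho> f A \<tau> =
     (inverse (v A) * real_power (aut_factor A \<tau>) (- w)) *s (matrix_inv (\<rho> A) *v f (moebius_action A \<tau>))"

definition growth_space :: "(complex \<Rightarrow> complex^'p) set" where
  "growth_space =
     {G. vholomorphic G \<and>
         (\<exists>K \<alpha> \<sigma>. K > 0 \<and> \<alpha> > 0 \<and> \<sigma> > 0 \<and>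
            (\<forall>j. \<forall>\<tau>\<in>upper_half_plane.
               norm (G \<tau> $ j) < K * (norm \<tau> powr \<alpha> + Im \<tau> powr (- \<sigma>))))}"

definition cocycle ::
    "(real^2^2) set \<Rightarrow> real \<Rightarrow> (real^2^2 \<Rightarrow> complex) \<Rightarrow> (real^2^2 \<Rightarrow> complex^'p^'p) \<Rightarrow>
     (real^2^2 \<Rightarrow> complex \<Rightarrow> complex^'p) \<Rightarrow> bool" where
  "cocycle \<Gamma> w v \<rho> g \<longleftrightarrow>
     (\<forall>A\<in>\<Gamma>. g A \<in> growth_space) \<and>
     (\<forall>A\<in>\<Gamma>. \<forall>B\<in>\<Gamma>. \<forall>\<tau>\<in>upper_half_plane.
        g (A ** B) \<tau> = g B \<tau> + slash w v \<rho> (g A) B \<tau>)"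

definition parabolic_cocycle ::
    "(real^2^2) set \<Rightarrow> real \<Rightarrow> (real^2^2 \<Rightarrow> complex) \<Rightarrow> (real^2^2 \<Rightarrow> complex^'p^'p) \<Rightarrow>
     (real^2^2 \<Rightarrow> complex \<Rightarrow> complex^'p) \<Rightarrow> bool" where
  "parabolic_cocycle \<Gamma> w v \<rho> g \<longleftrightarrow>
     cocycle \<Gamma> w v \<rho> g \<and>
     (\<forall>B\<in>\<Gamma>. parabolic B \<longrightarrow>
        (\<exists>Q\<in>growth_space. \<forall>\<tau>\<in>upper_half_plane. g B \<tau> = slash w v \<rho> Q B \<tau> - Q \<tau>))"

end

theory Submission
  imports Defs "HOL-Computational_Algebra.Fundamental_Theorem_Algebra"
begin

text \<open>
  The affine action \<open>f \<mapsto> f|A - g A\<close> of \<open>\<Gamma>\<close> has a fixed point as soon as some orbit can be averaged.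
  Let \<open>h\<close> be holomorphic with \<open>\<Sum> h(A\<tau>) = 1\<close>, the sum running over \<open>A \<in> SL(2,\<int>)\<close>, and with terms
  decaying like a large negative power of \<open>\<parallel>A\<parallel>\<close>. Write \<open>A = s(A) c(A)\<close> with \<open>s(A)\<close> a shortest element
  of \<open>A\<Gamma>\<close>. Then \<open>\<Phi>(\<tau>) = - \<Sum> h(A\<tau>) g\<^bsub>c(A)\<^esub>(\<tau>)\<close> is a solution, provided that \<open>g\<^bsub>A\<^esub>(\<tau>)\<close> grows at most
  polynomially in \<open>\<parallel>A\<parallel>\<close>.

  The function \<open>h\<close>: sums over \<open>SL(2,\<int>)\<close> of rapidly decaying functions such as
  \<open>(\<Delta>(\<tau>) (\<tau> - cnj \<tau>\<^sub>0)\<^sup>1\<^sup>2)\<^bsup>-n\<^esup>\<close> are polynomials in \<open>j\<close>, and those that occur form an ideal of \<open>\<complex>[j]\<close>.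
  For large \<open>n\<close> the sum does not vanish at \<open>\<tau>\<^sub>0\<close>, because the terms with \<open>A\<tau>\<^sub>0 = \<tau>\<^sub>0\<close> dominate; hence the
  ideal has no zero and contains 1. This uses a zero-free \<open>\<Delta>\<close>, obtained as the exponential of a primitive
  of the Eisenstein series of weight two.

  The growth: a generator of \<open>\<Gamma>\<close> is a word in the standard generators \<open>S\<close>, \<open>T\<close>, so \<open>A \<in> \<Gamma>\<close> is joined to 1
  by a path that stays at bounded distance from \<open>\<Gamma>\<close>. Since the Farey tessellation is a tree of triangles,
  this path meets every prefix of the Euclidean factorisation of \<open>A\<close>. That factorisation has at most
  \<open>\<parallel>A\<parallel>\<close> letters and its prefixes are bounded by \<open>\<parallel>A\<parallel>\<close>, so the cocycle relation along it gives the bound.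
\<close>

text \<open>The averaging rests on one identity: slashing the term of B by A and using the cocycle
  relation turns the value at c(B) into the value at c(BA) minus g at A. After reindexing by BA, the
  weights, which add up to 1, leave exactly g at A; all that is required of c here is c(BA) = c(B)A
  for A in \<Gamma>. The weights are built on all of SL(2,Z) because level one functions can be
  written down completely, so the existence of h becomes a question about ideals of polynomials.

  Convergence is the obstacle. The cocycle relation bounds g along a word by one summand per letter,
  each polynomial in the norm of a partial product. A word in generators of \<Gamma> may be very
  long, and its partial products may be far larger than the product. Euclidean factorisations have
  neither defect, but their prefixes need not lie in \<Gamma>; the tree argument shows that each
  prefix is an element of \<Gamma> times one of finitely many matrices, which is all that the
  telescoping needs.\<close>

no_notation fps_nth (infixl \<open>$\<close> 75)

subsection \<open>Partial fractions of the cotangent\<close>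

lemma summable_on_int_abs:
  fixes g :: "nat \<Rightarrow> real"
  assumes "summable g" "\<And>n. g n \<ge> 0"
  shows "(\<lambda>n::int. g (nat \<bar>n\<bar>)) summable_on UNIV"
proof -
  have s: "g summable_on UNIV"
    using assms by (intro norm_summable_imp_summable_on) auto
  have "(\<lambda>n::int. g (nat \<bar>n\<bar>)) summable_on {0..}"
    using s by (subst summable_on_reindex_bij_witness[of _ int nat UNIV g]) auto
  moreover have "(\<lambda>n::int. g (nat \<bar>n\<bar>)) summable_on {..0}"
    using s by (subst summable_on_reindex_bij_witness[of _ "\<lambda>n. - int n" "\<lambda>n. nat (-n)" UNIV g]) auto
  ultimately have "(\<lambda>n::int. g (nat \<bar>n\<bar>)) summable_on ({0..} \<union> {..0})"
    by (rule summable_on_union)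
  also have "{0..} \<union> {..0} = (UNIV :: int set)" by auto
  finally show ?thesis .
qed

text \<open>The weight is cut off at 1 since \<open>0 powr (-s)\<close> is 0: without
  \<open>max 1\<close> a majorant built from it would vanish at index 0.\<close>

lemma summable_on_int_powr:
  fixes s :: real
  assumes "s > 1"
  shows "(\<lambda>n::int. max 1 \<bar>of_int n\<bar> powr (-s)) summable_on UNIV"
proof -
  have "summable (\<lambda>n. real n powr (-s))"
    using assms by (simp add: summable_real_powr_iff)
  then have "summable (\<lambda>n. max 1 (real n) powr (-s))"
    by (rule summable_cong[THEN iffD1, rotated])
       (auto simp: eventually_sequentially max_def intro!: exI[of _ 1])
  from summable_on_int_abs[OF this]
  have "(\<lambda>n::int. max 1 (real (nat \<bar>n\<bar>)) powr (-s)) summable_on UNIV" by simp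
  moreover have "real (nat \<bar>n\<bar>) = \<bar>of_int n\<bar>" for n :: int by simp
  ultimately show ?thesis by simp
qed

lemma summable_on_times_real:
  fixes f :: "'a \<Rightarrow> real" and g :: "'b \<Rightarrow> real"
  assumes "f summable_on X" "g summable_on Y" "\<And>x. f x \<ge> 0" "\<And>x. g x \<ge> 0"
  shows "(\<lambda>(x,y). f x * g y) summable_on X \<times> Y"
proof (rule summable_on_SigmaI[where g = "\<lambda>x. f x * infsum g Y"])
  show "((\<lambda>y. case (x, y) of (x, y) \<Rightarrow> f x * g y) has_sum f x * infsum g Y) Y" for x
    using assms by (auto intro!: has_sum_cmult_right has_sum_infsum)
qed (use assms in \<open>auto intro: summable_on_cmult_left\<close>)

lemma has_sum_int_split:
  fixes f :: "int \<Rightarrow> 'a::{real_normed_vector, banach}"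
  assumes "(\<lambda>n. f (int n)) sums a" "(\<lambda>n. f (- int (Suc n))) sums b" "f summable_on UNIV"
  shows "(f has_sum (a + b)) UNIV"
proof -
  have "(f has_sum a) {0..}"
  proof -
    have "f summable_on {0..}" using assms(3) by (rule summable_on_subset_banach) auto
    then have *: "(f has_sum (infsum f {0..})) {0..}" by simp
    also have "?this \<longleftrightarrow> ((\<lambda>n. f (int n)) has_sum (infsum f {0..})) UNIV"
      by (rule has_sum_reindex_bij_witness[of _ int nat]) auto
    finally have "(\<lambda>n. f (int n)) sums (infsum f {0..})" by (rule has_sum_imp_sums)
    from sums_unique2[OF this assms(1)] * show ?thesis by simp
  qed
  moreover have "(f has_sum b) {..<0}"
  proof -
    have "f summable_on {..<0}" using assms(3) by (rule summable_on_subset_banach) auto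
    then have *: "(f has_sum (infsum f {..<0})) {..<0}" by simp
    also have "?this \<longleftrightarrow> ((\<lambda>n. f (- int (Suc n))) has_sum (infsum f {..<0})) UNIV"
      by (rule has_sum_reindex_bij_witness[of _ "\<lambda>n. - int (Suc n)" "\<lambda>n. nat (-n-1)"]) auto
    finally have "(\<lambda>n. f (- int (Suc n))) sums (infsum f {..<0})" by (rule has_sum_imp_sums)
    from sums_unique2[OF this assms(2)] * show ?thesis by simp
  qed
  ultimately have "(f has_sum (a + b)) ({0..} \<union> {..<0})"
    by (intro has_sum_Un_disjoint) auto
  also have "{0..} \<union> {..<0} = (UNIV :: int set)" by auto
  finally show ?thesis .
qed

lemma one_minus_notin_Ints:
  fixes z :: "'a::ring_1"
  assumes "z \<notin> \<int>"
  shows "1 - z \<notin> \<int>"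
proof
  assume "1 - z \<in> \<int>"
  then have "1 - (1 - z) \<in> \<int>" by (intro Ints_diff) auto
  then show False using assms by simp
qed

lemma has_sum_int_even:
  fixes f :: "int \<Rightarrow> complex"
  assumes even: "\<And>m. f (- m) = f m" and T: "((\<lambda>n. f (int (Suc n))) has_sum T) UNIV"
  shows "(f has_sum 2 * T) {m. m \<noteq> 0}"
proof -
  from T have pos: "(f has_sum T) {1..}"
    by (subst (asm) has_sum_reindex_bij_witness[of _ "\<lambda>n. nat (n - 1)" "\<lambda>n. int (Suc n)" "{1..}" f]) auto
  then have neg: "(f has_sum T) {..-1}"
    by (subst has_sum_reindex_bij_witness[of _ uminus uminus "{1..}" f]) (auto simp: even)
  have "(f has_sum (T + T)) ({1..} \<union> {..-1})"
    by (intro has_sum_Un_disjoint pos neg) auto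
  also have "{1..} \<union> {..-1} = {m::int. m \<noteq> 0}" by auto
  finally show ?thesis by simp
qed

lemma has_sum_int_evenD:
  fixes f :: "int \<Rightarrow> complex"
  assumes "\<And>m. f (- m) = f m" "(f has_sum S) {m. m \<noteq> 0}"
  shows "(\<lambda>n. f (int (Suc n))) sums (S / 2)"
proof -
  define T where "T = infsum f {1..}"
  have "f summable_on {m. m \<noteq> 0}" using assms(2) by (auto simp: summable_on_def)
  then have "f summable_on {1..}" by (rule summable_on_subset_banach) auto
  then have "(f has_sum T) {1..}" by (simp add: T_def)
  then have T: "((\<lambda>n. f (int (Suc n))) has_sum T) UNIV"
    by (subst has_sum_reindex_bij_witness[of _ "\<lambda>n. nat (n - 1)" "\<lambda>n. int (Suc n)" "{1..}" f]) auto
  from has_sum_int_even[OF assms(1) T] assms(2) have "S = 2 * T" using has_sum_unique by blast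
  with has_sum_imp_sums[OF T] show ?thesis by simp
qed

text \<open>Logarithmic differentiation of Gamma(z) Gamma(1 - z) = pi / sin(pi z).\<close>

lemma Digamma_reflection:
  fixes z :: complex
  assumes "z \<notin> \<int>"
  shows "Digamma (1 - z) - Digamma z = of_real pi * cot (of_real pi * z)"
proof -
  have n: "z \<notin> \<int>\<^sub>\<le>\<^sub>0" "1 - z \<notin> \<int>\<^sub>\<le>\<^sub>0"
    using assms one_minus_notin_Ints nonpos_Ints_subset_Ints by auto
  have sn: "sin (of_real pi * z) \<noteq> 0"
    using assms by (subst sin_eq_0) (auto simp: )
  have "((\<lambda>z. Gamma z * Gamma (1 - z)) has_field_derivative
         Gamma z * Digamma z * Gamma (1 - z) - Gamma z * (Gamma (1 - z) * Digamma (1 - z))) (at z)"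
    using n by (auto intro!: derivative_eq_intros)
  moreover have "(\<lambda>z. Gamma z * Gamma (1 - z)) = (\<lambda>z. complex_of_real pi / sin (of_real pi * z))"
    by (simp add: Gamma_reflection_complex of_real_def)
  moreover have "((\<lambda>z. of_real pi / sin (of_real pi * z)) has_field_derivative
      - (of_real pi * (of_real pi * cos (of_real pi * z)) / (sin (of_real pi * z))^2)) (at z)"
    using sn by (auto intro!: derivative_eq_intros simp: power2_eq_square)
  ultimately have "Gamma z * Digamma z * Gamma (1 - z) - Gamma z * (Gamma (1 - z) * Digamma (1 - z))
     = - (of_real pi * (of_real pi * cos (of_real pi * z)) / (sin (of_real pi * z))^2)"
    using DERIV_unique by metis
  then have "Gamma z * Gamma (1 - z) * (Digamma (1 - z) - Digamma z) =
     (of_real pi / sin (of_real pi * z)) * (of_real pi * cot (of_real pi * z))"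
    by (simp add: algebra_simps cot_def power2_eq_square)
  then show ?thesis using sn by (simp add: Gamma_reflection_complex)
qed

text \<open>Differentiates \<open>Digamma_reflection\<close>: the complement of the integers is
  open, so that identity holds in a neighbourhood of z.\<close>

lemma Polygamma_1_reflection:
  fixes z :: complex
  assumes "z \<notin> \<int>"
  shows "Polygamma 1 (1 - z) + Polygamma 1 z = (of_real pi)\<^sup>2 / (sin (of_real pi * z))\<^sup>2"
proof -
  have n: "z \<notin> \<int>\<^sub>\<le>\<^sub>0" "1 - z \<notin> \<int>\<^sub>\<le>\<^sub>0"
    using assms one_minus_notin_Ints nonpos_Ints_subset_Ints by auto
  have sn: "sin (of_real pi * z) \<noteq> 0"
    using assms by (subst sin_eq_0) (auto simp: )
  have d1: "((\<lambda>z. Digamma (1 - z) - Digamma z) has_field_derivative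
         - Polygamma 1 (1 - z) - Polygamma 1 z) (at z)"
    using n by (auto intro!: derivative_eq_intros)
  have d2: "((\<lambda>z. of_real pi * (cos (of_real pi * z) / sin (of_real pi * z))) has_field_derivative
      - ((of_real pi)\<^sup>2 / (sin (of_real pi * z))\<^sup>2)) (at z)"
  proof -
    define c where "c = complex_of_real pi"
    have 1: "((\<lambda>z. sin (c * z)) has_field_derivative cos (c * z) * c) (at z)"
      by (auto intro!: derivative_eq_intros)
    have 2: "((\<lambda>z. cos (c * z)) has_field_derivative - sin (c * z) * c) (at z)"
      by (auto intro!: derivative_eq_intros)
    have sn': "sin (c * z) \<noteq> 0" using sn by (simp add: c_def)
    have cc: "cos (c * z) * cos (c * z) + sin (c * z) * sin (c * z) = 1"
      by (rule sin_cos_squared_add3)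
    have "(- sin (c * z) * c * sin (c * z) - cos (c * z) * (cos (c * z) * c)) =
      - c * (cos (c * z) * cos (c * z) + sin (c * z) * sin (c * z))"
      by (simp add: algebra_simps del: sin_cos_squared_add3)
    then have eq: "(- sin (c * z) * c * sin (c * z) - cos (c * z) * (cos (c * z) * c)) = - c"
      unfolding cc by simp
    from DERIV_cmult[OF DERIV_divide[OF 2 1 sn'], of c, unfolded eq]
    show ?thesis by (simp add: power2_eq_square flip: c_def)
  qed
  have "\<forall>\<^sub>F w in nhds z. w \<in> - \<int>"
    using assms by (intro eventually_nhds_in_open) auto
  then have "\<forall>\<^sub>F w in nhds z. Digamma (1 - w) - Digamma w = of_real pi * (cos (of_real pi * w) / sin (of_real pi * w))"
    by eventually_elim (subst Digamma_reflection, auto simp: cot_def)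
  from DERIV_cong_ev[OF refl this refl] d1 d2
  have "- Polygamma 1 (1 - z) - Polygamma 1 z = - ((of_real pi)\<^sup>2 / (sin (of_real pi * z))\<^sup>2)"
    using DERIV_unique by metis
  then show ?thesis by (simp add: algebra_simps add_eq_0_iff)
qed

text \<open>The terms with n \<ge> 0 form the series of \<open>Polygamma 1\<close> at z, those with
  n < 0 the series at 1 - z. Unconditional summability is assumed because the two half-series are
  known only as limits of partial sums.\<close>

lemma csc_squared_has_sum:
  fixes z :: complex
  assumes "z \<notin> \<int>" "(\<lambda>n. 1 / (z + of_int n)\<^sup>2) summable_on UNIV"
  shows "((\<lambda>n. 1 / (z + of_int n)\<^sup>2) has_sum (of_real pi)\<^sup>2 / (sin (of_real pi * z))\<^sup>2) UNIV"
proof -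
  have z0: "z \<noteq> 0" "1 - z \<noteq> 0" using assms(1) by auto
  have P: "(\<lambda>k. inverse ((w + of_nat k)\<^sup>2)) sums Polygamma 1 w" if "w \<noteq> 0" for w :: complex
    using Polygamma_converges'[OF that, of 2] by (simp add: Polygamma_def summable_sums numeral_2_eq_2)
  have "((\<lambda>n. 1 / (z + of_int n)\<^sup>2) has_sum (Polygamma 1 z + Polygamma 1 (1 - z))) UNIV"
  proof (rule has_sum_int_split[OF _ _ assms(2)])
    show "(\<lambda>n. 1 / (z + of_int (int n))\<^sup>2) sums Polygamma 1 z"
      using P[OF z0(1)] by (simp add: inverse_eq_divide)
    have "1 / (z + of_int (- int (Suc n)))\<^sup>2 = inverse ((1 - z + of_nat n)\<^sup>2)" for n
    proof -
      have "z + of_int (- int (Suc n)) = - (1 - z + of_nat n)" by simp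
      then show ?thesis by (simp only: power2_minus inverse_eq_divide)
    qed
    then show "(\<lambda>n. 1 / (z + of_int (- int (Suc n)))\<^sup>2) sums Polygamma 1 (1 - z)"
      using P[OF z0(2)] by presburger
  qed
  then show ?thesis using Polygamma_1_reflection[OF assms(1)] by (simp add: add.commute)
qed

text \<open>The summand is even in m, and its positive half is the difference of the series for
  \<open>Digamma\<close> at 1 + z and at 1 - z, whose value the reflection formula gives.\<close>

lemma cot_has_sum:
  fixes z S :: complex
  assumes "z \<notin> \<int>" "((\<lambda>m. 1 / (of_int m - z) - 1 / (of_int m + z)) has_sum S) {m::int. m \<noteq> 0}"
  shows "S = 2 * (1 / z - of_real pi * cot (of_real pi * z))"
proof -
  define f where "f = (\<lambda>m::int. 1 / (of_int m - z) - 1 / (of_int m + z))"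
  have z0: "z \<noteq> 0" "1 - z \<noteq> 0" "1 + z \<noteq> 0" 
    using assms(1) by (auto simp: add_eq_0_iff2 minus_equation_iff[of z])
  have ev: "f (- m) = f m" for m
  proof -
    have "complex_of_int (- m) - z = - (of_int m + z)" "complex_of_int (- m) + z = - (of_int m - z)" by auto
    then show ?thesis unfolding f_def by (simp only: divide_minus_right) simp
  qed
  have "Digamma (1 + z) - Digamma (1 - z) = 1 / z - of_real pi * cot (of_real pi * z)"
    using Digamma_plus1[OF z0(1)] Digamma_reflection[OF assms(1)] by (simp add: algebra_simps)
  moreover have "(\<lambda>n. f (int (Suc n))) sums (Digamma (1 + z) - Digamma (1 - z))"
  proof -
    have D: "(\<lambda>k. inverse (of_nat (Suc k)) - inverse (w + of_nat k)) sums (Digamma w + euler_mascheroni)"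
      if "w \<noteq> 0" for w :: complex
      using summable_Digamma[OF that] by (simp add: Digamma_def summable_sums)
    from sums_diff[OF D[OF z0(3)] D[OF z0(2)]] show ?thesis
      by (simp add: f_def inverse_eq_divide algebra_simps)
  qed
  ultimately have s: "(\<lambda>n. f (int (Suc n))) sums (1 / z - of_real pi * cot (of_real pi * z))" by simp
  have "(f has_sum S) {m. m \<noteq> 0}" using assms(2) by (simp add: f_def)
  from sums_unique2[OF s has_sum_int_evenD[OF ev this]]
  have "S = (1 / z - of_real pi * cot (of_real pi * z)) * 2" by simp
  then show ?thesis by (simp only: mult.commute)
qed

subsection \<open>The lattice sum of weight two\<close>

text \<open>The imaginary part of m\<tau> + n controls m, and the triangle inequality then controls
  n.\<close>

lemma lattice_bound:
  fixes \<tau> :: complex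
  assumes "Im \<tau> > 0"
  obtains K where "K > 0"
    "\<And>m n :: int. \<bar>of_int m\<bar> \<le> K * norm (of_int m * \<tau> + of_int n)"
    "\<And>m n :: int. \<bar>of_int n\<bar> \<le> K * norm (of_int m * \<tau> + of_int n)"
proof -
  define K where "K = 1 / Im \<tau> + (1 + norm \<tau> / Im \<tau>)"
  have K: "K > 0" "1 / Im \<tau> \<le> K" "1 + norm \<tau> / Im \<tau> \<le> K"
    using assms by (auto simp: K_def intro!: add_nonneg_pos add_pos_nonneg)
  have 1: "\<bar>of_int m\<bar> \<le> 1 / Im \<tau> * norm (of_int m * \<tau> + of_int n)" for m n
  proof -
    have "\<bar>Im (of_int m * \<tau> + of_int n)\<bar> \<le> norm (of_int m * \<tau> + of_int n)" by (rule abs_Im_le_cmod)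
    then show ?thesis using assms by (simp add: field_simps abs_mult)
  qed
  have 2: "\<bar>of_int n\<bar> \<le> (1 + norm \<tau> / Im \<tau>) * norm (of_int m * \<tau> + of_int n)" for m n
  proof -
    have "\<bar>real_of_int n\<bar> = norm (complex_of_int n)" by simp
    also have "\<dots> \<le> norm (of_int m * \<tau> + of_int n) + norm (of_int m * \<tau>)"
      by (metis add_diff_cancel_left' norm_triangle_ineq4)
    also have "norm (of_int m * \<tau>) = \<bar>of_int m\<bar> * norm \<tau>" by (simp add: norm_mult)
    also have "\<dots> \<le> 1 / Im \<tau> * norm (of_int m * \<tau> + of_int n) * norm \<tau>"
      by (intro mult_right_mono 1) auto
    finally show ?thesis by (simp add: algebra_simps)
  qed
  show ?thesis
  proof (rule that[OF K(1)])
    show "\<bar>of_int m\<bar> \<le> K * norm (of_int m * \<tau> + of_int n)" for m n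
      using 1 K(2) by (meson mult_right_mono norm_ge_zero order_trans)
    show "\<bar>of_int n\<bar> \<le> K * norm (of_int m * \<tau> + of_int n)" for m n
      using 2 K(3) by (meson mult_right_mono norm_ge_zero order_trans)
  qed
qed

lemma of_int_mult_tau_notin_Ints:
  assumes "Im \<tau> > 0" "m \<noteq> (0::int)"
  shows "of_int m * \<tau> \<notin> \<int>"
proof
  assume "of_int m * \<tau> \<in> \<int>"
  then have "Im (of_int m * \<tau>) = 0" by (simp add: complex_is_Int_iff)
  then show False using assms by simp
qed

lemma int_plus_notin_Ints_nonzero: "z \<notin> \<int> \<Longrightarrow> z + of_int n \<noteq> (0::complex)"
  by (metis Ints_minus Ints_of_int add_eq_0_iff2 minus_minus)

lemma summable_on_row:
  assumes "Im \<tau> > 0" "m \<noteq> 0"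
  shows "(\<lambda>n::int. 1 / (of_int m * \<tau> + of_int n)\<^sup>2) summable_on UNIV"
proof -
  obtain K where K: "K > 0"
    "\<And>m n :: int. \<bar>of_int m\<bar> \<le> K * norm (of_int m * \<tau> + of_int n)"
    "\<And>m n :: int. \<bar>of_int n\<bar> \<le> K * norm (of_int m * \<tau> + of_int n)"
    using lattice_bound[OF assms(1)] by blast
  have "(\<lambda>n::int. K\<^sup>2 * (max 1 \<bar>of_int n\<bar> powr (-2))) summable_on UNIV"
    by (intro summable_on_cmult_right summable_on_int_powr) auto
  then have "(\<lambda>n::int. norm (1 / (of_int m * \<tau> + of_int n)\<^sup>2)) summable_on UNIV"
  proof (rule Infinite_Sum.abs_summable_on_comparison_test')
    fix n :: int
    define X where "X = norm (of_int m * \<tau> + of_int n)"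
    define b where "b = max 1 \<bar>real_of_int n\<bar>"
    have "1 \<le> \<bar>real_of_int m\<bar>" using assms(2) by linarith
    then have b: "b \<le> K * X" using K(2)[of m n] K(3)[of n m] by (auto simp: b_def X_def)
    have b1: "b \<ge> 1" by (simp add: b_def)
    have X0: "X > 0" using b b1 K(1) by (smt (verit) zero_less_mult_iff)
    have "b\<^sup>2 \<le> (K * X)\<^sup>2" using b b1 by (intro power_mono) auto
    then have "1 / X\<^sup>2 \<le> K\<^sup>2 * (1 / b\<^sup>2)" using X0 b1 by (simp add: field_simps power_mult_distrib)
    moreover have "b powr (-2) = 1 / b\<^sup>2" using b1 by (simp add: powr_minus powr_numeral inverse_eq_divide)
    ultimately show "norm (1 / (of_int m * \<tau> + of_int n)\<^sup>2) \<le> K\<^sup>2 * (max 1 \<bar>of_int n\<bar> powr (-2))"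
      unfolding b_def[symmetric] by (simp add: norm_divide norm_power X_def)
  qed
  then show ?thesis by (rule abs_summable_summable)
qed

text \<open>The summand is what remains of 1/(m\<tau> + n)^2 once the telescoping difference
  1/(m\<tau> + n) - 1/(m\<tau> + n + 1) is taken off. Its cubic decay is split evenly: each index
  receives a factor of exponent 3/2 > 1, so a product of two convergent single sums
  dominates.\<close>

lemma summable_on_lattice:
  assumes "Im \<tau> > 0"
  shows "(\<lambda>(m::int,n::int). 1 / ((of_int m * \<tau> + of_int n)\<^sup>2 * (of_int m * \<tau> + of_int n + 1)))
    summable_on ({m. m \<noteq> 0} \<times> UNIV)"
proof -
  obtain K where K: "K > 0"
    "\<And>m n :: int. \<bar>of_int m\<bar> \<le> K * norm (of_int m * \<tau> + of_int n)"
    "\<And>m n :: int. \<bar>of_int n\<bar> \<le> K * norm (of_int m * \<tau> + of_int n)"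
    using lattice_bound[OF assms(1)] by blast
  define w where "w = (\<lambda>n::int. max 1 \<bar>real_of_int n\<bar> powr (-(3/2)))"
  have "(\<lambda>(m,n). w m * w n) summable_on UNIV \<times> UNIV"
    unfolding w_def by (intro summable_on_times_real summable_on_int_powr) auto
  then have "(\<lambda>(m,n). w m * w n) summable_on {m. m \<noteq> 0} \<times> UNIV"
    by (rule summable_on_subset_banach) auto
  then have "(\<lambda>p. (2 * K)^3 * (case p of (m,n) \<Rightarrow> w m * w n)) summable_on {m. m \<noteq> 0} \<times> UNIV"
    by (intro summable_on_cmult_right)
  then have "(\<lambda>p. norm (case p of (m,n) \<Rightarrow> 1 / ((of_int m * \<tau> + of_int n)\<^sup>2 * (of_int m * \<tau> + of_int n + 1))))
     summable_on {m. m \<noteq> 0} \<times> UNIV"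
  proof (rule Infinite_Sum.abs_summable_on_comparison_test')
    fix p :: "int \<times> int" assume p: "p \<in> {m. m \<noteq> 0} \<times> UNIV"
    obtain m n where mn: "p = (m,n)" "m \<noteq> 0" using p by (cases p) auto
    define X where "X = norm (of_int m * \<tau> + of_int n)"
    define Y where "Y = norm (of_int m * \<tau> + of_int n + 1)"
    define a where "a = max 1 \<bar>real_of_int m\<bar>"
    define b where "b = max 1 \<bar>real_of_int n\<bar>"
    have m1: "1 \<le> \<bar>real_of_int m\<bar>" using mn(2) by linarith
    have KX: "\<bar>real_of_int m\<bar> \<le> K * X" "\<bar>real_of_int n\<bar> \<le> K * X" using K(2,3) by (auto simp: X_def)
    have KY: "\<bar>real_of_int m\<bar> \<le> K * Y" "\<bar>real_of_int n + 1\<bar> \<le> K * Y"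
      using K(2)[of m "n+1"] K(3)[of "n+1" m] by (auto simp: Y_def add_ac)
    \<comment> \<open>The factor 2 absorbs the shift by 1, since m \<noteq> 0 gives |n| \<le> |n +
      1| + |m|.\<close>
    have ab: "a \<le> 2 * K * X" "b \<le> 2 * K * X" "a \<le> 2 * K * Y" "b \<le> 2 * K * Y" "a \<ge> 1" "b \<ge> 1"
      using KX KY m1 by (auto simp: a_def b_def)
    have pos: "2 * K * X > 0" "2 * K * Y > 0" using ab by linarith+
    then have XY: "X > 0" "Y > 0" using K(1) by (simp_all add: zero_less_mult_iff)
    have 1: "a * b \<le> (2 * K * X)\<^sup>2" unfolding power2_eq_square using ab pos by (intro mult_mono) auto
    have "a * b \<le> (2 * K * Y)\<^sup>2" unfolding power2_eq_square using ab pos by (intro mult_mono) auto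
    then have 2: "sqrt (a * b) \<le> 2 * K * Y" using pos by (intro real_le_lsqrt) auto
    have "(a * b) * sqrt (a * b) \<le> (2 * K * X)\<^sup>2 * (2 * K * Y)"
      using 1 2 ab by (intro mult_mono) auto
    also have "\<dots> = (2 * K)^3 * (X\<^sup>2 * Y)" by (simp add: power2_eq_square power3_eq_cube)
    finally have le: "(a * b) * sqrt (a * b) \<le> (2 * K)^3 * (X\<^sup>2 * Y)" .
    have c: "x powr (-(3/2)) = 1 / (x * sqrt x)" if "x \<ge> 1" for x :: real
    proof -
      have "x powr (3/2) = x powr (1 + 1/2)" by simp
      also have "\<dots> = x * sqrt x" using that by (subst powr_add) (simp add: powr_half_sqrt)
      finally show ?thesis by (simp add: powr_minus inverse_eq_divide)
    qed
    have "w m * w n = 1 / ((a * b) * sqrt (a * b))"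
      using ab by (simp add: w_def c flip: a_def b_def) (simp add: real_sqrt_mult)
    moreover have "1 / (X\<^sup>2 * Y) \<le> (2 * K)^3 * (1 / ((a * b) * sqrt (a * b)))"
      using le XY ab by (simp add: field_simps)
    ultimately show "norm (case p of (m,n) \<Rightarrow> 1 / ((of_int m * \<tau> + of_int n)\<^sup>2 * (of_int m * \<tau> + of_int n + 1)))
       \<le> (2 * K)^3 * (case p of (m,n) \<Rightarrow> w m * w n)"
      using mn by (simp add: norm_divide norm_mult norm_power X_def Y_def)
  qed
  then show ?thesis by (rule abs_summable_summable)
qed

text \<open>The interval is half open so that telescoping over it leaves the symmetric endpoints -N
  and N.\<close>

lemma has_sum_int_symmetric:
  fixes f :: "int \<Rightarrow> 'a::{topological_comm_monoid_add}"
  assumes "(f has_sum S) UNIV"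
  shows "(\<lambda>N. \<Sum>n\<in>{-int N..<int N}. f n) \<longlonglongrightarrow> S"
proof -
  have "filterlim (\<lambda>N. {-int N..<int N}) (finite_subsets_at_top UNIV) sequentially"
    unfolding filterlim_finite_subsets_at_top
  proof safe
    fix X :: "int set" assume X: "finite X"
    define M where "M = Max (insert 0 (abs ` X))"
    have M: "\<bar>x\<bar> \<le> M" if "x \<in> X" for x unfolding M_def using X that by (intro Max_ge) auto
    show "\<forall>\<^sub>F N in sequentially. finite {- int N..<int N} \<and> X \<subseteq> {- int N..<int N} \<and> {- int N..<int N} \<subseteq> UNIV"
      unfolding eventually_sequentially
    proof (intro exI allI impI conjI subsetI)
      fix N x assume "nat (M + 1) \<le> N" "x \<in> X"
      then show "x \<in> {- int N..<int N}" using M[of x] by auto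
    qed auto
  qed
  from filterlim_compose[OF assms[unfolded has_sum_def] this] show ?thesis .
qed

lemma sum_telescope_int:
  fixes g :: "int \<Rightarrow> 'a::ab_group_add"
  shows "(\<Sum>n\<in>{-int N..<int N}. g n - g (n + 1)) = g (- int N) - g (int N)"
proof -
  have "(\<Sum>n\<in>{a..<a + int k}. g n - g (n + 1)) = g a - g (a + int k)" for a k
  proof (induction k)
    case (Suc k)
    have "{a..<a + int (Suc k)} = insert (a + int k) {a..<a + int k}" by auto
    then show ?case using Suc by (simp add: algebra_simps)
  qed auto
  from this[of "-int N" "2*N"] show ?thesis by simp
qed

lemma inverse_of_nat_add_tendsto_0: "(\<lambda>N. 1 / (z + of_nat N)) \<longlonglongrightarrow> (0::complex)"
  "(\<lambda>N. 1 / (z - of_nat N)) \<longlonglongrightarrow> (0::complex)"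
proof -
  have "filterlim (\<lambda>N. (z::complex) + of_nat N) at_infinity sequentially" for z
    by (intro tendsto_add_filterlim_at_infinity[OF tendsto_const] tendsto_of_nat)
  note * = tendsto_inverse_0[THEN filterlim_compose, OF this]
  from *[of z] show "(\<lambda>N. 1 / (z + of_nat N)) \<longlonglongrightarrow> 0" by (simp add: inverse_eq_divide)
  have eq: "1 / (z - of_nat N) = - inverse (- z + of_nat N)" for N
  proof -
    have "z - of_nat N = - (- z + of_nat N)" by simp
    then show ?thesis by (simp only: inverse_eq_divide divide_minus_right)
  qed
  from tendsto_minus[OF *[of "-z"]] show "(\<lambda>N. 1 / (z - of_nat N)) \<longlonglongrightarrow> 0"
    by (simp only: eq minus_zero)
qed

lemma has_sum_int_remove_0:
  fixes f :: "int \<Rightarrow> 'a::{real_normed_vector, banach}"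
  assumes "(f has_sum a) UNIV"
  shows "(f has_sum (a - f 0)) {n. n \<noteq> 0}"
proof -
  have "f summable_on {n. n \<noteq> 0}"
    by (rule summable_on_subset_banach[of f UNIV]) (use assms in \<open>auto simp: summable_on_def\<close>)
  then obtain b where b: "(f has_sum b) {n. n \<noteq> 0}" by (auto simp: summable_on_def)
  then have "(f has_sum (f 0 + b)) (insert 0 {n. n \<noteq> 0})"
    by (intro has_sum_insert) auto
  also have "insert 0 {n. n \<noteq> 0} = (UNIV :: int set)" by auto
  finally have "a = f 0 + b" using assms has_sum_unique by blast
  with b show ?thesis by simp
qed

lemma has_sum_finite_sum:
  fixes f :: "'b \<Rightarrow> 'a \<Rightarrow> 'c::topological_comm_monoid_add"
  assumes "finite A" "\<And>a. a \<in> A \<Longrightarrow> (f a has_sum s a) X"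
  shows "((\<lambda>x. \<Sum>a\<in>A. f a x) has_sum (\<Sum>a\<in>A. s a)) X"
  using assms by (induction A rule: finite_induct) (auto intro!: has_sum_add)

text \<open>This is the Eisenstein series G_2 without its row m = 0: the summand is the sum over n
  of 1/(m\<tau> + n)^2, so the rows are summed first.\<close>

definition csc_sum :: "complex \<Rightarrow> complex" where
  "csc_sum \<tau> = infsum (\<lambda>m::int. (of_real pi)\<^sup>2 / (sin (of_real pi * (of_int m * \<tau>)))\<^sup>2) {m. m \<noteq> 0}"

text \<open>Along a row the telescoping part has partial sums 1/(z - N) - 1/(z + N), which tend to
  0, so removing it leaves the sum of 1/(z + n)^2 unchanged.\<close>

lemma row_has_sum:
  assumes "Im \<tau> > 0" "m \<noteq> 0"
  shows "((\<lambda>n::int. 1 / ((of_int m * \<tau> + of_int n)\<^sup>2 * (of_int m * \<tau> + of_int n + 1))) has_sum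
    (of_real pi)\<^sup>2 / (sin (of_real pi * (of_int m * \<tau>)))\<^sup>2) UNIV"
proof -
  define z where "z = of_int m * \<tau>"
  have z: "z \<notin> \<int>" using of_int_mult_tau_notin_Ints[OF assms] by (simp add: z_def)
  have nz: "z + of_int n \<noteq> 0" for n using int_plus_notin_Ints_nonzero[OF z] .
  have nz': "z + of_int n + 1 \<noteq> 0" for n using nz[of "n+1"] by (simp add: add_ac)
  define f where "f = (\<lambda>n::int. 1 / ((z + of_int n)\<^sup>2 * (z + of_int n + 1)))"
  have c: "((\<lambda>n. 1 / (z + of_int n)\<^sup>2) has_sum (of_real pi)\<^sup>2 / (sin (of_real pi * z))\<^sup>2) UNIV"
    using csc_squared_has_sum[OF z] summable_on_row[OF assms] by (simp add: z_def)
  have "f summable_on UNIV"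
    using summable_on_SigmaD1[OF summable_on_lattice[OF assms(1)], of m] assms(2) by (simp add: f_def z_def)
  then have f: "(f has_sum infsum f UNIV) UNIV" by simp
  have "((\<lambda>n. 1 / (z + of_int n)\<^sup>2 + - f n) has_sum 
     ((of_real pi)\<^sup>2 / (sin (of_real pi * z))\<^sup>2 + - infsum f UNIV)) UNIV"
    using has_sum_add[OF c has_sum_uminusI[OF f]] .
  also have "(\<lambda>n. 1 / (z + of_int n)\<^sup>2 + - f n) = (\<lambda>n. 1 / (z + of_int n) - 1 / (z + of_int (n + 1)))"
  proof
    fix n
    have "1 / y\<^sup>2 + - (1 / (y\<^sup>2 * (y + 1))) = 1 / y - 1 / (y + 1)" if "y \<noteq> 0" "y + 1 \<noteq> 0" for y :: complex
      using that by (simp add: divide_simps power2_eq_square) (simp add: algebra_simps)?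
    from this[OF nz nz'] show "1 / (z + of_int n)\<^sup>2 + - f n = 1 / (z + of_int n) - 1 / (z + of_int (n + 1))"
      by (simp add: f_def add_ac)
  qed
  finally have "(\<lambda>N. \<Sum>n\<in>{-int N..<int N}. 1 / (z + of_int n) - 1 / (z + of_int (n + 1))) \<longlonglongrightarrow>
      (of_real pi)\<^sup>2 / (sin (of_real pi * z))\<^sup>2 + - infsum f UNIV"
    by (rule has_sum_int_symmetric)
  then have "(\<lambda>N. 1 / (z - of_nat N) - 1 / (z + of_nat N)) \<longlonglongrightarrow>
      (of_real pi)\<^sup>2 / (sin (of_real pi * z))\<^sup>2 + - infsum f UNIV"
    by (subst (asm) sum_telescope_int[where g = "\<lambda>n. 1 / (z + of_int n)"]) simp
  moreover have "(\<lambda>N. 1 / (z - of_nat N) - 1 / (z + of_nat N)) \<longlonglongrightarrow> 0 - 0"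
    by (intro tendsto_diff inverse_of_nat_add_tendsto_0)
  ultimately have "(of_real pi)\<^sup>2 / (sin (of_real pi * z))\<^sup>2 = infsum f UNIV"
    using LIMSEQ_unique by fastforce
  with f show ?thesis by (simp add: f_def z_def)
qed

lemma csc_sum_has_sum:
  assumes "Im \<tau> > 0"
  shows "((\<lambda>(m::int,n::int). 1 / ((of_int m * \<tau> + of_int n)\<^sup>2 * (of_int m * \<tau> + of_int n + 1)))
    has_sum csc_sum \<tau>) ({m. m \<noteq> 0} \<times> UNIV)"
  and "((\<lambda>m::int. (of_real pi)\<^sup>2 / (sin (of_real pi * (of_int m * \<tau>)))\<^sup>2) has_sum csc_sum \<tau>) {m. m \<noteq> 0}"
proof -
  define f where "f = (\<lambda>(m::int,n::int). 1 / ((of_int m * \<tau> + of_int n)\<^sup>2 * (of_int m * \<tau> + of_int n + 1)))"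
  obtain S where S: "(f has_sum S) ({m. m \<noteq> 0} \<times> UNIV)"
    using summable_on_lattice[OF assms] unfolding f_def summable_on_def by blast
  have "((\<lambda>m::int. (of_real pi)\<^sup>2 / (sin (of_real pi * (of_int m * \<tau>)))\<^sup>2) has_sum S) {m. m \<noteq> 0}"
    by (rule has_sum_SigmaD[OF S]) (use row_has_sum[OF assms] in \<open>auto simp: f_def\<close>)
  moreover from this have "S = csc_sum \<tau>" by (simp add: csc_sum_def infsumI)
  ultimately show "(f has_sum csc_sum \<tau>) ({m. m \<noteq> 0} \<times> UNIV)"
     "((\<lambda>m::int. (of_real pi)\<^sup>2 / (sin (of_real pi * (of_int m * \<tau>)))\<^sup>2) has_sum csc_sum \<tau>) {m. m \<noteq> 0}"
    using S by simp_all
qed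

lemma sum_inverse_squares_int:
  "((\<lambda>n::int. 1 / (of_int n)\<^sup>2) has_sum (complex_of_real (pi\<^sup>2 / 3))) {n. n \<noteq> 0}"
proof -
  have "((\<lambda>n. 1 / (real n + 1)\<^sup>2) has_sum (pi\<^sup>2 / 6)) UNIV"
    using inverse_squares_sums
    by (intro norm_summable_imp_has_sum) (auto simp: sums_iff norm_divide norm_power add_ac)
  then have "((\<lambda>n. complex_of_real (1 / (real n + 1)\<^sup>2)) has_sum (complex_of_real (pi\<^sup>2 / 6))) UNIV"
    by (subst has_sum_of_real_iff)
  then have 0: "((\<lambda>n. 1 / (of_nat (Suc n))\<^sup>2) has_sum (complex_of_real (pi\<^sup>2 / 6))) UNIV"
    by (simp add: add_ac)
  have "((\<lambda>n::int. 1 / (of_int n)\<^sup>2) has_sum 2 * complex_of_real (pi\<^sup>2 / 6)) {n. n \<noteq> 0}"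
    by (rule has_sum_int_even) (use 0 in simp_all)
  then show ?thesis by simp
qed

text \<open>The points N/\<tau> run off into the lower half-plane, where the cotangent tends to +i.
  This limit becomes the anomalous term in the transformation of G_2.\<close>

lemma cot_tendsto:
  assumes "Im \<tau> > 0"
  shows "(\<lambda>N. cot (of_real pi * (of_nat N / \<tau>))) \<longlonglongrightarrow> \<i>"
proof -
  define p where "p = exp (- (2 * \<i> * of_real pi / \<tau>))"
  have "Re (2 * \<i> * of_real pi / \<tau>) > 0"
    using assms by (auto simp: Re_divide power2_eq_square intro!: divide_pos_pos add_nonneg_pos mult_pos_pos)
  then have "norm p < 1" by (simp add: p_def norm_exp_eq_Re)
  then have p0: "(\<lambda>N. p ^ N) \<longlonglongrightarrow> 0" by (simp add: LIMSEQ_power_zero)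
  have ct: "cot (of_real pi * (of_nat N / \<tau>)) = \<i> * (1 + p ^ N) / (1 - p ^ N)" for N
  proof -
    define e where "e = exp (\<i> * (of_real pi * (of_nat N / \<tau>)))"
    have pe: "p ^ N = (inverse e)\<^sup>2"
      unfolding p_def e_def exp_minus[symmetric] exp_of_nat_mult[symmetric] exp_of_nat2_mult[symmetric] 
      by (simp add: exp_double[symmetric] mult_ac)
    have e: "e \<noteq> 0" by (simp add: e_def)
    have cs: "cos (of_real pi * (of_nat N / \<tau>)) = (e + inverse e) / 2" 
      "sin (of_real pi * (of_nat N / \<tau>)) = - \<i> * (e - inverse e) / 2"
      by (simp_all add: cos_exp_eq sin_exp_eq e_def exp_minus del: exp_of_nat_mult) 
    have "cot (of_real pi * (of_nat N / \<tau>)) = \<i> * ((e + inverse e) / (e - inverse e))"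
    proof -
      have "(A / 2) / (- \<i> * B / 2) = \<i> * (A / B)" for A B :: complex
        by (cases "B = 0") (simp_all add: field_simps)
      then show ?thesis unfolding cot_def cs .
    qed
    also have "(e + inverse e) / (e - inverse e) = (inverse e * (e + inverse e)) / (inverse e * (e - inverse e))"
      using e by (subst mult_divide_mult_cancel_left) auto
    also have "\<dots> = (1 + p ^ N) / (1 - p ^ N)"
      using e by (simp add: pe power2_eq_square distrib_left right_diff_distrib)
    finally show ?thesis by simp
  qed
  have "(\<lambda>N. \<i> * (1 + p ^ N) / (1 - p ^ N)) \<longlonglongrightarrow> \<i> * (1 + 0) / (1 - 0)"
    by (intro tendsto_intros p0) auto
  then show ?thesis unfolding ct by simp
qed

text \<open>Eisenstein's argument: subtracting telescoping terms makes the double series absolutely convergent.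
  They vanish when summed along rows, but contribute \<open>2\<pi>i/\<tau>\<close> when summed along columns.\<close>

lemma csc_sum_transform:
  assumes "Im \<tau> > 0"
  shows "csc_sum \<tau> = csc_sum (-1/\<tau>) / \<tau>\<^sup>2 - of_real (pi\<^sup>2 / 3) + of_real (pi\<^sup>2 / 3) / \<tau>\<^sup>2 + 2 * of_real pi * \<i> / \<tau>"
proof -
  define I where "I = {m::int. m \<noteq> 0}"
  define Z where "Z = complex_of_real (pi\<^sup>2 / 3)"
  have \<tau>0: "\<tau> \<noteq> 0" using assms by auto
  define \<sigma> where "\<sigma> = -1/\<tau>"
  have \<sigma>: "Im \<sigma> > 0" using assms by (auto simp: \<sigma>_def Im_divide power2_eq_square intro!: divide_pos_pos add_nonneg_pos)
  have nz: "of_int m * \<tau> + of_int n \<noteq> 0" if "m \<in> I" for m n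
    using int_plus_notin_Ints_nonzero[OF of_int_mult_tau_notin_Ints[OF assms]] that by (auto simp: I_def)
  have nz': "of_int m * \<tau> + of_int n + 1 \<noteq> 0" if "m \<in> I" for m n
    using nz[OF that, of "n+1"] by (simp add: add_ac)
  define c where "c = (\<lambda>z. (of_real pi)\<^sup>2 / (sin (of_real pi * z))\<^sup>2 :: complex)"
  define f where "f = (\<lambda>(m::int,n::int). 1 / ((of_int m * \<tau> + of_int n)\<^sup>2 * (of_int m * \<tau> + of_int n + 1)))"
  have F: "((\<lambda>(n,m). f (m,n)) has_sum csc_sum \<tau>) (UNIV \<times> I)"
    using csc_sum_has_sum(1)[OF assms] unfolding f_def[symmetric] I_def by (subst (asm) has_sum_swap)
  \<comment> \<open>Column n of the plain series. Factoring \<tau> out of m\<tau> + n turns it, up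
    to sign, into a row for -1/\<tau>; the term m = 0 of that row is taken off again, and column 0
    is a multiple of the sum of 1/m^2.\<close>
  define r where "r = (\<lambda>n::int. if n = 0 then Z / \<tau>\<^sup>2 else c (of_int n * \<sigma>) / \<tau>\<^sup>2 - 1 / (of_int n)\<^sup>2)"
  have r: "((\<lambda>m. 1 / (of_int m * \<tau> + of_int n)\<^sup>2) has_sum r n) I" for n
  proof (cases "n = 0")
    case True
    have "((\<lambda>m. 1 / (of_int m)\<^sup>2 / \<tau>\<^sup>2) has_sum (Z / \<tau>\<^sup>2)) I"
      unfolding I_def Z_def by (intro has_sum_divide_const sum_inverse_squares_int)
    then show ?thesis using True by (simp add: r_def power_mult_distrib)
  next
    case False
    have z: "of_int n * \<sigma> \<notin> \<int>" using of_int_mult_tau_notin_Ints[OF \<sigma> False] .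
    have "((\<lambda>m. 1 / (of_int n * \<sigma> + of_int m)\<^sup>2) has_sum c (of_int n * \<sigma>)) UNIV"
      unfolding c_def by (intro csc_squared_has_sum z summable_on_row \<sigma> False)
    also have "?this \<longleftrightarrow> ((\<lambda>m. 1 / (of_int n * \<sigma> - of_int m)\<^sup>2) has_sum c (of_int n * \<sigma>)) UNIV"
      by (rule has_sum_reindex_bij_witness[of _ uminus uminus]) auto
    finally have "((\<lambda>m. 1 / (of_int n * \<sigma> - of_int m)\<^sup>2 / \<tau>\<^sup>2) has_sum c (of_int n * \<sigma>) / \<tau>\<^sup>2) UNIV"
      by (rule has_sum_divide_const)
    also have "(\<lambda>m. 1 / (of_int n * \<sigma> - of_int m)\<^sup>2 / \<tau>\<^sup>2) = (\<lambda>m. 1 / (of_int m * \<tau> + of_int n)\<^sup>2)"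
    proof
      fix m
      have "of_int m * \<tau> + of_int n = - (\<tau> * (of_int n * \<sigma> - of_int m))"
        using \<tau>0 by (simp add: \<sigma>_def field_simps)
      then show "1 / (of_int n * \<sigma> - of_int m)\<^sup>2 / \<tau>\<^sup>2 = 1 / (of_int m * \<tau> + of_int n)\<^sup>2"
        by (simp only: power2_minus power_mult_distrib) (simp add: mult_ac)
    qed
    finally have *: "((\<lambda>m. 1 / (of_int m * \<tau> + of_int n)\<^sup>2) has_sum c (of_int n * \<sigma>) / \<tau>\<^sup>2) UNIV" .
    from has_sum_int_remove_0[OF this] show ?thesis using False by (simp add: r_def I_def)
  qed
  have rsum: "(r has_sum (Z / \<tau>\<^sup>2 + (csc_sum \<sigma> / \<tau>\<^sup>2 - Z))) UNIV"
  proof -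
    have "((\<lambda>n. c (of_int n * \<sigma>) / \<tau>\<^sup>2 + - (1 / (of_int n)\<^sup>2)) has_sum (csc_sum \<sigma> / \<tau>\<^sup>2 + - Z)) {n. n \<noteq> 0}"
      unfolding c_def Z_def
      by (intro has_sum_add has_sum_divide_const csc_sum_has_sum(2)[OF \<sigma>] has_sum_uminusI sum_inverse_squares_int)
    also have "?this \<longleftrightarrow> (r has_sum (csc_sum \<sigma> / \<tau>\<^sup>2 + - Z)) {n. n \<noteq> 0}"
      by (rule has_sum_cong) (auto simp: r_def)
    finally have "(r has_sum (r 0 + (csc_sum \<sigma> / \<tau>\<^sup>2 + - Z))) (insert 0 {n. n \<noteq> 0})"
      by (intro has_sum_insert) auto
    moreover have "insert 0 {n. n \<noteq> 0} = (UNIV :: int set)" by auto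
    ultimately show ?thesis by (simp add: r_def)
  qed
  define t where "t = (\<lambda>n. infsum (\<lambda>m. 1 / (of_int m * \<tau> + of_int n) - 1 / (of_int m * \<tau> + of_int (n + 1))) I)"
  have part: "1 / y\<^sup>2 + - (1 / (y\<^sup>2 * (y + 1))) = 1 / y - 1 / (y + 1)" if "y \<noteq> 0" "y + 1 \<noteq> 0" for y :: complex
    using that by (simp add: divide_simps power2_eq_square) (simp add: algebra_simps)?
  have col: "((\<lambda>m. f (m,n)) has_sum (r n - t n)) I" 
     and t: "((\<lambda>m. 1 / (of_int m * \<tau> + of_int n) - 1 / (of_int m * \<tau> + of_int (n + 1))) has_sum t n) I" for n
  proof -
    have "(\<lambda>m. f (m,n)) summable_on I"
      using summable_on_SigmaD1[of "\<lambda>n m. f (m,n)" UNIV "\<lambda>_. I" n] F summable_on_def by auto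
    then obtain S where S: "((\<lambda>m. f (m,n)) has_sum S) I" by (auto simp: summable_on_def)
    have "((\<lambda>m. 1 / (of_int m * \<tau> + of_int n)\<^sup>2 + - f (m,n)) has_sum (r n + - S)) I"
      by (intro has_sum_add r has_sum_uminusI S)
    also have "?this \<longleftrightarrow> ((\<lambda>m. 1 / (of_int m * \<tau> + of_int n) - 1 / (of_int m * \<tau> + of_int (n + 1))) has_sum (r n + - S)) I"
    proof (rule has_sum_cong)
      fix m assume "m \<in> I"
      from part[OF nz[OF this, of n] nz'[OF this, of n]]
      show "1 / (of_int m * \<tau> + of_int n)\<^sup>2 + - f (m,n) = 1 / (of_int m * \<tau> + of_int n) - 1 / (of_int m * \<tau> + of_int (n + 1))"
        by (simp only: f_def prod.case of_int_add of_int_1 add.assoc)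
    qed
    finally have T: "((\<lambda>m. 1 / (of_int m * \<tau> + of_int n) - 1 / (of_int m * \<tau> + of_int (n + 1))) has_sum (r n + - S)) I" .
    then have "t n = r n + - S" unfolding t_def by (rule infsumI)
    then show "((\<lambda>m. f (m,n)) has_sum (r n - t n)) I" 
      "((\<lambda>m. 1 / (of_int m * \<tau> + of_int n) - 1 / (of_int m * \<tau> + of_int (n + 1))) has_sum t n) I"
      using S T by simp_all
  qed
  have "((\<lambda>n. r n - t n) has_sum csc_sum \<tau>) UNIV"
    by (rule has_sum_SigmaD[OF F]) (use col in auto)
  from has_sum_add[OF rsum has_sum_uminusI[OF this]]
  have tsum: "(t has_sum (Z / \<tau>\<^sup>2 + (csc_sum \<sigma> / \<tau>\<^sup>2 - Z) - csc_sum \<tau>)) UNIV" by simp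
  \<comment> \<open>Summing over n before m collapses the inner sum; what is left is the partial
    fraction expansion of the cotangent at N/\<tau>.\<close>
  have pt: "(\<Sum>n\<in>{-int N..<int N}. t n) = 2 * (1 / of_nat N - of_real pi / \<tau> * cot (of_real pi * (of_nat N / \<tau>)))" 
    if "N > 0" for N
  proof -
    define z where "z = of_nat N / \<tau>"
    have zI: "z \<notin> \<int>"
    proof
      assume "z \<in> \<int>"
      then have "of_int (int N) * \<sigma> \<in> \<int>" using Ints_minus by (fastforce simp: z_def \<sigma>_def)
      then show False using of_int_mult_tau_notin_Ints[OF \<sigma>, of "int N"] that by simp
    qed
    have "((\<lambda>m. \<Sum>n\<in>{-int N..<int N}. 1 / (of_int m * \<tau> + of_int n) - 1 / (of_int m * \<tau> + of_int (n + 1)))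
       has_sum (\<Sum>n\<in>{-int N..<int N}. t n)) I"
      by (intro has_sum_finite_sum t) auto
    then have "((\<lambda>m. 1 / (of_int m * \<tau> - of_nat N) - 1 / (of_int m * \<tau> + of_nat N)) has_sum (\<Sum>n\<in>{-int N..<int N}. t n)) I"
      by (subst (asm) sum_telescope_int[where g = "\<lambda>n. 1 / (of_int m * \<tau> + of_int n)" for m]) simp
    then have "((\<lambda>m. \<tau> * (1 / (of_int m * \<tau> - of_nat N) - 1 / (of_int m * \<tau> + of_nat N))) 
       has_sum (\<tau> * (\<Sum>n\<in>{-int N..<int N}. t n))) I"
      by (rule has_sum_cmult_right)
    also have "(\<lambda>m. \<tau> * (1 / (of_int m * \<tau> - of_nat N) - 1 / (of_int m * \<tau> + of_nat N))) =
      (\<lambda>m. 1 / (of_int m - z) - 1 / (of_int m + z))"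
    proof
      fix m
      have cancel: "\<tau> * (1 / (\<tau> * a) - 1 / (\<tau> * b)) = 1 / a - 1 / b" for a b
        using \<tau>0 by (simp add: right_diff_distrib)
      have eqs: "of_int m * \<tau> - of_nat N = \<tau> * (of_int m - z)" "of_int m * \<tau> + of_nat N = \<tau> * (of_int m + z)"
        using \<tau>0 by (auto simp: z_def field_simps)
      show "\<tau> * (1 / (of_int m * \<tau> - of_nat N) - 1 / (of_int m * \<tau> + of_nat N)) = 1 / (of_int m - z) - 1 / (of_int m + z)"
        unfolding eqs by (rule cancel)
    qed
    finally have "\<tau> * (\<Sum>n\<in>{-int N..<int N}. t n) = 2 * (1 / z - of_real pi * cot (of_real pi * z))"
      unfolding I_def by (rule cot_has_sum[OF zI])
    then show ?thesis using \<tau>0 that by (simp add: z_def field_simps)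
  qed
  have "(\<lambda>N. \<Sum>n\<in>{-int N..<int N}. t n) \<longlonglongrightarrow> Z / \<tau>\<^sup>2 + (csc_sum \<sigma> / \<tau>\<^sup>2 - Z) - csc_sum \<tau>"
    using tsum by (rule has_sum_int_symmetric)
  moreover have "(\<lambda>N. \<Sum>n\<in>{-int N..<int N}. t n) \<longlonglongrightarrow> 2 * (0 - of_real pi / \<tau> * \<i>)"
  proof (rule Lim_transform_eventually)
    show "(\<lambda>N. 2 * (1 / of_nat N - of_real pi / \<tau> * cot (of_real pi * (of_nat N / \<tau>)))) \<longlonglongrightarrow> 2 * (0 - of_real pi / \<tau> * \<i>)"
    proof -
      have "(\<lambda>N. 1 / complex_of_nat N) \<longlonglongrightarrow> 0" using inverse_of_nat_add_tendsto_0(1)[of 0] by simp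
      then show ?thesis by (intro tendsto_intros cot_tendsto[OF assms])
    qed
    show "\<forall>\<^sub>F N in sequentially. 2 * (1 / of_nat N - of_real pi / \<tau> * cot (of_real pi * (of_nat N / \<tau>))) = (\<Sum>n\<in>{-int N..<int N}. t n)"
      using eventually_gt_at_top[of 0] by eventually_elim (simp add: pt)
  qed
  ultimately have "Z / \<tau>\<^sup>2 + (csc_sum \<sigma> / \<tau>\<^sup>2 - Z) - csc_sum \<tau> = 2 * (0 - of_real pi / \<tau> * \<i>)"
    by (rule LIMSEQ_unique)
  then show ?thesis unfolding Z_def \<sigma>_def by (simp add: algebra_simps)
qed

subsection \<open>The discriminant and the Eisenstein series of weight four\<close>

lemma open_upper_half_plane: "open upper_half_plane"
  unfolding upper_half_plane_def by (rule open_halfspace_Im_gt)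

lemma upper_half_plane_neg_inverse:
  assumes "\<tau> \<in> upper_half_plane"
  shows "-1 / \<tau> \<in> upper_half_plane"
  using assms by (auto simp: upper_half_plane_def Im_divide power2_eq_square intro!: divide_pos_pos add_nonneg_pos)

section \<open>The nome and the Eisenstein series of weight two on the unit disc\<close>

definition nome :: "complex \<Rightarrow> complex" where
  "nome \<tau> = exp (2 * of_real pi * \<i> * \<tau>)"

lemma nome_nonzero [simp]: "nome \<tau> \<noteq> 0"
  by (simp add: nome_def)

lemma norm_nome: "norm (nome \<tau>) = exp (- 2 * pi * Im \<tau>)"
  by (simp add: nome_def norm_exp_eq_Re)

lemma nome_in_ball: "\<tau> \<in> upper_half_plane \<Longrightarrow> nome \<tau> \<in> ball 0 1"
  by (simp add: norm_nome upper_half_plane_def)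

lemma nome_plus_1: "nome (\<tau> + 1) = nome \<tau>"
  by (simp add: nome_def distrib_left exp_add)

lemma has_field_derivative_nome:
  "(nome has_field_derivative 2 * of_real pi * \<i> * nome \<tau>) (at \<tau> within S)"
  unfolding nome_def by (auto intro!: derivative_eq_intros)

lemma holomorphic_on_nome: "nome holomorphic_on S"
  unfolding nome_def by (intro holomorphic_intros)

text \<open>G_2 as a function of the nome q, including the cusp q = 0. The constant term is 2
  zeta(2), and 8 pi^2 is twice the factor 4 pi^2 of \<open>csc_nome\<close>, for the two signs of
  m.\<close>

definition eisen2_disc :: "complex \<Rightarrow> complex" where
  "eisen2_disc q = of_real (pi\<^sup>2 / 3) - 8 * of_real (pi\<^sup>2) * (\<Sum>n. q ^ Suc n / (1 - q ^ Suc n)\<^sup>2)"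

lemma eisen2_term_bound:
  fixes q :: complex
  assumes "norm q \<le> r" "r < 1"
  shows "norm (q ^ Suc n / (1 - q ^ Suc n)\<^sup>2) \<le> r ^ Suc n / (1 - r)\<^sup>2"
proof -
  have r0: "0 \<le> r" using assms norm_ge_zero order_trans by blast
  have q: "norm (q ^ Suc n) \<le> r ^ Suc n" 
    unfolding norm_power by (intro power_mono assms) auto
  have "r ^ Suc n \<le> r ^ 1" using r0 assms by (intro power_decreasing) auto
  then have "1 - r \<le> 1 - norm (q ^ Suc n)" using q by simp
  also have "\<dots> \<le> norm (1 - q ^ Suc n)" by (metis norm_one norm_triangle_ineq2)
  finally have "(1 - r)\<^sup>2 \<le> (norm (1 - q ^ Suc n))\<^sup>2" using assms by (intro power_mono) auto
  then show ?thesis using assms q r0 unfolding norm_divide norm_power[of _ 2]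
    by (intro frac_le) auto
qed

lemma summable_eisen2_bound: "0 \<le> r \<Longrightarrow> r < 1 \<Longrightarrow> summable (\<lambda>n. r ^ Suc n / (1 - r)\<^sup>2 :: real)"
  by (intro summable_divide summable_ignore_initial_segment[of "\<lambda>n. r ^ n" 1, simplified] summable_geometric) auto

lemma holomorphic_eisen2_disc: "eisen2_disc holomorphic_on ball 0 1"
proof -
  have "(\<lambda>q. \<Sum>n. q ^ Suc n / (1 - q ^ Suc n)\<^sup>2) holomorphic_on ball (0::complex) 1"
  proof (rule holomorphic_uniform_sequence[where f = "\<lambda>N q. \<Sum>n<N. q ^ Suc n / (1 - q ^ Suc n)\<^sup>2"])
    fix N
    have "1 - q ^ Suc n \<noteq> 0" if "q \<in> ball 0 1" for q :: complex and n
    proof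
      assume "1 - q ^ Suc n = 0"
      then have "norm (q ^ Suc n) = 1" by simp
      moreover have "norm q ^ Suc n < 1" using that by (intro power_less_one_iff[THEN iffD2]) auto
      ultimately show False by (simp add: norm_power norm_mult)
    qed
    then show "(\<lambda>q. \<Sum>n<N. q ^ Suc n / (1 - q ^ Suc n)\<^sup>2) holomorphic_on ball (0::complex) 1"
      by (intro holomorphic_intros) auto
  next
    fix x :: complex assume x: "x \<in> ball 0 1"
    define d where "d = (1 - norm x) / 2"
    have d: "d > 0" "norm x + d < 1" using x by (auto simp: d_def field_simps)
    have sub: "norm y \<le> norm x + d" if "y \<in> cball x d" for y
      using that norm_triangle_ineq2[of y x] by (auto simp: dist_norm norm_minus_commute)
    show "\<exists>d>0. cball x d \<subseteq> ball 0 1 \<and>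
      uniform_limit (cball x d) (\<lambda>N q. \<Sum>n<N. q ^ Suc n / (1 - q ^ Suc n)\<^sup>2) (\<lambda>q. \<Sum>n. q ^ Suc n / (1 - q ^ Suc n)\<^sup>2) sequentially"
    proof (intro exI conjI)
      show "cball x d \<subseteq> ball 0 1" using sub d by fastforce
      show "uniform_limit (cball x d) (\<lambda>N q. \<Sum>n<N. q ^ Suc n / (1 - q ^ Suc n)\<^sup>2) (\<lambda>q. \<Sum>n. q ^ Suc n / (1 - q ^ Suc n)\<^sup>2) sequentially"
        by (rule Weierstrass_m_test[OF eisen2_term_bound[OF sub d(2)] summable_eisen2_bound]) (use d in auto)
    qed (use d in auto)
  qed auto
  then show ?thesis unfolding eisen2_disc_def[abs_def] by (intro holomorphic_intros)
qed

lemma eisen2_disc_0: "eisen2_disc 0 = of_real (pi\<^sup>2 / 3)"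
  by (simp add: eisen2_disc_def)

lemma csc_nome:
  assumes "Im z > 0"
  shows "(of_real pi)\<^sup>2 / (sin (of_real pi * z))\<^sup>2 = - 4 * of_real (pi\<^sup>2) * (nome z / (1 - nome z)\<^sup>2)"
proof -
  define e where "e = exp (\<i> * (of_real pi * z))"
  have e: "e \<noteq> 0" by (simp add: e_def)
  have q: "nome z = e\<^sup>2" unfolding nome_def e_def exp_double[symmetric] by (simp add: mult_ac)
  have "norm (nome z) < 1" using assms by (simp add: norm_nome)
  then have ne: "e\<^sup>2 \<noteq> 1" using q by auto
  define X where "X = inverse e * (1 - e\<^sup>2)"
  have "sin (of_real pi * z) = - \<i> * (e - inverse e) / 2"
    by (simp add: sin_exp_eq e_def exp_minus)
  also have "e - inverse e = - (inverse e * (1 - e\<^sup>2))"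
    using e by (simp add: power2_eq_square algebra_simps)
  finally have sn: "sin (of_real pi * z) = \<i> * X / 2" by (simp add: X_def)
  have "(sin (of_real pi * z))\<^sup>2 = - (X\<^sup>2 / 4)"
    unfolding sn by (simp add: power_mult_distrib power_divide)
  moreover have "X\<^sup>2 = (1 - e\<^sup>2)\<^sup>2 / e\<^sup>2"
    unfolding X_def by (simp add: power_mult_distrib power_inverse divide_inverse mult.commute)
  ultimately have sn2: "(sin (of_real pi * z))\<^sup>2 = - ((1 - e\<^sup>2)\<^sup>2 / (4 * e\<^sup>2))" by simp
  show ?thesis unfolding sn2 q using e ne by (simp add: field_simps)
qed

lemma eisen2_disc_nome:
  assumes "Im \<tau> > 0"
  shows "eisen2_disc (nome \<tau>) = of_real (pi\<^sup>2 / 3) + csc_sum \<tau>"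
proof -
  define c where "c = (\<lambda>m::int. (of_real pi)\<^sup>2 / (sin (of_real pi * (of_int m * \<tau>)))\<^sup>2)"
  have S: "(c has_sum csc_sum \<tau>) {m. m \<noteq> 0}"
    using csc_sum_has_sum(2)[OF assms] by (simp add: c_def)
  have ev: "c (- m) = c m" for m by (simp add: c_def)
  have "(\<lambda>n. c (int (Suc n))) sums (csc_sum \<tau> / 2)" by (rule has_sum_int_evenD[OF ev S])
  also have "(\<lambda>n. c (int (Suc n))) = (\<lambda>n. - 4 * of_real (pi\<^sup>2) * (nome \<tau> ^ Suc n / (1 - nome \<tau> ^ Suc n)\<^sup>2))"
  proof
    fix n
    have "nome (of_nat (Suc n) * \<tau>) = nome \<tau> ^ Suc n"
      unfolding nome_def exp_of_nat_mult[symmetric] by (simp add: mult_ac)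
    then show "c (int (Suc n)) = - 4 * of_real (pi\<^sup>2) * (nome \<tau> ^ Suc n / (1 - nome \<tau> ^ Suc n)\<^sup>2)"
      using csc_nome[of "of_nat (Suc n) * \<tau>"] assms unfolding c_def by (simp only: of_int_of_nat_eq) simp
  qed
  finally have 1: "(\<lambda>n. - 4 * of_real (pi\<^sup>2) * (nome \<tau> ^ Suc n / (1 - nome \<tau> ^ Suc n)\<^sup>2)) sums (csc_sum \<tau> / 2)" .
  have "summable (\<lambda>n. nome \<tau> ^ Suc n / (1 - nome \<tau> ^ Suc n)\<^sup>2)"
    by (rule summable_comparison_test'[OF summable_eisen2_bound[of "norm (nome \<tau>)"] eisen2_term_bound])
       (use assms in \<open>auto simp: norm_nome\<close>)
  then have "(\<lambda>n. - 4 * of_real (pi\<^sup>2) * (nome \<tau> ^ Suc n / (1 - nome \<tau> ^ Suc n)\<^sup>2)) sums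
      (- 4 * of_real (pi\<^sup>2) * (\<Sum>n. nome \<tau> ^ Suc n / (1 - nome \<tau> ^ Suc n)\<^sup>2))"
    by (intro sums_mult summable_sums)
  then have "csc_sum \<tau> / 2 = - 4 * of_real (pi\<^sup>2) * (\<Sum>n. nome \<tau> ^ Suc n / (1 - nome \<tau> ^ Suc n)\<^sup>2)"
    using 1 sums_unique2 by blast
  then show ?thesis by (simp add: eisen2_disc_def)
qed

definition eisen2 :: "complex \<Rightarrow> complex" where
  "eisen2 \<tau> = eisen2_disc (nome \<tau>)"

text \<open>The linear term measures the failure of G_2 to be modular; integrated, it becomes the
  weight of the discriminant.\<close>

lemma eisen2_transform:
  assumes "\<tau> \<in> upper_half_plane"
  shows "eisen2 (-1 / \<tau>) = \<tau>\<^sup>2 * eisen2 \<tau> - 2 * of_real pi * \<i> * \<tau>"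
proof -
  have t: "Im \<tau> > 0" "\<tau> \<noteq> 0" using assms by (auto simp: upper_half_plane_def)
  have s: "Im (-1/\<tau>) > 0" using upper_half_plane_neg_inverse[OF assms] by (simp add: upper_half_plane_def)
  show ?thesis
    unfolding eisen2_def eisen2_disc_nome[OF t(1)] eisen2_disc_nome[OF s] csc_sum_transform[OF t(1)]
    using t(2) by (simp add: field_simps power2_eq_square)
qed

section \<open>The zero-free discriminant\<close>

lemma factor_zero_disc:
  assumes "f holomorphic_on ball 0 1" "f 0 = 0"
  obtains g where "g holomorphic_on ball 0 1" "\<And>q. q \<in> ball 0 1 \<Longrightarrow> f q = q * g q"
  using Schwarz3[OF assms] by (auto simp: dist_norm)

text \<open>The logarithmic derivative of Delta is 2 pi i E_2, and E_2 = (3/pi^2) G_2. The primitive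
  is formed on the disc: the part of G_2 vanishing at q = 0 is divided by q and integrated there,
  while the constant term integrates to 2 pi i \<tau>, that is, to the factor q of D.\<close>

lemma ex_discriminant:
  obtains D u where "D holomorphic_on upper_half_plane" "u holomorphic_on ball 0 1"
    "\<And>q. q \<in> ball 0 1 \<Longrightarrow> u q \<noteq> 0"
    "\<And>\<tau>. D \<tau> = nome \<tau> * u (nome \<tau>)"
    "\<And>\<tau>. \<tau> \<in> upper_half_plane \<Longrightarrow> D (-1 / \<tau>) = \<tau> ^ 12 * D \<tau>"
proof -
  have "(\<lambda>q. eisen2_disc q - of_real (pi\<^sup>2 / 3)) holomorphic_on ball 0 1"
    by (intro holomorphic_intros holomorphic_eisen2_disc)
  then obtain \<psi> where \<psi>: "\<psi> holomorphic_on ball 0 1" 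
     "\<And>q. q \<in> ball 0 1 \<Longrightarrow> eisen2_disc q - of_real (pi\<^sup>2 / 3) = q * \<psi> q"
    by (rule factor_zero_disc) (use eisen2_disc_0 in auto)
  obtain \<Psi> where \<Psi>: "\<And>q. q \<in> ball 0 1 \<Longrightarrow> (\<Psi> has_field_derivative \<psi> q) (at q within ball 0 1)"
    using holomorphic_convex_primitive'[OF _ _ \<psi>(1)] by auto
  then have \<Psi>': "(\<Psi> has_field_derivative \<psi> q) (at q)" if "q \<in> ball 0 1" for q
    using that by (metis at_within_open open_ball)
  define l where "l = (\<lambda>\<tau>. 2 * of_real pi * \<i> * \<tau> + of_real (3 / pi\<^sup>2) * \<Psi> (nome \<tau>))"
  have l': "(l has_field_derivative (6 * \<i> / of_real pi * eisen2 \<tau>)) (at \<tau>)" if "\<tau> \<in> upper_half_plane" for \<tau>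
  proof -
    have "((\<lambda>\<tau>. \<Psi> (nome \<tau>)) has_field_derivative \<psi> (nome \<tau>) * (2 * of_real pi * \<i> * nome \<tau>)) (at \<tau>)"
      by (rule DERIV_chain2[OF \<Psi>' has_field_derivative_nome]) (use nome_in_ball that in auto)
    from DERIV_add[OF DERIV_cmult_Id[of "2 * of_real pi * \<i>"] DERIV_cmult[OF this, of "of_real (3 / pi\<^sup>2)"]]
    have "(l has_field_derivative (2 * of_real pi * \<i> + of_real (3 / pi\<^sup>2) * (\<psi> (nome \<tau>) * (2 * of_real pi * \<i> * nome \<tau>)))) (at \<tau>)"
      unfolding l_def .
    also have "2 * of_real pi * \<i> + of_real (3 / pi\<^sup>2) * (\<psi> (nome \<tau>) * (2 * of_real pi * \<i> * nome \<tau>)) = 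
      6 * \<i> / of_real pi * (of_real (pi\<^sup>2 / 3) + nome \<tau> * \<psi> (nome \<tau>))"
      by (simp add: field_simps power2_eq_square)
    also have "of_real (pi\<^sup>2 / 3) + nome \<tau> * \<psi> (nome \<tau>) = eisen2 \<tau>"
      using \<psi>(2)[OF nome_in_ball[OF that]] by (simp add: eisen2_def algebra_simps)
    finally show ?thesis .
  qed
  define D where "D = (\<lambda>\<tau>. exp (l \<tau>))"
  define u where "u = (\<lambda>q. exp (of_real (3 / pi\<^sup>2) * \<Psi> q))"
  show ?thesis
  proof (rule that)
    have "l holomorphic_on upper_half_plane"
      using l' open_upper_half_plane by (meson field_differentiable_at_within field_differentiable_def holomorphic_onI)
    then show "D holomorphic_on upper_half_plane" unfolding D_def by (intro holomorphic_intros)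
    have "\<Psi> holomorphic_on ball 0 1" using \<Psi> by (meson field_differentiable_def holomorphic_onI)
    then show "u holomorphic_on ball 0 1" unfolding u_def by (intro holomorphic_intros)
    show "u q \<noteq> 0" for q by (simp add: u_def)
    show "D \<tau> = nome \<tau> * u (nome \<tau>)" for \<tau>
      by (simp add: D_def u_def l_def exp_add nome_def)
    fix \<tau> assume \<tau>: "\<tau> \<in> upper_half_plane"
    \<comment> \<open>A constant: the anomaly of \<open>eisen2\<close> contributes 12/z to the
      derivative, which 12 \<open>Ln\<close> cancels. The fixed point i of z to -1/z gives the value
      -6 pi i, whose exponential is 1.\<close>
    define F where "F = (\<lambda>\<tau>. l (-1 / \<tau>) - l \<tau> - 12 * Ln \<tau>)"
    have "\<exists>c. \<forall>z\<in>upper_half_plane. F z = c"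
    proof (rule has_field_derivative_zero_constant)
      show "convex upper_half_plane" unfolding upper_half_plane_def by (rule convex_halfspace_Im_gt)
      fix z assume z: "z \<in> upper_half_plane"
      have z0: "z \<noteq> 0" "z \<notin> \<real>\<^sub>\<le>\<^sub>0" using z by (auto simp: upper_half_plane_def complex_nonpos_Reals_iff)
      have "((\<lambda>z. l (-1 / z)) has_field_derivative (6 * \<i> / of_real pi * eisen2 (-1 / z)) * (1 / z\<^sup>2)) (at z)"
        by (rule DERIV_chain2[where f = l and g = "\<lambda>z. -1 / z", OF l'[OF upper_half_plane_neg_inverse[OF z]]])
           (use z0 in \<open>auto intro!: derivative_eq_intros simp: power2_eq_square\<close>)
      then have "(F has_field_derivative ((6 * \<i> / of_real pi * eisen2 (-1 / z)) * (1 / z\<^sup>2) - 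
          (6 * \<i> / of_real pi * eisen2 z) - 12 * (1 / z))) (at z)"
        unfolding F_def using z0 by (auto intro!: derivative_eq_intros l' z simp: inverse_eq_divide)
      also have "((6 * \<i> / of_real pi * eisen2 (-1 / z)) * (1 / z\<^sup>2) - 
          (6 * \<i> / of_real pi * eisen2 z) - 12 * (1 / z)) = 0"
        unfolding eisen2_transform[OF z] using z0 by (simp add: field_simps power2_eq_square)
      finally show "(F has_field_derivative 0) (at z within upper_half_plane)"
        by (rule has_field_derivative_at_within)
    qed
    then obtain c where c: "\<And>z. z \<in> upper_half_plane \<Longrightarrow> F z = c" by blast
    have "F \<i> = c" using c by (simp add: upper_half_plane_def)
    then have "F \<tau> = - 6 * of_real pi * \<i>" using c[OF \<tau>] by (simp add: F_def mult_ac)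
    then have l_eq: "l (-1 / \<tau>) = - 6 * of_real pi * \<i> + (l \<tau> + 12 * Ln \<tau>)" by (simp add: F_def algebra_simps)
    have "D (-1 / \<tau>) = exp (- 6 * of_real pi * \<i>) * (D \<tau> * exp (of_nat 12 * Ln \<tau>))"
      unfolding D_def l_eq exp_add by simp
    also have "exp (- 6 * of_real pi * \<i>) = (1::complex)"
      using exp_integer_2pi[of "-3"] by (simp add: mult_ac)
    also have "exp (of_nat 12 * Ln \<tau>) = \<tau> ^ 12"
    proof -
      have "\<tau> \<noteq> 0" using \<tau> by (auto simp: upper_half_plane_def)
      then show ?thesis by (subst exp_of_nat_mult) simp
    qed
    finally show "D (-1 / \<tau>) = \<tau> ^ 12 * D \<tau>" by simp
  qed
qed

text \<open>By Ramanujan's identity, \<open>e\<close> is a multiple of the usual series \<open>E\<^sub>4\<close>; differentiating the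
  transformation law of \<open>E\<^sub>2\<close> gives its modularity.\<close>

lemma ex_eisen4:
  obtains e where "e holomorphic_on ball 0 1" "e 0 \<noteq> 0"
    "\<And>\<tau>. \<tau> \<in> upper_half_plane \<Longrightarrow> e (nome (-1 / \<tau>)) = \<tau> ^ 4 * e (nome \<tau>)"
proof -
  \<comment> \<open>With E_2 = (3/pi^2) G_2, Ramanujan's identity q dE_2/dq = (E_2^2 - E_4)/12 makes
    this (pi^4/9) E_4.\<close>
  define e where "e = (\<lambda>q. (eisen2_disc q)\<^sup>2 - 4 * (of_real pi)\<^sup>2 * (q * deriv eisen2_disc q))"
  define g where "g = (\<lambda>\<tau>. 2 * of_real pi * \<i> * (nome \<tau> * deriv eisen2_disc (nome \<tau>)))"
  have e: "e (nome \<tau>) = (eisen2 \<tau>)\<^sup>2 + 2 * of_real pi * \<i> * g \<tau>" for \<tau>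
    by (simp add: e_def g_def eisen2_def power2_eq_square algebra_simps)
  have d: "(eisen2 has_field_derivative g \<tau>) (at \<tau>)" if "\<tau> \<in> upper_half_plane" for \<tau>
  proof -
    have "(eisen2_disc has_field_derivative deriv eisen2_disc (nome \<tau>)) (at (nome \<tau>))"
      using holomorphic_derivI[OF holomorphic_eisen2_disc open_ball nome_in_ball[OF that]] .
    from DERIV_chain2[OF this has_field_derivative_nome]
    show ?thesis unfolding eisen2_def[abs_def] g_def by (simp add: mult_ac)
  qed
  show ?thesis
  proof (rule that)
    show "e holomorphic_on ball 0 1"
      unfolding e_def by (intro holomorphic_intros holomorphic_eisen2_disc) auto
    show "e 0 \<noteq> 0" by (simp add: e_def eisen2_disc_0)
    fix \<tau> assume \<tau>: "\<tau> \<in> upper_half_plane"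
    have t0: "\<tau> \<noteq> 0" using \<tau> by (auto simp: upper_half_plane_def)
    have 1: "((\<lambda>z. eisen2 (-1 / z)) has_field_derivative g (-1 / \<tau>) * (1 / \<tau>\<^sup>2)) (at \<tau>)"
      by (rule DERIV_chain2[where f = eisen2 and g = "\<lambda>z. -1 / z", OF d[OF upper_half_plane_neg_inverse[OF \<tau>]]])
         (use t0 in \<open>auto intro!: derivative_eq_intros simp: power2_eq_square\<close>)
    have 2: "((\<lambda>z. z\<^sup>2 * eisen2 z - 2 * of_real pi * \<i> * z) has_field_derivative 
        (2 * \<tau> * eisen2 \<tau> + \<tau>\<^sup>2 * g \<tau> - 2 * of_real pi * \<i>)) (at \<tau>)"
      by (auto intro!: derivative_eq_intros d \<tau>)
    have "\<forall>\<^sub>F z in nhds \<tau>. eisen2 (-1 / z) = z\<^sup>2 * eisen2 z - 2 * of_real pi * \<i> * z"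
      using eventually_nhds_in_open[OF open_upper_half_plane \<tau>] by eventually_elim (rule eisen2_transform)
    then have "((\<lambda>z. eisen2 (-1 / z)) has_field_derivative 
        (2 * \<tau> * eisen2 \<tau> + \<tau>\<^sup>2 * g \<tau> - 2 * of_real pi * \<i>)) (at \<tau>)"
      using 2 by (subst DERIV_cong_ev[OF refl _ refl])
    from DERIV_unique[OF 1 this] have g_eq: "g (-1 / \<tau>) = \<tau>\<^sup>2 * (2 * \<tau> * eisen2 \<tau> + \<tau>\<^sup>2 * g \<tau> - 2 * of_real pi * \<i>)"
      using t0 by (simp add: field_simps)
    show "e (nome (-1 / \<tau>)) = \<tau> ^ 4 * e (nome \<tau>)"
      unfolding e eisen2_transform[OF \<tau>] g_eq by (simp add: power2_eq_square algebra_simps power4_eq_xxxx)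
  qed
qed

subsection \<open>The modular group\<close>

definition mat2 :: "'a \<Rightarrow> 'a \<Rightarrow> 'a \<Rightarrow> 'a \<Rightarrow> 'a::zero^2^2" where
  "mat2 a b c d = vector [vector [a, b], vector [c, d]]"

lemma mat2_nth [simp]:
  "mat2 a b c d $ 1 $ 1 = a" "mat2 a b c d $ 1 $ 2 = b"
  "mat2 a b c d $ 2 $ 1 = c" "mat2 a b c d $ 2 $ 2 = d"
  by (simp_all add: mat2_def)

lemma mat2_eq_iff: "A = B \<longleftrightarrow> A$1$1 = B$1$1 \<and> A$1$2 = B$1$2 \<and> A$2$1 = B$2$1 \<and> A$2$2 = B$2$2"
  for A B :: "'a^2^2"
  by (auto simp: vec_eq_iff forall_2)

lemma matrix_mult_nth2:
  "(A ** B) $ i $ j = A $ i $ 1 * B $ 1 $ j + A $ i $ 2 * B $ 2 $ j" for A B :: "'a::semiring_1^2^2"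
  by (simp add: matrix_matrix_mult_def sum_2)

lemma mat_1_nth2: "(mat 1 :: 'a::{zero,one}^2^2) $ 1 $ 1 = 1" "(mat 1 :: 'a^2^2) $ 1 $ 2 = 0"
  "(mat 1 :: 'a^2^2) $ 2 $ 1 = 0" "(mat 1 :: 'a^2^2) $ 2 $ 2 = 1"
  by (simp_all add: mat_def)

lemmas mat2_simps = mat2_eq_iff matrix_mult_nth2 mat_1_nth2 mat2_nth

text \<open>On determinant 1 this is the inverse. The entrywise formula keeps inverses accessible to
  simplification and shows at once that they have the same \<open>mnorm\<close>.\<close>

definition adj2 :: "'a::comm_ring_1^2^2 \<Rightarrow> 'a^2^2" where
  "adj2 A = mat2 (A$2$2) (- A$1$2) (- A$2$1) (A$1$1)"

lemma SL2Z_iff: "A \<in> SL2Z \<longleftrightarrow> A$1$1 * A$2$2 - A$1$2 * A$2$1 = 1 \<and>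
    A$1$1 \<in> \<int> \<and> A$1$2 \<in> \<int> \<and> A$2$1 \<in> \<int> \<and> A$2$2 \<in> \<int>"
  by (auto simp: SL2Z_def SL2R_def det_2 forall_2)

lemma SL2Z_cases:
  assumes "A \<in> SL2Z"
  obtains a b c d :: int where "A = mat2 (of_int a) (of_int b) (of_int c) (of_int d)" "a * d - b * c = 1"
proof -
  from assms obtain a b c d :: int where *: "A$1$1 = of_int a" "A$1$2 = of_int b" "A$2$1 = of_int c" "A$2$2 = of_int d"
    unfolding SL2Z_iff by (auto elim!: Ints_cases)
  have "real_of_int (a * d - b * c) = 1" using assms by (simp add: SL2Z_iff *)
  then have "a * d - b * c = 1" by linarith
  then show ?thesis using that * by (auto simp: mat2_eq_iff)
qed

lemma mat2_in_SL2Z: "a * d - b * c = 1 \<Longrightarrow> mat2 (of_int a) (of_int b) (of_int c) (of_int d) \<in> SL2Z"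
  unfolding SL2Z_iff by (auto simp flip: of_int_mult of_int_diff)

lemma det_SL2Z: "A \<in> SL2Z \<Longrightarrow> A$1$1 * A$2$2 - A$1$2 * A$2$1 = 1"
  by (simp add: SL2Z_iff)

lemma SL2Z_one: "mat 1 \<in> SL2Z"
  by (simp add: SL2Z_iff mat_1_nth2)

lemma SL2Z_mult: "A \<in> SL2Z \<Longrightarrow> B \<in> SL2Z \<Longrightarrow> A ** B \<in> SL2Z"
  by (auto simp: SL2Z_def SL2R_def det_mul forall_2 matrix_mult_nth2)

lemma SL2Z_adj2: "A \<in> SL2Z \<Longrightarrow> adj2 A \<in> SL2Z"
  by (auto simp: SL2Z_iff adj2_def algebra_simps)

lemma adj2_mult_left: "A \<in> SL2Z \<Longrightarrow> adj2 A ** A = mat 1"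
  using det_SL2Z[of A] by (simp add: mat2_simps adj2_def algebra_simps)

lemma adj2_mult_right: "A \<in> SL2Z \<Longrightarrow> A ** adj2 A = mat 1"
  using det_SL2Z[of A] by (simp add: mat2_simps adj2_def algebra_simps)

lemma adj2_adj2 [simp]: "adj2 (adj2 A) = A"
  by (simp add: adj2_def mat2_eq_iff)

lemma adj2_mult: "adj2 (A ** B) = adj2 B ** adj2 A" for A B :: "'a::comm_ring_1^2^2"
  by (simp add: adj2_def mat2_simps algebra_simps)

lemma adj2_mult_cancel: "A \<in> SL2Z \<Longrightarrow> adj2 A ** (A ** B) = B" "A \<in> SL2Z \<Longrightarrow> A ** (adj2 A ** B) = B"
  "A \<in> SL2Z \<Longrightarrow> (B ** A) ** adj2 A = B" "A \<in> SL2Z \<Longrightarrow> (B ** adj2 A) ** A = B"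
  subgoal by (simp add: matrix_mul_assoc adj2_mult_left)
  subgoal by (simp add: matrix_mul_assoc adj2_mult_right)
  subgoal by (simp add: adj2_mult_right flip: matrix_mul_assoc)
  subgoal by (simp add: adj2_mult_left flip: matrix_mul_assoc)
  done

lemma inv_SL2R_eq_adj2: "A \<in> SL2Z \<Longrightarrow> inv\<^bsub>SL2R\<^esub> A = adj2 A"
  by (rule group.inv_equality[OF group_SL2R])
     (use SL2Z_adj2 in \<open>auto simp: SL2R_def adj2_mult_left SL2Z_def\<close>)

text \<open>The sum norm is submultiplicative, integral on SL(2,Z), and unchanged by inversion and
  by multiplication with S; being integral, it serves as the measure of the Euclidean
  algorithm.\<close>

definition mnorm :: "real^2^2 \<Rightarrow> real" where
  "mnorm A = \<bar>A$1$1\<bar> + \<bar>A$1$2\<bar> + \<bar>A$2$1\<bar> + \<bar>A$2$2\<bar>"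

lemma mnorm_nonneg: "mnorm A \<ge> 0"
  by (simp add: mnorm_def)

lemma mnorm_mult: "mnorm (A ** B) \<le> mnorm A * mnorm B"
proof -
  have *: "\<bar>(A ** B) $ i $ j\<bar> \<le> \<bar>A$i$1\<bar> * \<bar>B$1$j\<bar> + \<bar>A$i$2\<bar> * \<bar>B$2$j\<bar>" for i j
    unfolding matrix_mult_nth2 by (rule order_trans[OF abs_triangle_ineq]) (simp add: abs_mult)
  have "mnorm (A ** B) \<le> (\<bar>A$1$1\<bar> * \<bar>B$1$1\<bar> + \<bar>A$1$2\<bar> * \<bar>B$2$1\<bar>) + (\<bar>A$1$1\<bar> * \<bar>B$1$2\<bar> + \<bar>A$1$2\<bar> * \<bar>B$2$2\<bar>) +
    (\<bar>A$2$1\<bar> * \<bar>B$1$1\<bar> + \<bar>A$2$2\<bar> * \<bar>B$2$1\<bar>) + (\<bar>A$2$1\<bar> * \<bar>B$1$2\<bar> + \<bar>A$2$2\<bar> * \<bar>B$2$2\<bar>)"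
    unfolding mnorm_def by (intro add_mono *)
  also have "\<dots> = (\<bar>A$1$1\<bar> + \<bar>A$2$1\<bar>) * (\<bar>B$1$1\<bar> + \<bar>B$1$2\<bar>) + (\<bar>A$1$2\<bar> + \<bar>A$2$2\<bar>) * (\<bar>B$2$1\<bar> + \<bar>B$2$2\<bar>)"
    by (simp add: algebra_simps)
  also have "\<dots> \<le> (\<bar>A$1$1\<bar> + \<bar>A$2$1\<bar>) * mnorm B + (\<bar>A$1$2\<bar> + \<bar>A$2$2\<bar>) * mnorm B"
    by (intro add_mono mult_left_mono) (auto simp: mnorm_def)
  also have "\<dots> = mnorm A * mnorm B"
    by (simp add: mnorm_def algebra_simps)
  finally show ?thesis .
qed

lemma mnorm_adj2 [simp]: "mnorm (adj2 A) = mnorm A"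
  by (simp add: mnorm_def adj2_def)

lemma mnorm_mat2_of_int: "mnorm (mat2 (of_int a) (of_int b) (of_int c) (of_int d)) =
    of_int (\<bar>a\<bar> + \<bar>b\<bar> + \<bar>c\<bar> + \<bar>d\<bar>)"
  by (simp add: mnorm_def)

lemma SL2Z_bottom_row: "A \<in> SL2Z \<Longrightarrow> \<bar>A$2$1\<bar> + \<bar>A$2$2\<bar> \<ge> 1"
proof (erule SL2Z_cases)
  fix a b c d :: int
  assume "A = mat2 (real_of_int a) (real_of_int b) (real_of_int c) (real_of_int d)" "a * d - b * c = 1"
  moreover from this have "c \<noteq> 0 \<or> d \<noteq> 0" by auto
  then have "\<bar>c\<bar> + \<bar>d\<bar> \<ge> 1" by linarith
  then have "real_of_int (\<bar>c\<bar> + \<bar>d\<bar>) \<ge> 1" by linarith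
  ultimately show ?thesis by simp
qed

lemma mnorm_ge_1: "A \<in> SL2Z \<Longrightarrow> mnorm A \<ge> 1"
  using SL2Z_bottom_row[of A] by (auto simp: mnorm_def)

text \<open>The exponent is 8 because each of the four entries receives a weight of order
  |n|^(-2).\<close>

lemma summable_on_mnorm:
  "(\<lambda>A. 1 / mnorm A ^ 8) summable_on SL2Z"
proof -
  define w where "w = (\<lambda>n::int. max 1 \<bar>real_of_int n\<bar> powr (-2))"
  have w0: "w n \<ge> 0" for n by (simp add: w_def)
  have w: "w summable_on UNIV" unfolding w_def by (intro summable_on_int_powr) auto
  define W where "W = (\<lambda>((a,b),(c,d)). (w a * w b) * (w c * w d))"
  have "(\<lambda>(p,q). (case p of (a,b) \<Rightarrow> w a * w b) * (case q of (c,d) \<Rightarrow> w c * w d)) summable_on ((UNIV \<times> UNIV) \<times> (UNIV \<times> UNIV))"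
    by (intro summable_on_times_real w) (auto simp: w0)
  then have W: "W summable_on UNIV" by (simp add: W_def case_prod_unfold)
  define F :: "real^2^2 \<Rightarrow> (int \<times> int) \<times> (int \<times> int)" where
    "F = (\<lambda>A. ((\<lfloor>A$1$1\<rfloor>, \<lfloor>A$1$2\<rfloor>), (\<lfloor>A$2$1\<rfloor>, \<lfloor>A$2$2\<rfloor>)))"
  have "inj_on F SL2Z"
  proof (rule inj_onI)
    fix A B assume "A \<in> SL2Z" "B \<in> SL2Z" "F A = F B"
    then show "A = B" by (elim SL2Z_cases) (simp add: F_def)
  qed
  moreover have "W summable_on F ` SL2Z" using W by (rule summable_on_subset_banach) auto
  ultimately have "(W \<circ> F) summable_on SL2Z" by (subst (asm) summable_on_reindex)
  then show ?thesis
  proof (rule summable_on_comparison_test)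
    fix A assume A: "A \<in> SL2Z"
    have m: "mnorm A \<ge> 1" using mnorm_ge_1[OF A] .
    have w1: "1 / (mnorm A)\<^sup>2 \<le> w n" if "\<bar>real_of_int n\<bar> \<le> mnorm A" for n
    proof -
      have "w n = 1 / (max 1 \<bar>real_of_int n\<bar>)\<^sup>2"
        by (simp add: w_def powr_minus powr_numeral inverse_eq_divide)
      moreover have "(max 1 \<bar>real_of_int n\<bar>)\<^sup>2 \<le> (mnorm A)\<^sup>2" using that m by (intro power_mono) auto
      ultimately show ?thesis by (auto intro!: divide_left_mono mult_pos_pos zero_less_power simp: less_max_iff_disj) (use m in auto)
    qed
    obtain a b c d where abcd: "A = mat2 (of_int a) (of_int b) (of_int c) (of_int d)" using A by (elim SL2Z_cases)
    have "1 / mnorm A ^ 8 = (1 / (mnorm A)\<^sup>2 * (1 / (mnorm A)\<^sup>2)) * (1 / (mnorm A)\<^sup>2 * (1 / (mnorm A)\<^sup>2))"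
      by (simp flip: power_add)
    also have "\<dots> \<le> (w a * w b) * (w c * w d)"
      by (intro mult_mono w1) (auto simp: w0 abcd mnorm_def)
    finally show "1 / mnorm A ^ 8 \<le> (W \<circ> F) A" by (simp add: W_def F_def abcd)
  qed (simp add: mnorm_nonneg)
qed

section \<open>Automorphy factors and the action on the upper half-plane\<close>

lemma aut_factor_nonzero:
  assumes "A \<in> SL2Z" "\<tau> \<in> upper_half_plane"
  shows "aut_factor A \<tau> \<noteq> 0"
proof
  assume "aut_factor A \<tau> = 0"
  then have "Im (aut_factor A \<tau>) = 0" "Re (aut_factor A \<tau>) = 0" by auto
  then have "A$2$1 = 0" "A$2$2 = 0" using assms(2) by (auto simp: aut_factor_def upper_half_plane_def)
  then show False using SL2Z_bottom_row[OF assms(1)] by simp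
qed

text \<open>Numerator of the Moebius transformation, kept apart from \<open>aut_factor\<close> so
  that A\<tau> - w can be cleared of denominators to an expression linear in the entries of
  A.\<close>

definition num_factor :: "real^2^2 \<Rightarrow> complex \<Rightarrow> complex" where
  "num_factor A \<tau> = of_real (A$1$1) * \<tau> + of_real (A$1$2)"

lemma moebius_action_eq: "moebius_action A \<tau> = num_factor A \<tau> / aut_factor A \<tau>"
  by (simp add: moebius_action_def moebius_def num_factor_def aut_factor_def)

lemma Im_moebius_action:
  assumes "A \<in> SL2Z" "\<tau> \<in> upper_half_plane"
  shows "Im (moebius_action A \<tau>) = Im \<tau> / (norm (aut_factor A \<tau>))\<^sup>2"
proof -
  have "Im (moebius_action A \<tau>) = (A$1$1 * A$2$2 - A$1$2 * A$2$1) * Im \<tau> / (norm (aut_factor A \<tau>))\<^sup>2"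
    by (simp add: moebius_action_eq Im_divide cmod_power2 num_factor_def aut_factor_def algebra_simps)
  then show ?thesis using det_SL2Z[OF assms(1)] by simp
qed

lemma moebius_action_in_uhp:
  assumes "A \<in> SL2Z" "\<tau> \<in> upper_half_plane"
  shows "moebius_action A \<tau> \<in> upper_half_plane"
  using assms Im_moebius_action[OF assms] aut_factor_nonzero[OF assms]
  by (simp add: upper_half_plane_def)

lemma aut_factor_mult:
  assumes "A \<in> SL2Z" "B \<in> SL2Z" "\<tau> \<in> upper_half_plane"
  shows "aut_factor (A ** B) \<tau> = aut_factor A (moebius_action B \<tau>) * aut_factor B \<tau>"
    and "num_factor (A ** B) \<tau> = num_factor A (moebius_action B \<tau>) * aut_factor B \<tau>"
proof -
  have nz: "aut_factor B \<tau> \<noteq> 0" using aut_factor_nonzero assms by blast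
  have "moebius_action B \<tau> * aut_factor B \<tau> = num_factor B \<tau>" using nz by (simp add: moebius_action_eq)
  then show "aut_factor (A ** B) \<tau> = aut_factor A (moebius_action B \<tau>) * aut_factor B \<tau>"
    and "num_factor (A ** B) \<tau> = num_factor A (moebius_action B \<tau>) * aut_factor B \<tau>"
    unfolding aut_factor_def[of A] num_factor_def[of A] distrib_right mult.assoc
    by (simp_all add: aut_factor_def num_factor_def matrix_mult_nth2 algebra_simps)
qed

lemma moebius_action_mult:
  assumes "A \<in> SL2Z" "B \<in> SL2Z" "\<tau> \<in> upper_half_plane"
  shows "moebius_action (A ** B) \<tau> = moebius_action A (moebius_action B \<tau>)"
  using aut_factor_nonzero[OF assms(2,3)]
  unfolding moebius_action_eq[of "A ** B"] moebius_action_eq[of A "moebius_action B \<tau>"] aut_factor_mult[OF assms]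
  by simp

lemma moebius_action_one: "moebius_action (mat 1) \<tau> = \<tau>"
  by (simp add: moebius_action_eq num_factor_def aut_factor_def mat_1_nth2)

lemma holomorphic_moebius_action:
  assumes "A \<in> SL2Z"
  shows "moebius_action A holomorphic_on upper_half_plane"
proof -
  have "(\<lambda>\<tau>. num_factor A \<tau> / aut_factor A \<tau>) holomorphic_on upper_half_plane"
  proof (intro holomorphic_on_divide)
    show "num_factor A holomorphic_on upper_half_plane" "aut_factor A holomorphic_on upper_half_plane"
      unfolding num_factor_def[abs_def] aut_factor_def[abs_def] by (intro holomorphic_intros)+
  qed (use aut_factor_nonzero assms in auto)
  then show ?thesis by (simp add: moebius_action_eq[abs_def])
qed

subsection \<open>Generation of the modular group\<close>

definition matS :: "real^2^2" where "matS = mat2 0 (-1) 1 0"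
definition matT :: "real^2^2" where "matT = mat2 1 1 0 1"
definition matL :: "real^2^2" where "matL = mat2 1 0 1 1"

lemma matS_SL2Z: "matS \<in> SL2Z" and matT_SL2Z: "matT \<in> SL2Z" and matL_SL2Z: "matL \<in> SL2Z"
  by (auto simp: SL2Z_iff matS_def matT_def matL_def)

lemma matL_eq: "A ** matL = A ** matS ** adj2 matT ** matS ** matS ** matS" for A :: "real^2^2"
proof -
  have eq: "matL = matS ** adj2 matT ** matS ** matS ** matS"
    by (simp add: mat2_simps matS_def matT_def matL_def adj2_def)
  show ?thesis unfolding eq by (simp add: matrix_mul_assoc)
qed

definition nonneg_mat :: "real^2^2 \<Rightarrow> bool" where
  "nonneg_mat A \<longleftrightarrow> A$1$1 \<ge> 0 \<and> A$1$2 \<ge> 0 \<and> A$2$1 \<ge> 0 \<and> A$2$2 \<ge> 0"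

lemma nonneg_mat_mult: "nonneg_mat A \<Longrightarrow> nonneg_mat B \<Longrightarrow> nonneg_mat (A ** B)"
  by (simp add: nonneg_mat_def matrix_mult_nth2)

text \<open>Subtractive Euclid on the columns. They are comparable entrywise unless A = 1: in the
  mixed cases the determinant gives either (b + 1)(c + 1) \<le> 1 + bc, so b = c = 0, or ad \<le>
  bc, which is impossible. The subtracted column is a nonzero integer vector, whence the drop of the
  norm by at least 1.\<close>

lemma nonneg_mat_step:
  assumes "A \<in> SL2Z" "nonneg_mat A" "A \<noteq> mat 1"
  obtains B t where "B \<in> SL2Z" "nonneg_mat B" "mnorm B + 1 \<le> mnorm A" "t \<in> {matT, matL}" "A = B ** t"
proof -
  obtain a b c d :: int where A: "A = mat2 (of_int a) (of_int b) (of_int c) (of_int d)" "a * d - b * c = 1"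
    using assms(1) by (rule SL2Z_cases)
  have nn: "a \<ge> 0" "b \<ge> 0" "c \<ge> 0" "d \<ge> 0" using assms(2) by (auto simp: nonneg_mat_def A)
  consider "a \<ge> b" "c \<ge> d" | "a \<le> b" "c \<le> d" | "a \<ge> b + 1" "d \<ge> c + 1" | "b \<ge> a + 1" "c \<ge> d + 1" by linarith
  then show ?thesis
  proof cases
    case 1
    have "b \<noteq> 0 \<or> d \<noteq> 0" using A(2) by auto
    then have "b + d \<ge> 1" using nn by linarith
    then show ?thesis using 1 nn A(2)
      by (intro that[of "mat2 (of_int (a - b)) (of_int b) (of_int (c - d)) (of_int d)" matL] mat2_in_SL2Z)
         (auto simp: nonneg_mat_def A(1) matL_def mat2_simps mnorm_mat2_of_int algebra_simps simp flip: of_int_diff)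
  next
    case 2
    have "a \<noteq> 0 \<or> c \<noteq> 0" using A(2) by auto
    then have "a + c \<ge> 1" using nn by linarith
    then show ?thesis using 2 nn A(2)
      by (intro that[of "mat2 (of_int a) (of_int (b - a)) (of_int c) (of_int (d - c))" matT] mat2_in_SL2Z)
         (auto simp: nonneg_mat_def A(1) matT_def mat2_simps mnorm_mat2_of_int algebra_simps simp flip: of_int_diff)
  next
    case 3
    have "(b + 1) * (c + 1) \<le> a * d" using 3 nn by (intro mult_mono) auto
    then have "b + c \<le> 0" using A(2) by (simp add: algebra_simps)
    then have bc: "b = 0" "c = 0" using nn by auto
    then have "a * d = 1" using A(2) by simp
    then have "a = 1" "d = 1" using nn zmult_eq_1_iff by auto
    then show ?thesis using assms(3) bc by (simp add: A(1) mat2_simps)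
  next
    case 4
    have "a * d \<le> b * c" using 4 nn by (intro mult_mono) auto
    then show ?thesis using A(2) by simp
  qed
qed

lemma nonneg_mat_induct [consumes 2, case_names one step]:
  assumes "A \<in> SL2Z" "nonneg_mat A" "P (mat 1)"
    "\<And>B t. B \<in> SL2Z \<Longrightarrow> nonneg_mat B \<Longrightarrow> t \<in> {matT, matL} \<Longrightarrow> mnorm B + 1 \<le> mnorm (B ** t) \<Longrightarrow> P B \<Longrightarrow> P (B ** t)"
  shows "P A"
  using assms(1,2)
proof (induction "nat \<lfloor>mnorm A\<rfloor>" arbitrary: A rule: less_induct)
  case less
  show ?case
  proof (cases "A = mat 1")
    case False
    then obtain B t where B: "B \<in> SL2Z" "nonneg_mat B" "mnorm B + 1 \<le> mnorm A" "t \<in> {matT, matL}" "A = B ** t"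
      using nonneg_mat_step less.prems by metis
    have "nat \<lfloor>mnorm B\<rfloor> < nat \<lfloor>mnorm A\<rfloor>" using B(3) mnorm_nonneg[of B] by linarith
    then show ?thesis using less.hyps[of B] B assms(4) by auto
  qed (use assms(3) in simp)
qed

text \<open>The geodesic from \<open>A(0)\<close> to \<open>A(\<infinity>)\<close> lies in the closed right half of the upper half-plane;
  the elements of \<open>S_group\<close> map the imaginary axis to itself.\<close>

definition half_plane_mat :: "real^2^2 \<Rightarrow> bool" where
  "half_plane_mat A \<longleftrightarrow> A$1$1 * A$2$1 \<ge> 0 \<and> A$1$2 * A$2$2 \<ge> 0"

definition S_group :: "(real^2^2) set" where
  "S_group = {mat 1, matS, - mat 1, - matS}"

lemma S_group_SL2Z: "\<sigma> \<in> S_group \<Longrightarrow> \<sigma> \<in> SL2Z"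
  by (auto simp: S_group_def SL2Z_iff matS_def mat_1_nth2)

text \<open>By the determinant, (ac)(bd) = bc(bc + 1), a product of consecutive integers.
  Geometrically, the edge with endpoints a/c and b/d does not cross the imaginary axis.\<close>

lemma SL2Z_column_signs:
  assumes "A \<in> SL2Z"
  shows "(A$1$1 * A$2$1) * (A$1$2 * A$2$2) \<ge> 0"
proof -
  obtain a b c d :: int where A: "A = mat2 (of_int a) (of_int b) (of_int c) (of_int d)" "a * d - b * c = 1"
    using assms by (rule SL2Z_cases)
  have "(b * c) * (b * c + 1) \<ge> 0"
    by (cases "b * c \<ge> 0") (auto intro: mult_nonneg_nonneg mult_nonpos_nonpos)
  also have "(b * c) * (b * c + 1) = (a * c) * (b * d)" using A(2) by (simp add: algebra_simps) algebra
  finally have "real_of_int ((a * c) * (b * d)) \<ge> 0" by linarith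
  then show ?thesis by (simp add: A)
qed

lemma half_plane_mat_cases:
  assumes "A \<in> SL2Z"
  shows "half_plane_mat A \<or> half_plane_mat (matS ** A)"
proof -
  obtain a b c d :: int where A: "A = mat2 (of_int a) (of_int b) (of_int c) (of_int d)" "a * d - b * c = 1"
    using assms by (rule SL2Z_cases)
  show ?thesis
    using SL2Z_column_signs[OF assms]
    by (auto simp: half_plane_mat_def matS_def matrix_mult_nth2 zero_le_mult_iff mult_le_0_iff)
qed

lemma uminus_SL2Z: "A \<in> SL2Z \<Longrightarrow> - A \<in> SL2Z"
  by (auto simp: SL2Z_iff)

text \<open>Each column has entries of one sign. If the two signs agree, a factor -1 suffices; if
  they differ, exchanging the columns, which is multiplication by S up to sign, makes all entries
  nonnegative.\<close>

lemma half_plane_mat_decomp: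
  assumes "A \<in> SL2Z" "half_plane_mat A"
  obtains p \<sigma> where "p \<in> SL2Z" "nonneg_mat p" "\<sigma> \<in> S_group" "A = p ** \<sigma>" "mnorm p = mnorm A"
proof -
  have d: "A$1$1 * A$2$2 - A$1$2 * A$2$1 = 1" using det_SL2Z[OF assms(1)] .
  have I: "A$1$1 \<in> \<int>" "A$1$2 \<in> \<int>" "A$2$1 \<in> \<int>" "A$2$2 \<in> \<int>" using assms(1) by (auto simp: SL2Z_iff)
  consider "A$1$1 \<ge> 0" "A$2$1 \<ge> 0" "A$1$2 \<ge> 0" "A$2$2 \<ge> 0"
    | "A$1$1 \<le> 0" "A$2$1 \<le> 0" "A$1$2 \<le> 0" "A$2$2 \<le> 0"
    | "A$1$1 \<ge> 0" "A$2$1 \<ge> 0" "A$1$2 \<le> 0" "A$2$2 \<le> 0"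
    | "A$1$1 \<le> 0" "A$2$1 \<le> 0" "A$1$2 \<ge> 0" "A$2$2 \<ge> 0"
    using assms(2) by (auto simp: half_plane_mat_def zero_le_mult_iff)
  then show ?thesis
  proof cases
    case 1
    then show ?thesis by (intro that[of A "mat 1"]) (auto simp: assms nonneg_mat_def S_group_def)
  next
    case 2
    then show ?thesis
      by (intro that[of "- A" "- mat 1"])
         (auto simp: uminus_SL2Z assms nonneg_mat_def S_group_def mnorm_def mat2_eq_iff matrix_mult_nth2 mat_1_nth2)
  next
    case 3
    show ?thesis
      using 3 d I by (intro that[of "mat2 (- A$1$2) (A$1$1) (- A$2$2) (A$2$1)" "matS"])
        (auto simp: SL2Z_iff nonneg_mat_def S_group_def mnorm_def mat2_eq_iff matrix_mult_nth2 mat_1_nth2 matS_def algebra_simps)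
  next
    case 4
    show ?thesis
      using 4 d I by (intro that[of "mat2 (A$1$2) (- A$1$1) (A$2$2) (- A$2$1)" "- matS"])
        (auto simp: SL2Z_iff nonneg_mat_def S_group_def mnorm_def mat2_eq_iff matrix_mult_nth2 mat_1_nth2 matS_def algebra_simps)
  qed
qed

lemma adj2_S_group: "\<sigma> \<in> S_group \<Longrightarrow> adj2 \<sigma> \<in> S_group"
proof -
  have e: "adj2 (mat 1) = (mat 1 :: real^2^2)" "adj2 matS = - matS" "adj2 (- mat 1) = (- mat 1 :: real^2^2)" "adj2 (- matS) = matS"
    by (simp_all add: mat2_simps matS_def adj2_def)
  assume "\<sigma> \<in> S_group"
  then show ?thesis unfolding S_group_def by (elim insertE emptyE) (simp_all add: e)
qed

text \<open>S exchanges the two sides of the imaginary axis, so A or SA lies on the right side. The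
  middle factor p is a word in T and L, which is the form in which the Euclidean factorisation is
  used later.\<close>

lemma SL2Z_decomp:
  assumes "A \<in> SL2Z"
  obtains \<sigma> p \<sigma>' where "\<sigma> \<in> S_group" "p \<in> SL2Z" "nonneg_mat p" "\<sigma>' \<in> S_group" "A = \<sigma> ** p ** \<sigma>'" "mnorm p = mnorm A"
proof -
  consider "half_plane_mat A" | "half_plane_mat (matS ** A)" using half_plane_mat_cases[OF assms] by blast
  then show ?thesis
  proof cases
    case 1
    then obtain p \<sigma> where "p \<in> SL2Z" "nonneg_mat p" "\<sigma> \<in> S_group" "A = p ** \<sigma>" "mnorm p = mnorm A"
      using half_plane_mat_decomp assms by metis
    then show ?thesis using that[of "mat 1" p \<sigma>] by (auto simp: S_group_def)
  next
    case 2
    then obtain p \<sigma> where p: "p \<in> SL2Z" "nonneg_mat p" "\<sigma> \<in> S_group" "matS ** A = p ** \<sigma>" "mnorm p = mnorm (matS ** A)"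
      using half_plane_mat_decomp SL2Z_mult[OF matS_SL2Z assms] by metis
    have "A = adj2 matS ** (matS ** A)" using matS_SL2Z by (simp add: adj2_mult_cancel)
    then have "A = adj2 matS ** p ** \<sigma>" by (simp add: p(4) matrix_mul_assoc)
    moreover have "mnorm (matS ** A) = mnorm A" by (simp add: mnorm_def matrix_mult_nth2 matS_def)
    ultimately show ?thesis using that[of "adj2 matS" p \<sigma>] p adj2_S_group by (auto simp: S_group_def)
  qed
qed

lemma SL2Z_induct [consumes 1, case_names one T T_inv S]:
  assumes "A \<in> SL2Z" "P (mat 1)"
    "\<And>B. B \<in> SL2Z \<Longrightarrow> P B \<Longrightarrow> P (B ** matT)"
    "\<And>B. B \<in> SL2Z \<Longrightarrow> P B \<Longrightarrow> P (B ** adj2 matT)"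
    "\<And>B. B \<in> SL2Z \<Longrightarrow> P B \<Longrightarrow> P (B ** matS)"
  shows "P A"
proof -
  have L: "P (B ** matL)" if "B \<in> SL2Z" "P B" for B
    unfolding matL_eq using that
    by (intro assms(3-5) SL2Z_mult matS_SL2Z SL2Z_adj2 matT_SL2Z)
  have right: "P (B ** \<sigma>)" if "B \<in> SL2Z" "P B" "\<sigma> \<in> S_group" for B \<sigma>
  proof -
    have e: "- mat 1 = matS ** matS" "- matS = matS ** matS ** matS"
      by (simp_all add: mat2_simps matS_def)
    have S1: "P (B ** matS)" "P (B ** matS ** matS)" "P (B ** matS ** matS ** matS)"
      using that by (auto intro!: assms(5) SL2Z_mult matS_SL2Z)
    show ?thesis using that(3) S1 that(2) by (auto simp: S_group_def e matrix_mul_assoc)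
  qed
  obtain \<sigma> p \<sigma>' where A: "\<sigma> \<in> S_group" "p \<in> SL2Z" "nonneg_mat p" "\<sigma>' \<in> S_group" "A = \<sigma> ** p ** \<sigma>'"
    using SL2Z_decomp[OF assms(1)] by metis
  have \<sigma>: "P \<sigma>" using right[OF SL2Z_one assms(2) A(1)] by simp
  have "P (\<sigma> ** p)" using A(2,3)
  proof (induction rule: nonneg_mat_induct)
    case (step B t)
    then show ?case using L[of "\<sigma> ** B"] assms(3)[of "\<sigma> ** B"] SL2Z_mult[OF S_group_SL2Z[OF A(1)]]
      by (auto simp: matrix_mul_assoc)
  qed (use \<sigma> in simp)
  from right[OF SL2Z_mult[OF S_group_SL2Z[OF A(1)] A(2)] this A(4)] show ?thesis by (simp add: A(5))
qed

section \<open>Action of the generators, and estimates uniform up to the cusp\<close>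

lemma moebius_action_matT: "moebius_action matT \<tau> = \<tau> + 1"
  and moebius_action_adj2_matT: "moebius_action (adj2 matT) \<tau> = \<tau> - 1"
  and moebius_action_matS: "moebius_action matS \<tau> = -1 / \<tau>"
  by (simp_all add: moebius_action_eq num_factor_def aut_factor_def matT_def matS_def adj2_def)

text \<open>These regions exhaust the upper half-plane and also contain the cusp neighbourhood
  \<open>Im \<tau> \<ge> 1, \<bar>Re \<tau>\<bar> \<le> 1/2\<close>.\<close>

definition cone_region :: "real \<Rightarrow> real \<Rightarrow> complex set" where
  "cone_region y R = {\<tau>. y \<le> Im \<tau> \<and> norm \<tau> \<le> R * Im \<tau>}"

text \<open>As in \<open>lattice_bound\<close>, but uniformly over the region: the height bounds c,
  and |\<tau>| \<le> R Im \<tau> transfers the bound to d.\<close>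

lemma linear_form_bound:
  assumes "y > 0" "\<tau> \<in> cone_region y R"
  shows "\<bar>c\<bar> + \<bar>d\<bar> \<le> (1 / y + 1 + R) * norm (of_real c * \<tau> + of_real d)"
proof -
  define X where "X = norm (of_real c * \<tau> + of_real d)"
  have t: "y \<le> Im \<tau>" "norm \<tau> \<le> R * Im \<tau>" "Im \<tau> > 0" using assms by (auto simp: cone_region_def)
  have "\<bar>Im (of_real c * \<tau> + of_real d)\<bar> \<le> X" unfolding X_def by (rule abs_Im_le_cmod)
  then have 1: "\<bar>c\<bar> * Im \<tau> \<le> X" using t by (simp add: abs_mult)
  have "\<bar>c\<bar> * y \<le> \<bar>c\<bar> * Im \<tau>" using t by (intro mult_left_mono) auto
  then have 2: "\<bar>c\<bar> \<le> 1 / y * X" using 1 assms(1) by (simp add: field_simps)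
  have "\<bar>d\<bar> = norm ((of_real c * \<tau> + of_real d) - of_real c * \<tau>)" by simp
  also have "\<dots> \<le> X + \<bar>c\<bar> * norm \<tau>" unfolding X_def by (metis norm_mult norm_of_real norm_triangle_ineq4)
  also have "\<bar>c\<bar> * norm \<tau> \<le> \<bar>c\<bar> * (R * Im \<tau>)" using t by (intro mult_left_mono) auto
  also have "\<bar>c\<bar> * (R * Im \<tau>) = R * (\<bar>c\<bar> * Im \<tau>)" by simp
  also have "\<dots> \<le> R * X"
  proof (intro mult_left_mono 1)
    have "0 \<le> R * Im \<tau>" using t(2) norm_ge_zero order_trans by blast
    then show "R \<ge> 0" using t(3) by (simp add: zero_le_mult_iff)
  qed
  finally show ?thesis using 2 by (simp add: X_def algebra_simps)
qed

lemma compact_subset_cone_region: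
  assumes "compact K" "K \<subseteq> upper_half_plane"
  obtains y R where "y > 0" "R > 0" "K \<subseteq> cone_region y R" "\<And>\<tau>. \<tau> \<in> K \<Longrightarrow> norm \<tau> \<le> R"
proof (cases "K = {}")
  case True
  then show ?thesis using that[of 1 1] by auto
next
  case False
  have "continuous_on K Im" by (intro continuous_intros)
  then obtain \<tau>0 where \<tau>0: "\<tau>0 \<in> K" "\<And>\<tau>. \<tau> \<in> K \<Longrightarrow> Im \<tau>0 \<le> Im \<tau>"
    using continuous_attains_inf[OF assms(1) False] by metis
  have y: "Im \<tau>0 > 0" using \<tau>0 assms(2) by (auto simp: upper_half_plane_def)
  obtain B where B: "B > 0" "\<And>\<tau>. \<tau> \<in> K \<Longrightarrow> norm \<tau> \<le> B"
    using compact_imp_bounded[OF assms(1)] bounded_pos by metis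
  show ?thesis
  proof (rule that[OF y, of "max B (B / Im \<tau>0)"])
    show "K \<subseteq> cone_region (Im \<tau>0) (max B (B / Im \<tau>0))"
    proof
      fix \<tau> assume t: "\<tau> \<in> K"
      have "norm \<tau> \<le> B / Im \<tau>0 * Im \<tau>0" using B(2)[OF t] y by simp
      also have "\<dots> \<le> max B (B / Im \<tau>0) * Im \<tau>" using \<tau>0(2)[OF t] y B(1) by (intro mult_mono) auto
      finally show "\<tau> \<in> cone_region (Im \<tau>0) (max B (B / Im \<tau>0))" using \<tau>0(2)[OF t] by (simp add: cone_region_def)
    qed
  qed (use B in \<open>auto simp: less_max_iff_disj le_max_iff_disj\<close>)
qed

text \<open>The expression on the right equals (c\<tau> + d)(A\<tau> - cnj \<tau>0), and |A\<tau> -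
  cnj \<tau>0| \<ge> Im \<tau>0 because A\<tau> and \<tau>0 have positive imaginary parts. So it
  controls c\<tau> + d, hence a\<tau> + b, and through \<open>linear_form_bound\<close> all
  entries.\<close>

lemma conj_factor_bound:
  assumes "\<tau>0 \<in> upper_half_plane" "y > 0" "\<tau> \<in> cone_region y R" "A \<in> SL2Z"
  shows "mnorm A \<le> (1 / y + 1 + R) * (1 + (1 + norm \<tau>0) / Im \<tau>0) * norm (num_factor A \<tau> - cnj \<tau>0 * aut_factor A \<tau>)"
proof -
  have t0: "Im \<tau>0 > 0" using assms(1) by (simp add: upper_half_plane_def)
  have t: "\<tau> \<in> upper_half_plane" using assms(2,3) by (auto simp: cone_region_def upper_half_plane_def)
  define X where "X = num_factor A \<tau>"
  define Y where "Y = aut_factor A \<tau>"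
  define z where "z = moebius_action A \<tau>"
  define W where "W = norm (X - cnj \<tau>0 * Y)"
  have Y: "Y \<noteq> 0" using aut_factor_nonzero[OF assms(4) t] by (simp add: Y_def)
  have X: "X = z * Y" using Y by (simp add: X_def Y_def z_def moebius_action_eq)
  have z: "Im z > 0" using moebius_action_in_uhp[OF assms(4) t] by (simp add: z_def upper_half_plane_def)
  have W: "W = norm Y * norm (z - cnj \<tau>0)"
    unfolding W_def X by (simp add: norm_mult[symmetric] algebra_simps)
  have "\<bar>Im (z - cnj \<tau>0)\<bar> \<le> norm (z - cnj \<tau>0)" by (rule abs_Im_le_cmod)
  then have 1: "Im \<tau>0 \<le> norm (z - cnj \<tau>0)" using z t0 by simp
  then have "norm Y * Im \<tau>0 \<le> W" unfolding W by (intro mult_left_mono) auto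
  then have nY: "norm Y \<le> W / Im \<tau>0" using t0 by (simp add: field_simps)
  have "norm X = norm ((X - cnj \<tau>0 * Y) + cnj \<tau>0 * Y)" by simp
  also have "\<dots> \<le> W + norm \<tau>0 * norm Y" unfolding W_def by (metis norm_triangle_ineq norm_mult complex_mod_cnj)
  also have "norm \<tau>0 * norm Y \<le> norm \<tau>0 * (W / Im \<tau>0)" by (intro mult_left_mono nY) auto
  finally have nXY: "norm X + norm Y \<le> (1 + (1 + norm \<tau>0) / Im \<tau>0) * W"
    using nY by (simp add: algebra_simps add_divide_distrib)
  have "mnorm A = (\<bar>A$1$1\<bar> + \<bar>A$1$2\<bar>) + (\<bar>A$2$1\<bar> + \<bar>A$2$2\<bar>)" by (simp add: mnorm_def)
  also have "\<dots> \<le> (1 / y + 1 + R) * norm X + (1 / y + 1 + R) * norm Y"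
    unfolding X_def Y_def num_factor_def aut_factor_def by (intro add_mono linear_form_bound assms)
  also have "\<dots> = (1 / y + 1 + R) * (norm X + norm Y)" by (simp add: algebra_simps)
  also have "\<dots> \<le> (1 / y + 1 + R) * ((1 + (1 + norm \<tau>0) / Im \<tau>0) * W)"
  proof (intro mult_left_mono nXY)
    have "0 \<le> R * Im \<tau>" using assms(3) norm_ge_zero[of \<tau>] by (auto simp: cone_region_def simp del: norm_ge_zero)
    then have "R \<ge> 0" using t by (simp add: zero_le_mult_iff upper_half_plane_def)
    then show "0 \<le> 1 / y + 1 + R" using assms(2) by simp
  qed
  finally show ?thesis by (simp add: W_def X_def Y_def mult.assoc)
qed

section \<open>Periodic functions as functions of the nome\<close>

lemma nome_surj:
  assumes "q \<noteq> 0" "norm q < 1"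
  obtains \<tau> where "\<tau> \<in> upper_half_plane" "nome \<tau> = q"
proof (rule that)
  show "nome (Ln q / (2 * of_real pi * \<i>)) = q" using assms by (simp add: nome_def)
  show "Ln q / (2 * of_real pi * \<i>) \<in> upper_half_plane"
    using assms by (simp add: upper_half_plane_def Im_divide power2_eq_square divide_neg_pos)
qed

lemma periodic_int:
  assumes "\<And>\<tau>. \<tau> \<in> upper_half_plane \<Longrightarrow> f (\<tau> + 1) = f \<tau>" "\<tau> \<in> upper_half_plane"
  shows "f (\<tau> + of_int n) = f \<tau>"
proof -
  have pos: "f (\<tau> + of_nat m) = f \<tau>" if "\<tau> \<in> upper_half_plane" for m \<tau>
  proof (induction m)
    case (Suc m)
    then show ?case using assms(1)[of "\<tau> + of_nat m"] that by (simp add: upper_half_plane_def add_ac)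
  qed simp
  show ?thesis
  proof (cases "n \<ge> 0")
    case True
    then show ?thesis using pos[OF assms(2), of "nat n"] by simp
  next
    case False
    then show ?thesis using pos[of "\<tau> + of_int n" "nat (- n)"] assms(2) by (simp add: upper_half_plane_def)
  qed
qed

text \<open>Local branches of the logarithm make the induced function holomorphic on the punctured
  disc. The bound for Im \<tau> \<ge> 1, a neighbourhood of q = 0, removes the singularity.\<close>

lemma periodic_disc_function:
  assumes hol: "f holomorphic_on upper_half_plane"
    and per: "\<And>\<tau>. \<tau> \<in> upper_half_plane \<Longrightarrow> f (\<tau> + 1) = f \<tau>"
    and bd: "\<And>\<tau>. Im \<tau> \<ge> 1 \<Longrightarrow> norm (f \<tau>) \<le> B"
  obtains \<phi> where "\<phi> holomorphic_on ball 0 1" "\<And>\<tau>. \<tau> \<in> upper_half_plane \<Longrightarrow> f \<tau> = \<phi> (nome \<tau>)"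
proof -
  have same: "f \<tau> = f \<tau>'" if "\<tau> \<in> upper_half_plane" "\<tau>' \<in> upper_half_plane" "nome \<tau> = nome \<tau>'" for \<tau> \<tau>'
  proof -
    from that(3) obtain n :: int where "2 * of_real pi * \<i> * \<tau> = 2 * of_real pi * \<i> * \<tau>' + of_real (real_of_int (2 * n) * pi) * \<i>"
      unfolding nome_def exp_eq by blast
    then have "2 * of_real pi * \<i> * \<tau> = 2 * of_real pi * \<i> * (\<tau>' + of_int n)" by (simp add: algebra_simps)
    then have "\<tau> = \<tau>' + of_int n" by simp
    then show ?thesis using periodic_int[of f, OF per that(2)] by simp
  qed
  define npre where "npre = (\<lambda>q. SOME \<tau>. \<tau> \<in> upper_half_plane \<and> nome \<tau> = q)"
  have npre: "npre q \<in> upper_half_plane" "nome (npre q) = q" if "q \<noteq> 0" "norm q < 1" for q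
    using someI_ex[of "\<lambda>\<tau>. \<tau> \<in> upper_half_plane \<and> nome \<tau> = q"] nome_surj[OF that] unfolding npre_def by metis+
  define \<phi>0 where "\<phi>0 = (\<lambda>q. f (npre q))"
  have \<phi>0: "\<phi>0 (nome \<tau>) = f \<tau>" if "\<tau> \<in> upper_half_plane" for \<tau>
    unfolding \<phi>0_def by (rule same[OF npre(1) that npre(2)]) (use nome_in_ball[OF that] in auto)
  have "\<phi>0 holomorphic_on (ball 0 1 - {0})"
    unfolding holomorphic_on_def
  proof
    fix q0 :: complex assume q0: "q0 \<in> ball 0 1 - {0}"
    \<comment> \<open>A local inverse of the nome: on the disc of radius |q0| around q0 the quotient
      q/q0 avoids the branch cut of \<open>Ln\<close>, wherever q0 lies.\<close>
    define L where "L = (\<lambda>q. (Ln (q / q0) + Ln q0) / (2 * of_real pi * \<i>))"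
    define U where "U = ball 0 1 \<inter> ball q0 (norm q0)"
    have U: "open U" "q0 \<in> U" using q0 by (auto simp: U_def)
    have ne: "q \<noteq> 0" if "q \<in> U" for q using that by (auto simp: U_def dist_norm)
    have nr: "q / q0 \<notin> \<real>\<^sub>\<le>\<^sub>0" if "q \<in> U" for q
    proof
      assume "q / q0 \<in> \<real>\<^sub>\<le>\<^sub>0"
      then obtain r where r: "q / q0 = of_real r" "r \<le> 0" by (auto elim!: nonpos_Reals_cases)
      then have "q = of_real r * q0" using q0 by (simp add: field_simps)
      then have "norm (q0 - q) = norm (1 - r) * norm q0" 
        by (metis left_diff_distrib' mult_1 norm_mult norm_of_real of_real_1 of_real_diff real_norm_def)
      moreover have "norm (q0 - q) < norm q0" using that by (auto simp: U_def dist_norm)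
      ultimately show False using r q0 by (simp add: mult_less_cancel_right2)
    qed
    have nL: "nome (L q) = q" if "q \<in> U" for q
      using ne[OF that] q0 by (simp add: nome_def L_def exp_add)
    have "Im (L q) > 0" if "q \<in> U" for q
    proof -
      have "norm (nome (L q)) < 1" using nL that by (simp add: U_def)
      then show ?thesis by (simp add: norm_nome zero_less_mult_iff)
    qed
    then have LU: "L q \<in> upper_half_plane" if "q \<in> U" for q using that by (simp add: upper_half_plane_def)
    have "L holomorphic_on U" unfolding L_def by (intro holomorphic_intros) (use nr q0 in auto)
    then have "(f \<circ> L) holomorphic_on U" by (intro holomorphic_on_compose_gen[OF _ hol]) (use LU in auto)
    then have "\<phi>0 holomorphic_on U"
      by (rule holomorphic_transform) (use \<phi>0[OF LU] nL in auto)
    then have "\<phi>0 field_differentiable at q0" using U holomorphic_on_imp_differentiable_at by blast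
    then show "\<phi>0 field_differentiable at q0 within ball 0 1 - {0}" by (rule field_differentiable_at_within)
  qed
  moreover have "\<exists>B. \<forall>\<^sub>F q in at 0. norm (\<phi>0 q) \<le> B"
  proof (intro exI)
    show "\<forall>\<^sub>F q in at 0. norm (\<phi>0 q) \<le> B"
      unfolding eventually_at
    proof (intro exI conjI ballI impI)
      show "0 < exp (- 2 * pi)" by simp
      fix q :: complex assume q: "q \<noteq> 0 \<and> dist q 0 < exp (- 2 * pi)"
      have e1: "exp (- 2 * pi) < 1" by simp
      have qe: "norm q < exp (- 2 * pi)" using q by simp
      have q1: "q \<noteq> 0" "norm q < 1" using q less_trans[OF qe e1] by auto
      have "norm (nome (npre q)) < exp (- 2 * pi)" using q npre[OF q1] by simp
      then have "Im (npre q) \<ge> 1" by (simp add: norm_nome)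
      then show "norm (\<phi>0 q) \<le> B" unfolding \<phi>0_def by (rule bd)
    qed
  qed
  ultimately obtain \<phi> where \<phi>: "\<phi> holomorphic_on ball 0 1" "\<forall>z\<in>ball 0 1 - {0}. \<phi> z = \<phi>0 z"
    using holomorphic_on_extend_bounded[of \<phi>0 "ball 0 1" 0] by auto
  show ?thesis
  proof (rule that[OF \<phi>(1)])
    fix \<tau> assume "\<tau> \<in> upper_half_plane"
    then show "f \<tau> = \<phi> (nome \<tau>)" using \<phi>(2) nome_in_ball \<phi>0 by auto
  qed
qed

subsection \<open>Modular functions are polynomials in the j-invariant\<close>

lemma finite_summable_superlevel:
  fixes f :: "'a \<Rightarrow> real"
  assumes "f summable_on X" "\<And>x. x \<in> X \<Longrightarrow> f x \<ge> 0" "e > 0"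
  shows "finite {x\<in>X. f x \<ge> e}"
proof (rule ccontr)
  assume inf: "infinite {x\<in>X. f x \<ge> e}"
  define n where "n = nat \<lceil>infsum f X / e\<rceil> + 1"
  obtain B where B: "finite B" "card B = n" "B \<subseteq> {x\<in>X. f x \<ge> e}"
    using infinite_arbitrarily_large[OF inf] by blast
  have "real n * e = (\<Sum>x\<in>B. e)" by (simp add: B)
  also have "\<dots> \<le> sum f B" using B(3) by (intro sum_mono) auto
  also have "\<dots> \<le> infsum f X"
    using B assms by (intro finite_sum_le_infsum) auto
  finally have "real n \<le> infsum f X / e" using assms(3) by (simp add: field_simps)
  then show False unfolding n_def by linarith
qed

text \<open>The terms equal to 1 contribute their number for every n. All others are bounded in norm
  by some q < 1, since summability leaves only finitely many of norm at least 1/2, so their total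
  tends to 0.\<close>

lemma infsum_power_nonzero:
  fixes r :: "'a \<Rightarrow> complex"
  assumes sm: "(\<lambda>x. norm (r x)) summable_on X" and x0: "x0 \<in> X" "r x0 = 1"
    and lt: "\<And>x. x \<in> X \<Longrightarrow> r x \<noteq> 1 \<Longrightarrow> norm (r x) < 1"
  obtains n0 where "\<And>n. n \<ge> n0 \<Longrightarrow> infsum (\<lambda>x. r x ^ n) X \<noteq> 0"
proof -
  define S where "S = {x\<in>X. r x = 1}"
  define T where "T = {x\<in>X. norm (r x) \<ge> 1/2}"
  have T: "finite T" unfolding T_def by (rule finite_summable_superlevel[OF sm]) auto
  have ST: "S \<subseteq> T" by (auto simp: S_def T_def)
  then have S: "finite S" using T finite_subset by blast
  define q where "q = Max (insert (1/2) ((\<lambda>x. norm (r x)) ` (T - S)))"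
  have fin: "finite (insert (1/2) ((\<lambda>x. norm (r x)) ` (T - S)))" using T by simp
  have q1: "q < 1" unfolding q_def using lt by (subst Max_less_iff[OF fin]) (auto simp: S_def T_def)
  have q0: "q \<ge> 1/2" unfolding q_def using fin by (intro Max_ge) auto
  have le: "norm (r x) \<le> q" if "x \<in> X - S" for x
  proof (cases "x \<in> T")
    case True
    then show ?thesis unfolding q_def using fin that by (intro Max_ge) auto
  next
    case False
    then show ?thesis using q0 that by (auto simp: T_def)
  qed
  define W where "W = infsum (\<lambda>x. norm (r x)) X"
  have W0: "W \<ge> 0" unfolding W_def by (intro infsum_nonneg) auto
  have smS: "(\<lambda>x. norm (r x)) summable_on (X - S)"
    using sm by (rule summable_on_subset_banach) auto
  have WS: "infsum (\<lambda>x. norm (r x)) (X - S) \<le> W"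
    unfolding W_def by (rule infsum_mono2) (use sm smS in auto)
  have "(\<lambda>n. q ^ n * W) \<longlonglongrightarrow> 0 * W" using q0 q1 by (intro tendsto_mult LIMSEQ_power_zero) auto
  then have "\<forall>\<^sub>F n in sequentially. q ^ n * W < 1" by (intro order_tendstoD) auto
  then obtain n1 where n1: "\<And>n. n \<ge> n1 \<Longrightarrow> q ^ n * W < 1" by (auto simp: eventually_sequentially)
  show ?thesis
  proof (rule that)
    fix n assume "Suc n1 \<le> n"
    then obtain m where m: "n = Suc m" "m \<ge> n1" by (metis Suc_le_D Suc_le_mono)
    \<comment> \<open>One factor is kept back: it makes the bound summable, while the other m
      factors make it small.\<close>
    have bd: "norm (r x ^ n) \<le> q ^ m * norm (r x)" if "x \<in> X - S" for x
    proof -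
      have "norm (r x ^ n) = norm (r x) ^ m * norm (r x)" by (simp add: m norm_mult norm_power)
      also have "\<dots> \<le> q ^ m * norm (r x)" using le[OF that] by (intro mult_right_mono power_mono) auto
      finally show ?thesis .
    qed
    have smn: "(\<lambda>x. norm (r x ^ n)) summable_on (X - S)"
      by (rule Infinite_Sum.abs_summable_on_comparison_test'[OF summable_on_cmult_right[OF smS] bd])
    have "norm (infsum (\<lambda>x. r x ^ n) (X - S)) \<le> infsum (\<lambda>x. norm (r x ^ n)) (X - S)"
      by (rule norm_infsum_bound[OF smn])
    also have "\<dots> \<le> infsum (\<lambda>x. q ^ m * norm (r x)) (X - S)"
      by (intro infsum_mono smn summable_on_cmult_right smS bd)
    also have "\<dots> = q ^ m * infsum (\<lambda>x. norm (r x)) (X - S)"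
      by (intro infsum_cmult_right smS)
    also have "\<dots> \<le> q ^ m * W" using q0 by (intro mult_left_mono WS) auto
    also have "\<dots> < 1" by (rule n1[OF m(2)])
    finally have lt1: "norm (infsum (\<lambda>x. r x ^ n) (X - S)) < 1" .
    have "infsum (\<lambda>x. r x ^ n) (S \<union> (X - S)) = infsum (\<lambda>x. r x ^ n) S + infsum (\<lambda>x. r x ^ n) (X - S)"
      by (rule infsum_Un_disjoint[OF summable_on_finite[OF S] abs_summable_summable[OF smn]]) auto
    also have "S \<union> (X - S) = X" by (auto simp: S_def)
    also have "infsum (\<lambda>x. r x ^ n) S = (\<Sum>x\<in>S. 1)"
      using S by (auto simp: S_def intro!: sum.cong)
    finally have eq: "infsum (\<lambda>x. r x ^ n) X = of_nat (card S) + infsum (\<lambda>x. r x ^ n) (X - S)" by simp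
    have "x0 \<in> S" using x0 by (simp add: S_def)
    then have "card S \<ge> 1" using S by (metis One_nat_def Suc_leI card_gt_0_iff empty_iff)
    then have "norm (of_nat (card S) :: complex) \<ge> 1" by simp
    then show "infsum (\<lambda>x. r x ^ n) X \<noteq> 0"
      unfolding eq using lt1 by (metis add_eq_0_iff2 linorder_not_less norm_minus_cancel)
  qed
qed

text \<open>A level one function with a pole of order at most N at the cusp. Its q-expansion times
  q^N is carried along as \<phi>, so that the behaviour at the cusp can be argued at q = 0.\<close>

definition modular_function :: "nat \<Rightarrow> (complex \<Rightarrow> complex) \<Rightarrow> (complex \<Rightarrow> complex) \<Rightarrow> bool" where
  "modular_function N \<phi> f \<longleftrightarrow> \<phi> holomorphic_on ball 0 1 \<and>
     (\<forall>\<tau>\<in>upper_half_plane. f \<tau> * nome \<tau> ^ N = \<phi> (nome \<tau>)) \<and>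
     (\<forall>A\<in>SL2Z. \<forall>\<tau>\<in>upper_half_plane. f (moebius_action A \<tau>) = f \<tau>)"

lemma aut_factor_matS: "aut_factor matS \<tau> = \<tau>"
  and aut_factor_matT: "aut_factor matT \<tau> = 1"
  and aut_factor_adj2_matT: "aut_factor (adj2 matT) \<tau> = 1"
  by (simp_all add: aut_factor_def matS_def matT_def adj2_def)

lemma finite_bounded_rows:
  "finite {(c, d). c \<in> \<int> \<and> d \<in> \<int> \<and> \<bar>c\<bar> + \<bar>d\<bar> \<le> (B::real)}"
proof -
  have "{(c, d). c \<in> \<int> \<and> d \<in> \<int> \<and> \<bar>c\<bar> + \<bar>d\<bar> \<le> B} \<subseteq>
      (\<lambda>(c, d). (of_int c, of_int d)) ` ({-\<lceil>B\<rceil>..\<lceil>B\<rceil>} \<times> {-\<lceil>B\<rceil>..\<lceil>B\<rceil>})"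
  proof safe
    fix c d :: real assume "c \<in> \<int>" "d \<in> \<int>" and le: "\<bar>c\<bar> + \<bar>d\<bar> \<le> B"
    then obtain m n :: int where mn: "c = of_int m" "d = of_int n" by (auto elim!: Ints_cases)
    have "m \<in> {-\<lceil>B\<rceil>..\<lceil>B\<rceil>}" "n \<in> {-\<lceil>B\<rceil>..\<lceil>B\<rceil>}" using le unfolding mn by auto linarith+
    then show "(c, d) \<in> (\<lambda>(c, d). (of_int c, of_int d)) ` ({-\<lceil>B\<rceil>..\<lceil>B\<rceil>} \<times> {-\<lceil>B\<rceil>..\<lceil>B\<rceil>})"
      by (auto simp: mn image_iff)
  qed
  then show ?thesis by (rule finite_subset) auto
qed

text \<open>Minimising |c\<tau> + d| maximises the imaginary part. After a translation to |Re z|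
  \<le> 1/2, comparison with S forces |z| \<ge> 1, and |z| \<le> |Re z| + |Im z| gives the
  bound.\<close>

lemma SL2Z_reduce:
  assumes "\<tau> \<in> upper_half_plane"
  obtains A where "A \<in> SL2Z" "Im (moebius_action A \<tau>) \<ge> 1/2"
proof -
  have t: "Im \<tau> > 0" using assms by (simp add: upper_half_plane_def)
  define C where "C = 1 / Im \<tau> + 1 + norm \<tau> / Im \<tau>"
  have C0: "C > 0" using t by (auto simp: C_def intro!: add_pos_nonneg)
  define G where "G = {A\<in>SL2Z. norm (aut_factor A \<tau>) \<le> 1}"
  \<comment> \<open>The minimum is taken over values, since infinitely many matrices share a bottom
    row.\<close>
  define V where "V = (\<lambda>A. norm (aut_factor A \<tau>)) ` G"
  have "V \<subseteq> (\<lambda>(c, d). norm (of_real c * \<tau> + of_real d)) ` {(c, d). c \<in> \<int> \<and> d \<in> \<int> \<and> \<bar>c\<bar> + \<bar>d\<bar> \<le> C}"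
  proof
    fix x assume "x \<in> V"
    then obtain A where A: "A \<in> SL2Z" "norm (aut_factor A \<tau>) \<le> 1" "x = norm (aut_factor A \<tau>)"
      by (auto simp: V_def G_def)
    have "\<bar>A$2$1\<bar> + \<bar>A$2$2\<bar> \<le> C * norm (aut_factor A \<tau>)"
      unfolding aut_factor_def C_def by (rule linear_form_bound[OF t]) (use t in \<open>simp add: cone_region_def\<close>)
    also have "\<dots> \<le> C * 1" using A C0 by (intro mult_left_mono) auto
    finally show "x \<in> (\<lambda>(c, d). norm (of_real c * \<tau> + of_real d)) ` {(c, d). c \<in> \<int> \<and> d \<in> \<int> \<and> \<bar>c\<bar> + \<bar>d\<bar> \<le> C}"
      using A by (intro image_eqI[of _ _ "(A$2$1, A$2$2)"]) (auto simp: aut_factor_def SL2Z_iff)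
  qed
  then have V: "finite V" by (rule finite_subset) (intro finite_imageI finite_bounded_rows)
  have "mat 1 \<in> G" by (simp add: G_def SL2Z_one aut_factor_def mat_1_nth2)
  then have "V \<noteq> {}" by (auto simp: V_def)
  then have "Min V \<in> V" using V by simp
  then obtain A where A: "A \<in> SL2Z" "norm (aut_factor A \<tau>) \<le> 1" "norm (aut_factor A \<tau>) = Min V"
    by (auto simp: V_def G_def)
  have min: "norm (aut_factor A \<tau>) \<le> norm (aut_factor B \<tau>)" if "B \<in> SL2Z" for B
  proof (cases "norm (aut_factor B \<tau>) \<le> 1")
    case True
    then show ?thesis unfolding A(3) using V that by (intro Min_le) (auto simp: V_def G_def)
  qed (use A in simp)
  define n where "n = - round (Re (moebius_action A \<tau>))"
  define B where "B = mat2 1 (of_int n) 0 1 ** A"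
  have Tn: "mat2 1 (real_of_int n) 0 1 \<in> SL2Z" by (simp add: SL2Z_iff)
  have B: "B \<in> SL2Z" unfolding B_def by (intro SL2Z_mult Tn A)
  have afB: "aut_factor B \<tau> = aut_factor A \<tau>"
    by (simp add: aut_factor_def B_def matrix_mult_nth2)
  define z where "z = moebius_action B \<tau>"
  have zz: "z = moebius_action A \<tau> + of_int n"
    unfolding z_def B_def moebius_action_mult[OF Tn A(1) assms]
    by (simp add: moebius_action_eq[of "mat2 1 (of_int n) 0 1"] num_factor_def aut_factor_def)
  have re: "\<bar>Re z\<bar> \<le> 1/2"
    using of_int_round_abs_le[of "Re (moebius_action A \<tau>)"] by (simp add: zz n_def abs_minus_commute)
  have "norm (aut_factor A \<tau>) \<le> norm (aut_factor (matS ** B) \<tau>)"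
    by (intro min SL2Z_mult matS_SL2Z B)
  also have "aut_factor (matS ** B) \<tau> = z * aut_factor A \<tau>"
    unfolding aut_factor_mult[OF matS_SL2Z B assms] afB by (simp add: z_def aut_factor_matS)
  finally have "norm z \<ge> 1" using aut_factor_nonzero[OF A(1) assms] by (simp add: norm_mult)
  have zpos: "Im z > 0" using moebius_action_in_uhp[OF B assms] by (simp add: z_def upper_half_plane_def)
  have "Im z \<ge> 1/2"
  proof (rule ccontr)
    assume "\<not> Im z \<ge> 1/2"
    then have "\<bar>Im z\<bar> < 1/2" using zpos by simp
    then have "norm z < 1" using cmod_le[of z] re by linarith
    then show False using \<open>norm z \<ge> 1\<close> by simp
  qed
  then show ?thesis using that[OF B] by (simp add: z_def)
qed

text \<open>Every orbit meets Im \<tau> \<ge> 1/2, where |q| \<le> exp(-pi). So the maximum of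
  |\<phi>| over this closed disc is a maximum over the whole open unit disc.\<close>

lemma modular_function_0_constant:
  assumes "modular_function 0 \<phi> f" "q \<in> ball 0 1"
  shows "\<phi> q = \<phi> 0"
proof -
  have hol: "\<phi> holomorphic_on ball 0 1"
    and f: "\<And>\<tau>. \<tau> \<in> upper_half_plane \<Longrightarrow> \<phi> (nome \<tau>) = f \<tau>"
    and inv: "\<And>A \<tau>. A \<in> SL2Z \<Longrightarrow> \<tau> \<in> upper_half_plane \<Longrightarrow> f (moebius_action A \<tau>) = f \<tau>"
    using assms(1) by (auto simp: modular_function_def)
  define r where "r = exp (- pi)"
  have r: "0 < r" "r < 1" by (auto simp: r_def)
  then have "continuous_on (cball 0 r) (\<lambda>q. norm (\<phi> q))"
    by (intro continuous_intros holomorphic_on_imp_continuous_on holomorphic_on_subset[OF hol]) auto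
  then obtain q0 where q0: "q0 \<in> cball 0 r" "\<And>q. q \<in> cball 0 r \<Longrightarrow> norm (\<phi> q) \<le> norm (\<phi> q0)"
    using continuous_attains_sup[of "cball 0 r" "\<lambda>q. norm (\<phi> q)"] r by (metis cball_eq_empty compact_cball not_less_iff_gr_or_eq)
  have "\<phi> constant_on ball 0 1"
  proof (rule maximum_modulus_principle[OF hol])
    show "q0 \<in> ball 0 1" using q0(1) r by auto
    fix q :: complex assume q: "q \<in> ball 0 1"
    show "norm (\<phi> q) \<le> norm (\<phi> q0)"
    proof (cases "q = 0")
      case True
      then show ?thesis using q0(2)[of 0] r by simp
    next
      case False
      then obtain \<tau> where \<tau>: "\<tau> \<in> upper_half_plane" "nome \<tau> = q" using nome_surj[of q] q by auto
      obtain A where A: "A \<in> SL2Z" "Im (moebius_action A \<tau>) \<ge> 1/2" using SL2Z_reduce[OF \<tau>(1)] .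
      have "\<phi> q = \<phi> (nome (moebius_action A \<tau>))"
        using f[OF \<tau>(1)] f[OF moebius_action_in_uhp[OF A(1) \<tau>(1)]] inv[OF A(1) \<tau>(1)] \<tau>(2) by simp
      moreover have "nome (moebius_action A \<tau>) \<in> cball 0 r" using A(2) by (simp add: norm_nome r_def)
      ultimately show ?thesis using q0(2) by simp
    qed
  qed auto
  then show ?thesis using assms(2) by (auto simp: constant_on_def)
qed

text \<open>Induction on the order of the pole: j has a simple pole at the cusp, so a multiple of
  its power removes the leading coefficient.\<close>

lemma modular_function_poly:
  assumes j: "modular_function 1 \<phi>j j" "\<phi>j 0 \<noteq> 0"
  shows "modular_function N \<phi> f \<Longrightarrow> \<exists>P. \<forall>\<tau>\<in>upper_half_plane. f \<tau> = poly P (j \<tau>)"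
proof (induction N arbitrary: \<phi> f)
  case 0
  have "f \<tau> = poly [:\<phi> 0:] (j \<tau>)" if "\<tau> \<in> upper_half_plane" for \<tau>
    using modular_function_0_constant[OF 0 nome_in_ball[OF that]] 0 that by (simp add: modular_function_def)
  then show ?case by blast
next
  case (Suc N)
  have hol: "\<phi> holomorphic_on ball 0 1"
    and f: "\<And>\<tau>. \<tau> \<in> upper_half_plane \<Longrightarrow> f \<tau> * nome \<tau> ^ Suc N = \<phi> (nome \<tau>)"
    and inv: "\<And>A \<tau>. A \<in> SL2Z \<Longrightarrow> \<tau> \<in> upper_half_plane \<Longrightarrow> f (moebius_action A \<tau>) = f \<tau>"
    using Suc.prems by (auto simp: modular_function_def)
  have holj: "\<phi>j holomorphic_on ball 0 1"
    and fj: "\<And>\<tau>. \<tau> \<in> upper_half_plane \<Longrightarrow> j \<tau> * nome \<tau> = \<phi>j (nome \<tau>)"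
    and invj: "\<And>A \<tau>. A \<in> SL2Z \<Longrightarrow> \<tau> \<in> upper_half_plane \<Longrightarrow> j (moebius_action A \<tau>) = j \<tau>"
    using j(1) by (auto simp: modular_function_def)
  define c where "c = \<phi> 0 / \<phi>j 0 ^ Suc N"
  have "(\<lambda>q. \<phi> q - c * \<phi>j q ^ Suc N) holomorphic_on ball 0 1"
    by (intro holomorphic_intros hol holj)
  then obtain \<psi> where \<psi>: "\<psi> holomorphic_on ball 0 1"
      "\<And>q. q \<in> ball 0 1 \<Longrightarrow> \<phi> q - c * \<phi>j q ^ Suc N = q * \<psi> q"
    by (rule factor_zero_disc) (use j(2) in \<open>auto simp: c_def\<close>)
  define f' where "f' = (\<lambda>\<tau>. f \<tau> - c * j \<tau> ^ Suc N)"
  have "modular_function N \<psi> f'"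
    unfolding modular_function_def
  proof (intro conjI ballI)
    fix \<tau> assume \<tau>: "\<tau> \<in> upper_half_plane"
    have "f' \<tau> * nome \<tau> ^ Suc N = \<phi> (nome \<tau>) - c * \<phi>j (nome \<tau>) ^ Suc N"
      unfolding f'_def left_diff_distrib f[OF \<tau>] fj[OF \<tau>, symmetric] by (simp add: power_mult_distrib mult_ac)
    also have "\<dots> = nome \<tau> * \<psi> (nome \<tau>)" by (rule \<psi>(2)[OF nome_in_ball[OF \<tau>]])
    finally show "f' \<tau> * nome \<tau> ^ N = \<psi> (nome \<tau>)" by simp
  qed (use \<psi> inv invj in \<open>auto simp: f'_def\<close>)
  from Suc.IH[OF this] obtain P where P: "\<And>\<tau>. \<tau> \<in> upper_half_plane \<Longrightarrow> f' \<tau> = poly P (j \<tau>)" by blast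
  have "f \<tau> = poly (P + monom c (Suc N)) (j \<tau>)" if "\<tau> \<in> upper_half_plane" for \<tau>
    using P[OF that] by (simp add: f'_def poly_monom algebra_simps)
  then show ?case by blast
qed

text \<open>The laws under T and S extend to the group by the multiplicativity of
  \<open>aut_factor\<close>. The weight is a parameter because the discriminant and the series of
  weight four are both treated this way.\<close>

lemma modular_discriminant_action:
  assumes per: "\<And>\<tau>. \<tau> \<in> upper_half_plane \<Longrightarrow> D (\<tau> + 1) = D \<tau>"
    and S: "\<And>\<tau>. \<tau> \<in> upper_half_plane \<Longrightarrow> D (-1 / \<tau>) = \<tau> ^ k * D \<tau>"
    and A: "A \<in> SL2Z" "\<tau> \<in> upper_half_plane"
  shows "D (moebius_action A \<tau>) = aut_factor A \<tau> ^ k * D \<tau>"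
  using A
proof (induction arbitrary: \<tau> rule: SL2Z_induct)
  case one
  then show ?case by (simp add: moebius_action_one aut_factor_def mat_1_nth2)
next
  case (T B)
  note m = aut_factor_mult[OF T(1) matT_SL2Z T(3)] moebius_action_mult[OF T(1) matT_SL2Z T(3)]
  have "\<tau> + 1 \<in> upper_half_plane" using T(3) by (simp add: upper_half_plane_def)
  from T.IH[OF this] show ?case unfolding m moebius_action_matT per[OF T(3)]
    by (simp add: aut_factor_matT)
next
  case (T_inv B)
  note m = aut_factor_mult[OF T_inv(1) SL2Z_adj2[OF matT_SL2Z] T_inv(3)] moebius_action_mult[OF T_inv(1) SL2Z_adj2[OF matT_SL2Z] T_inv(3)]
  have *: "\<tau> - 1 \<in> upper_half_plane" using T_inv(3) by (simp add: upper_half_plane_def)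
  have "D (\<tau> - 1) = D \<tau>" using per[OF *] by simp
  with T_inv.IH[OF *] show ?case unfolding m moebius_action_adj2_matT
    by (simp add: aut_factor_adj2_matT)
next
  case (S B)
  note m = aut_factor_mult[OF S(1) matS_SL2Z S(3)] moebius_action_mult[OF S(1) matS_SL2Z S(3)]
  from S.IH[OF upper_half_plane_neg_inverse[OF S(3)]] show ?case unfolding m moebius_action_matS assms(2)[OF S(3)]
    by (simp add: aut_factor_matS power_mult_distrib)
qed

lemma ex_modular_functions:
  obtains D u j \<phi> where "D holomorphic_on upper_half_plane" "\<And>\<tau>. \<tau> \<in> upper_half_plane \<Longrightarrow> D \<tau> \<noteq> 0"
    "u holomorphic_on ball 0 1" "\<And>q. q \<in> ball 0 1 \<Longrightarrow> u q \<noteq> 0" "\<And>\<tau>. D \<tau> = nome \<tau> * u (nome \<tau>)"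
    "\<And>A \<tau>. A \<in> SL2Z \<Longrightarrow> \<tau> \<in> upper_half_plane \<Longrightarrow> D (moebius_action A \<tau>) = aut_factor A \<tau> ^ 12 * D \<tau>"
    "modular_function 1 \<phi> j" "\<phi> 0 \<noteq> 0" "j holomorphic_on upper_half_plane"
proof -
  obtain D u where D: "D holomorphic_on upper_half_plane" "u holomorphic_on ball 0 1"
    "\<And>q. q \<in> ball 0 1 \<Longrightarrow> u q \<noteq> 0"
    "\<And>\<tau>. D \<tau> = nome \<tau> * u (nome \<tau>)"
    "\<And>\<tau>. \<tau> \<in> upper_half_plane \<Longrightarrow> D (-1 / \<tau>) = \<tau> ^ 12 * D \<tau>"
    using ex_discriminant by blast
  obtain e where e: "e holomorphic_on ball 0 1" "e 0 \<noteq> 0"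
    "\<And>\<tau>. \<tau> \<in> upper_half_plane \<Longrightarrow> e (nome (-1 / \<tau>)) = \<tau> ^ 4 * e (nome \<tau>)"
    using ex_eisen4 by blast
  have uq: "u (nome \<tau>) \<noteq> 0" if "\<tau> \<in> upper_half_plane" for \<tau>
    using D(3)[OF nome_in_ball[OF that]] .
  have DA: "D (moebius_action A \<tau>) = aut_factor A \<tau> ^ 12 * D \<tau>" if "A \<in> SL2Z" "\<tau> \<in> upper_half_plane" for A \<tau>
    by (rule modular_discriminant_action[of D 12, OF _ D(5) that]) (simp_all add: D(4) nome_plus_1)
  have eA: "e (nome (moebius_action A \<tau>)) = aut_factor A \<tau> ^ 4 * e (nome \<tau>)" if "A \<in> SL2Z" "\<tau> \<in> upper_half_plane" for A \<tau>
    by (rule modular_discriminant_action[of "\<lambda>\<tau>. e (nome \<tau>)" 4, OF _ e(3) that]) (simp_all add: nome_plus_1)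
  \<comment> \<open>Up to a constant this is the classical E_4^3 / Delta; the simple zero of D at q
    = 0 produces the simple pole.\<close>
  define j where "j = (\<lambda>\<tau>. e (nome \<tau>) ^ 3 / D \<tau>)"
  define \<phi> where "\<phi> = (\<lambda>q. e q ^ 3 / u q)"
  show ?thesis
  proof (rule that[of D u \<phi> j])
    have "(e \<circ> nome) holomorphic_on upper_half_plane"
      by (rule holomorphic_on_compose_gen[OF holomorphic_on_nome e(1)]) (use nome_in_ball in auto)
    then have "(\<lambda>\<tau>. e (nome \<tau>)) holomorphic_on upper_half_plane" by (simp add: o_def)
    then show "j holomorphic_on upper_half_plane"
      unfolding j_def by (intro holomorphic_intros D(1)) (use uq in \<open>auto simp: D(4)\<close>)
    show "modular_function 1 \<phi> j"
      unfolding modular_function_def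
    proof (intro conjI ballI)
      show "\<phi> holomorphic_on ball 0 1" unfolding \<phi>_def by (intro holomorphic_intros e D) (use D(3) in auto)
      fix \<tau> assume \<tau>: "\<tau> \<in> upper_half_plane"
      show "j \<tau> * nome \<tau> ^ 1 = \<phi> (nome \<tau>)" by (simp add: j_def \<phi>_def D(4))
      fix A assume A: "A \<in> SL2Z"
      show "j (moebius_action A \<tau>) = j \<tau>"
        unfolding j_def DA[OF A \<tau>] eA[OF A \<tau>] using aut_factor_nonzero[OF A \<tau>]
        by (simp add: power_mult_distrib flip: power_mult)
    qed
    show "\<phi> 0 \<noteq> 0" using e(2) D(3)[of 0] by (simp add: \<phi>_def)
    show "D \<tau> \<noteq> 0" if "\<tau> \<in> upper_half_plane" for \<tau> using uq[OF that] by (simp add: D(4))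
  qed (use D DA in auto)
qed

subsection \<open>Partitions of unity along orbits of the modular group\<close>

lemma continuous_on_compact_norm_bound:
  fixes f :: "'a::topological_space \<Rightarrow> 'b::real_normed_vector"
  assumes "compact K" "continuous_on K f"
  obtains B where "B > 0" "\<And>x. x \<in> K \<Longrightarrow> norm (f x) \<le> B"
proof -
  have "bounded (f ` K)" using assms by (intro compact_imp_bounded compact_continuous_image)
  then obtain B where "B > 0" "\<forall>y\<in>f ` K. norm y \<le> B" unfolding bounded_pos by blast
  then show ?thesis using that by simp
qed

text \<open>The bound supplies C / \<open>mnorm A ^ 8\<close> as a summable majorant on compact
  sets; the number 8 in all later decay conditions comes from here.\<close>

lemma infsum_SL2Z_holomorphic:
  assumes hol: "\<And>A. A \<in> SL2Z \<Longrightarrow> F A holomorphic_on upper_half_plane"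
    and bd: "\<And>K. compact K \<Longrightarrow> K \<subseteq> upper_half_plane \<Longrightarrow> \<exists>C. \<forall>\<tau>\<in>K. \<forall>A\<in>SL2Z. norm (F A \<tau>) * mnorm A ^ 8 \<le> C"
  shows "(\<lambda>\<tau>. infsum (\<lambda>A. F A \<tau>) SL2Z) holomorphic_on upper_half_plane"
    and "\<And>\<tau>. \<tau> \<in> upper_half_plane \<Longrightarrow> (\<lambda>A. norm (F A \<tau>)) summable_on SL2Z"
proof -
  have bd': "\<exists>C. \<forall>\<tau>\<in>K. \<forall>A\<in>SL2Z. norm (F A \<tau>) \<le> C * (1 / mnorm A ^ 8)" if K: "compact K" "K \<subseteq> upper_half_plane" for K
  proof -
    obtain C where C: "\<And>\<tau> A. \<tau> \<in> K \<Longrightarrow> A \<in> SL2Z \<Longrightarrow> norm (F A \<tau>) * mnorm A ^ 8 \<le> C"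
      using bd[OF K] by blast
    have "norm (F A \<tau>) \<le> C * (1 / mnorm A ^ 8)" if "\<tau> \<in> K" "A \<in> SL2Z" for \<tau> A
    proof -
      have "mnorm A ^ 8 > 0" using mnorm_ge_1[OF that(2)] by simp
      then show ?thesis using C[OF that] by (simp add: field_simps)
    qed
    then show ?thesis by blast
  qed
  show "(\<lambda>A. norm (F A \<tau>)) summable_on SL2Z" if t: "\<tau> \<in> upper_half_plane" for \<tau>
  proof -
    obtain C where C: "\<And>A. A \<in> SL2Z \<Longrightarrow> norm (F A \<tau>) \<le> C * (1 / mnorm A ^ 8)"
      using bd'[of "{\<tau>}"] t by auto
    show ?thesis
      by (rule Infinite_Sum.abs_summable_on_comparison_test'[OF summable_on_cmult_right[OF summable_on_mnorm] C])
  qed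
  show "(\<lambda>\<tau>. infsum (\<lambda>A. F A \<tau>) SL2Z) holomorphic_on upper_half_plane"
    unfolding holomorphic_on_open[OF open_upper_half_plane]
  proof
    fix z assume z: "z \<in> upper_half_plane"
    obtain r where r: "r > 0" "cball z r \<subseteq> upper_half_plane"
      using open_upper_half_plane z open_contains_cball by metis
    obtain C where C: "\<And>\<tau> A. \<tau> \<in> cball z r \<Longrightarrow> A \<in> SL2Z \<Longrightarrow> norm (F A \<tau>) \<le> C * (1 / mnorm A ^ 8)"
      using bd'[OF compact_cball r(2)] by blast
    have ul: "uniform_limit (cball z r) (\<lambda>X \<tau>. \<Sum>A\<in>X. F A \<tau>) (\<lambda>\<tau>. infsum (\<lambda>A. F A \<tau>) SL2Z) (finite_subsets_at_top SL2Z)"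
      by (rule Weierstrass_m_test_general[where M = "\<lambda>A. C * (1 / mnorm A ^ 8)"])
         (use C summable_on_cmult_right[OF summable_on_mnorm] in auto)
    have ev: "\<forall>\<^sub>F X in finite_subsets_at_top SL2Z. continuous_on (cball z r) (\<lambda>\<tau>. \<Sum>A\<in>X. F A \<tau>) \<and> (\<lambda>\<tau>. \<Sum>A\<in>X. F A \<tau>) holomorphic_on ball z r"
    proof (rule eventually_finite_subsets_at_top_weakI)
      fix X assume X: "finite X" "X \<subseteq> SL2Z"
      have "(\<lambda>\<tau>. \<Sum>A\<in>X. F A \<tau>) holomorphic_on upper_half_plane"
        using X by (intro holomorphic_on_sum hol) auto
      then show "continuous_on (cball z r) (\<lambda>\<tau>. \<Sum>A\<in>X. F A \<tau>) \<and> (\<lambda>\<tau>. \<Sum>A\<in>X. F A \<tau>) holomorphic_on ball z r"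
        using r by (meson ball_subset_cball holomorphic_on_imp_continuous_on holomorphic_on_subset order_trans)
    qed
    from holomorphic_uniform_limit[OF ev ul] have "(\<lambda>\<tau>. infsum (\<lambda>A. F A \<tau>) SL2Z) holomorphic_on ball z r"
      by (auto simp: finite_subsets_at_top_neq_bot)
    then show "\<exists>f'. ((\<lambda>\<tau>. infsum (\<lambda>A. F A \<tau>) SL2Z) has_field_derivative f') (at z)"
      using r by (auto simp: holomorphic_on_open)
  qed
qed

text \<open>Decay is measured in the norm of the group element, locally uniformly in \<tau>, so that
  it can be set against the growth of the cocycle in the same norm.\<close>

definition orbit_decay :: "nat \<Rightarrow> (complex \<Rightarrow> complex) \<Rightarrow> bool" where
  "orbit_decay M h \<longleftrightarrow> h holomorphic_on upper_half_plane \<and>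
     (\<forall>K. compact K \<longrightarrow> K \<subseteq> upper_half_plane \<longrightarrow>
        (\<exists>C. \<forall>\<tau>\<in>K. \<forall>A\<in>SL2Z. norm (h (moebius_action A \<tau>)) * mnorm A ^ M \<le> C))"

lemma orbit_decayE:
  assumes "orbit_decay M h" "compact K" "K \<subseteq> upper_half_plane"
  obtains C where "\<And>\<tau> A. \<tau> \<in> K \<Longrightarrow> A \<in> SL2Z \<Longrightarrow> norm (h (moebius_action A \<tau>)) * mnorm A ^ M \<le> C"
proof -
  have "\<exists>C. \<forall>\<tau>\<in>K. \<forall>A\<in>SL2Z. norm (h (moebius_action A \<tau>)) * mnorm A ^ M \<le> C"
    using assms by (simp add: orbit_decay_def)
  then show ?thesis using that by metis
qed

lemma orbit_decayI:
  assumes "h holomorphic_on upper_half_plane"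
    "\<And>K. compact K \<Longrightarrow> K \<subseteq> upper_half_plane \<Longrightarrow>
       \<exists>C. \<forall>\<tau>\<in>K. \<forall>A\<in>SL2Z. norm (h (moebius_action A \<tau>)) * mnorm A ^ M \<le> C"
  shows "orbit_decay M h"
  using assms by (simp add: orbit_decay_def)

lemma orbit_decay_holomorphic: "orbit_decay M h \<Longrightarrow> h holomorphic_on upper_half_plane"
  by (simp add: orbit_decay_def)

lemma orbit_decay_diff:
  assumes "orbit_decay M f" "orbit_decay M g"
  shows "orbit_decay M (\<lambda>\<tau>. f \<tau> - g \<tau>)"
proof (rule orbit_decayI)
  show "(\<lambda>\<tau>. f \<tau> - g \<tau>) holomorphic_on upper_half_plane"
    using assms by (intro holomorphic_on_diff) (auto simp: orbit_decay_def)
  fix K assume K: "compact K" "K \<subseteq> upper_half_plane"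
  obtain C where C: "\<And>\<tau> A. \<tau> \<in> K \<Longrightarrow> A \<in> SL2Z \<Longrightarrow> norm (f (moebius_action A \<tau>)) * mnorm A ^ M \<le> C"
    using orbit_decayE[OF assms(1) K] by metis
  obtain C' where C': "\<And>\<tau> A. \<tau> \<in> K \<Longrightarrow> A \<in> SL2Z \<Longrightarrow> norm (g (moebius_action A \<tau>)) * mnorm A ^ M \<le> C'"
    using orbit_decayE[OF assms(2) K] by metis
  have "norm (f (moebius_action A \<tau>) - g (moebius_action A \<tau>)) * mnorm A ^ M \<le> C + C'"
    if "\<tau> \<in> K" "A \<in> SL2Z" for \<tau> A
  proof -
    have "norm (f (moebius_action A \<tau>) - g (moebius_action A \<tau>)) * mnorm A ^ M \<le>
       (norm (f (moebius_action A \<tau>)) + norm (g (moebius_action A \<tau>))) * mnorm A ^ M"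
      by (intro mult_right_mono norm_triangle_ineq4) (simp add: mnorm_nonneg)
    then show ?thesis using C[OF that] C'[OF that] by (simp add: distrib_right)
  qed
  then show "\<exists>C. \<forall>\<tau>\<in>K. \<forall>A\<in>SL2Z. norm (f (moebius_action A \<tau>) - g (moebius_action A \<tau>)) * mnorm A ^ M \<le> C"
    by blast
qed

text \<open>An invariant factor is constant along orbits and bounded on compact sets. This gives the
  orbit sums of a fixed decay the structure of a module over the polynomials in j.\<close>

lemma orbit_decay_mult_invariant:
  assumes "orbit_decay M h" "f holomorphic_on upper_half_plane"
    "\<And>A \<tau>. A \<in> SL2Z \<Longrightarrow> \<tau> \<in> upper_half_plane \<Longrightarrow> f (moebius_action A \<tau>) = f \<tau>"
  shows "orbit_decay M (\<lambda>\<tau>. f \<tau> * h \<tau>)"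
proof (rule orbit_decayI)
  show "(\<lambda>\<tau>. f \<tau> * h \<tau>) holomorphic_on upper_half_plane"
    using assms by (intro holomorphic_on_mult) (auto simp: orbit_decay_def)
  fix K assume K: "compact K" "K \<subseteq> upper_half_plane"
  obtain C where C: "\<And>\<tau> A. \<tau> \<in> K \<Longrightarrow> A \<in> SL2Z \<Longrightarrow> norm (h (moebius_action A \<tau>)) * mnorm A ^ M \<le> C"
    using orbit_decayE[OF assms(1) K] by metis
  have "continuous_on K f"
    using K assms(2) by (meson holomorphic_on_imp_continuous_on holomorphic_on_subset)
  then obtain B where B: "B > 0" "\<And>\<tau>. \<tau> \<in> K \<Longrightarrow> norm (f \<tau>) \<le> B"
    using continuous_on_compact_norm_bound[OF K(1)] by metis
  have "norm (f (moebius_action A \<tau>) * h (moebius_action A \<tau>)) * mnorm A ^ M \<le> B * \<bar>C\<bar>"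
    if "\<tau> \<in> K" "A \<in> SL2Z" for \<tau> A
  proof -
    have "norm (f (moebius_action A \<tau>) * h (moebius_action A \<tau>)) * mnorm A ^ M
       = norm (f \<tau>) * (norm (h (moebius_action A \<tau>)) * mnorm A ^ M)"
      using assms(3)[OF that(2)] that K by (auto simp: norm_mult)
    also have "\<dots> \<le> B * \<bar>C\<bar>"
      using B that order_trans[OF C[OF that] abs_ge_self] by (intro mult_mono) (auto simp: mnorm_nonneg)
    finally show ?thesis .
  qed
  then show "\<exists>C. \<forall>\<tau>\<in>K. \<forall>A\<in>SL2Z. norm (f (moebius_action A \<tau>) * h (moebius_action A \<tau>)) * mnorm A ^ M \<le> C"
    by blast
qed

lemma has_sum_SL2Z_translate:
  assumes "A \<in> SL2Z"
  shows "((\<lambda>B. f (B ** A)) has_sum s) SL2Z \<longleftrightarrow> (f has_sum s) SL2Z"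
  by (rule has_sum_reindex_bij_witness[of _ "\<lambda>B. B ** adj2 A" "\<lambda>B. B ** A"])
     (auto simp: adj2_mult_cancel assms SL2Z_mult SL2Z_adj2)

lemma orbit_decay_infsum:
  assumes "orbit_decay 8 h"
  defines "E \<equiv> \<lambda>\<tau>. infsum (\<lambda>A. h (moebius_action A \<tau>)) SL2Z"
  shows "E holomorphic_on upper_half_plane"
    and "\<And>\<tau>. \<tau> \<in> upper_half_plane \<Longrightarrow> (\<lambda>A. norm (h (moebius_action A \<tau>))) summable_on SL2Z"
    and "\<And>\<tau>. \<tau> \<in> upper_half_plane \<Longrightarrow> ((\<lambda>A. h (moebius_action A \<tau>)) has_sum E \<tau>) SL2Z"
    and "\<And>A \<tau>. A \<in> SL2Z \<Longrightarrow> \<tau> \<in> upper_half_plane \<Longrightarrow> E (moebius_action A \<tau>) = E \<tau>"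
proof -
  have hol: "(\<lambda>\<tau>. h (moebius_action A \<tau>)) holomorphic_on upper_half_plane" if "A \<in> SL2Z" for A
    using holomorphic_on_compose_gen[OF holomorphic_moebius_action[OF that], of h upper_half_plane]
      moebius_action_in_uhp[OF that] assms(1) by (auto simp: o_def orbit_decay_def)
  have bd: "\<exists>C. \<forall>\<tau>\<in>K. \<forall>A\<in>SL2Z. norm (h (moebius_action A \<tau>)) * mnorm A ^ 8 \<le> C"
    if "compact K" "K \<subseteq> upper_half_plane" for K
    using assms(1) that by (simp add: orbit_decay_def)
  note F = infsum_SL2Z_holomorphic[of "\<lambda>A \<tau>. h (moebius_action A \<tau>)", OF hol bd]
  show "E holomorphic_on upper_half_plane" unfolding E_def by (rule F(1))
  show "(\<lambda>A. norm (h (moebius_action A \<tau>))) summable_on SL2Z" if "\<tau> \<in> upper_half_plane" for \<tau>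
    by (rule F(2)) (use that in auto)
  note sm = this
  show hs: "((\<lambda>A. h (moebius_action A \<tau>)) has_sum E \<tau>) SL2Z" if "\<tau> \<in> upper_half_plane" for \<tau>
    unfolding E_def by (rule has_sum_infsum[OF abs_summable_summable[OF sm[OF that]]])
  fix A \<tau> assume A: "A \<in> SL2Z" "\<tau> \<in> upper_half_plane"
  have "((\<lambda>B. h (moebius_action (B ** A) \<tau>)) has_sum E \<tau>) SL2Z"
    using has_sum_SL2Z_translate[OF A(1), of "\<lambda>B. h (moebius_action B \<tau>)"] hs[OF A(2)] by simp
  also have "?this \<longleftrightarrow> ((\<lambda>B. h (moebius_action B (moebius_action A \<tau>))) has_sum E \<tau>) SL2Z"
    by (rule has_sum_cong) (simp add: moebius_action_mult A)
  finally show "E (moebius_action A \<tau>) = E \<tau>"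
    using hs[OF moebius_action_in_uhp[OF A]] has_sum_unique by blast
qed

text \<open>The quotient of the two norms is the hyperbolic cosine of half the distance from \<open>\<tau>0\<close> to \<open>A\<tau>0\<close>.\<close>

lemma reproducing_ratio:
  assumes "\<tau>0 \<in> upper_half_plane" "A \<in> SL2Z"
  shows "norm (\<tau>0 - cnj \<tau>0) \<le> norm (num_factor A \<tau>0 - cnj \<tau>0 * aut_factor A \<tau>0)"
    and "norm (\<tau>0 - cnj \<tau>0) = norm (num_factor A \<tau>0 - cnj \<tau>0 * aut_factor A \<tau>0) \<Longrightarrow> moebius_action A \<tau>0 = \<tau>0"
proof -
  define z where "z = moebius_action A \<tau>0"
  define W where "W = norm (num_factor A \<tau>0 - cnj \<tau>0 * aut_factor A \<tau>0)"
  have t0: "Im \<tau>0 > 0" using assms(1) by (simp add: upper_half_plane_def)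
  have nz: "aut_factor A \<tau>0 \<noteq> 0" using aut_factor_nonzero[OF assms(2,1)] .
  have zpos: "Im z > 0" using moebius_action_in_uhp[OF assms(2,1)] by (simp add: z_def upper_half_plane_def)
  have "Im z = Im \<tau>0 / (norm (aut_factor A \<tau>0))\<^sup>2"
    unfolding z_def by (rule Im_moebius_action[OF assms(2,1)])
  then have Y: "(norm (aut_factor A \<tau>0))\<^sup>2 = Im \<tau>0 / Im z" using nz t0 zpos by (simp add: field_simps)
  have "num_factor A \<tau>0 - cnj \<tau>0 * aut_factor A \<tau>0 = aut_factor A \<tau>0 * (z - cnj \<tau>0)"
    using nz by (simp add: z_def moebius_action_eq right_diff_distrib)
  then have "W\<^sup>2 = Im \<tau>0 / Im z * (norm (z - cnj \<tau>0))\<^sup>2"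
    by (simp add: W_def norm_mult power_mult_distrib Y)
  also have "(norm (z - cnj \<tau>0))\<^sup>2 = (norm (z - \<tau>0))\<^sup>2 + 4 * Im \<tau>0 * Im z"
    unfolding cmod_power2 by (simp add: power2_eq_square algebra_simps)
  also have "Im \<tau>0 / Im z * ((norm (z - \<tau>0))\<^sup>2 + 4 * Im \<tau>0 * Im z) = Im \<tau>0 / Im z * (norm (z - \<tau>0))\<^sup>2 + (2 * Im \<tau>0)\<^sup>2"
    using zpos by (simp add: field_simps power2_eq_square)
  also have "2 * Im \<tau>0 = norm (\<tau>0 - cnj \<tau>0)"
    using t0 by (simp add: complex_diff_cnj norm_mult)
  finally have W2: "W\<^sup>2 = Im \<tau>0 / Im z * (norm (z - \<tau>0))\<^sup>2 + (norm (\<tau>0 - cnj \<tau>0))\<^sup>2" .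
  have "(norm (\<tau>0 - cnj \<tau>0))\<^sup>2 \<le> W\<^sup>2" unfolding W2 using t0 zpos by simp
  then show "norm (\<tau>0 - cnj \<tau>0) \<le> norm (num_factor A \<tau>0 - cnj \<tau>0 * aut_factor A \<tau>0)"
    by (simp add: W_def abs_le_square_iff flip: power2_le_iff_abs_le)
  assume "norm (\<tau>0 - cnj \<tau>0) = norm (num_factor A \<tau>0 - cnj \<tau>0 * aut_factor A \<tau>0)"
  then have "Im \<tau>0 / Im z * (norm (z - \<tau>0))\<^sup>2 = 0" using W2 by (simp add: W_def)
  then show "moebius_action A \<tau>0 = \<tau>0" using t0 zpos by (simp add: z_def)
qed

text \<open>High powers of one kernel serve two purposes: the decay exponent 12 n exceeds M, and at
  \<open>\<tau>0\<close> the terms of the stabiliser dominate.\<close>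

lemma ex_orbit_decay_kernel:
  fixes D u :: "complex \<Rightarrow> complex"
  assumes D: "D holomorphic_on upper_half_plane" "\<And>\<tau>. \<tau> \<in> upper_half_plane \<Longrightarrow> D \<tau> \<noteq> 0"
    "\<And>A \<tau>. A \<in> SL2Z \<Longrightarrow> \<tau> \<in> upper_half_plane \<Longrightarrow> D (moebius_action A \<tau>) = aut_factor A \<tau> ^ 12 * D \<tau>"
    and u: "u holomorphic_on ball 0 1" "\<And>q. q \<in> ball 0 1 \<Longrightarrow> u q \<noteq> 0" "\<And>\<tau>. D \<tau> = nome \<tau> * u (nome \<tau>)"
    and \<tau>0: "\<tau>0 \<in> upper_half_plane" and M: "M \<ge> 8"
  obtains h E N \<phi> where "orbit_decay M h" "modular_function N \<phi> E"
    "\<And>\<tau>. \<tau> \<in> upper_half_plane \<Longrightarrow> ((\<lambda>A. h (moebius_action A \<tau>)) has_sum E \<tau>) SL2Z" "E \<tau>0 \<noteq> 0"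
proof -
  have t0: "Im \<tau>0 > 0" using \<tau>0 by (simp add: upper_half_plane_def)
  \<comment> \<open>The exponent 12 matches the weight of D: in h1(A\<tau>) the factors (c\<tau> +
    d)^12 cancel and leave 1/(D(\<tau>) W^12), with W linear in the entries of A.\<close>
  define h1 where "h1 = (\<lambda>z. 1 / (D z * (z - cnj \<tau>0) ^ 12))"
  define W where "W = (\<lambda>A \<tau>. num_factor A \<tau> - cnj \<tau>0 * aut_factor A \<tau>)"
  have zc: "z - cnj \<tau>0 \<noteq> 0" if "z \<in> upper_half_plane" for z
  proof
    assume "z - cnj \<tau>0 = 0"
    then have "Im (z - cnj \<tau>0) = 0" by simp
    then show False using that t0 by (simp add: upper_half_plane_def)
  qed
  have h1_hol: "h1 holomorphic_on upper_half_plane"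
    unfolding h1_def by (intro holomorphic_intros D(1)) (use D(2) zc in auto)
  have h1_nz: "h1 z \<noteq> 0" if "z \<in> upper_half_plane" for z using D(2) zc that by (simp add: h1_def)
  have h1A: "h1 (moebius_action A \<tau>) = 1 / (D \<tau> * W A \<tau> ^ 12)" if "A \<in> SL2Z" "\<tau> \<in> upper_half_plane" for A \<tau>
  proof -
    have "W A \<tau> = aut_factor A \<tau> * (moebius_action A \<tau> - cnj \<tau>0)"
      using aut_factor_nonzero[OF that] by (simp add: W_def moebius_action_eq right_diff_distrib)
    then show ?thesis by (simp add: h1_def D(3)[OF that] power_mult_distrib mult_ac)
  qed
  have bound: "norm (h1 (moebius_action A \<tau>)) \<le> C ^ 12 / norm (D \<tau>) * (1 / mnorm A ^ 12)"
    if "A \<in> SL2Z" "\<tau> \<in> cone_region y R" "y > 0" "C = (1 / y + 1 + R) * (1 + (1 + norm \<tau>0) / Im \<tau>0)" for A \<tau> y R C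
  proof -
    have t: "\<tau> \<in> upper_half_plane" using that by (auto simp: cone_region_def upper_half_plane_def)
    have le: "mnorm A \<le> C * norm (W A \<tau>)"
      unfolding W_def that(4) by (rule conj_factor_bound[OF \<tau>0 that(3,2,1)])
    have m: "mnorm A > 0" using mnorm_ge_1[OF that(1)] by simp
    have "mnorm A ^ 12 \<le> (C * norm (W A \<tau>)) ^ 12" using le m by (intro power_mono) auto
    moreover have "norm (W A \<tau>) > 0" using le m by (cases "W A \<tau> = 0") auto
    ultimately show ?thesis using m D(2)[OF t]
      by (simp add: h1A[OF that(1) t] norm_divide norm_mult norm_power power_mult_distrib field_simps)
  qed
  have decay: "orbit_decay m (\<lambda>z. h1 z ^ n)" if n: "m \<le> 12 * n" for n m
  proof (rule orbit_decayI)
    show "(\<lambda>z. h1 z ^ n) holomorphic_on upper_half_plane" by (intro holomorphic_intros h1_hol)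
    fix K assume K: "compact K" "K \<subseteq> upper_half_plane"
    obtain y R where yR: "y > 0" "R > 0" "K \<subseteq> cone_region y R" using compact_subset_cone_region[OF K] by metis
    define C where "C = (1 / y + 1 + R) * (1 + (1 + norm \<tau>0) / Im \<tau>0)"
    have "C > 0" unfolding C_def using yR t0 by (intro mult_pos_pos add_pos_nonneg) auto
    have "continuous_on K (\<lambda>\<tau>. 1 / D \<tau>)"
      using K D(2) by (intro continuous_intros holomorphic_on_imp_continuous_on holomorphic_on_subset[OF D(1)]) auto
    then obtain B where B: "B > 0" "\<And>\<tau>. \<tau> \<in> K \<Longrightarrow> norm (1 / D \<tau>) \<le> B"
      using continuous_on_compact_norm_bound[OF K(1)] by metis
    have "norm (h1 (moebius_action A \<tau>) ^ n) * mnorm A ^ m \<le> (C ^ 12 * B) ^ n" if "\<tau> \<in> K" "A \<in> SL2Z" for \<tau> A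
    proof -
      have mA: "mnorm A \<ge> 1" using mnorm_ge_1[OF that(2)] .
      have "norm (h1 (moebius_action A \<tau>)) \<le> C ^ 12 / norm (D \<tau>) * (1 / mnorm A ^ 12)"
        using that yR C_def by (intro bound) auto
      also have "C ^ 12 / norm (D \<tau>) \<le> C ^ 12 * B"
        using mult_left_mono[OF B(2)[OF that(1)], of "C ^ 12"] \<open>C > 0\<close> by (simp add: norm_divide)
      finally have "norm (h1 (moebius_action A \<tau>)) \<le> C ^ 12 * B * (1 / mnorm A ^ 12)"
        using mA by (simp add: mult_right_mono divide_right_mono)
      then have "norm (h1 (moebius_action A \<tau>)) * mnorm A ^ 12 \<le> C ^ 12 * B" using mA by (simp add: field_simps)
      then have "(norm (h1 (moebius_action A \<tau>)) * mnorm A ^ 12) ^ n \<le> (C ^ 12 * B) ^ n"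
        using mA by (intro power_mono) auto
      then have "norm (h1 (moebius_action A \<tau>) ^ n) * mnorm A ^ (12 * n) \<le> (C ^ 12 * B) ^ n"
        by (simp add: power_mult_distrib norm_power power_mult)
      moreover have "norm (h1 (moebius_action A \<tau>) ^ n) * mnorm A ^ m \<le> norm (h1 (moebius_action A \<tau>) ^ n) * mnorm A ^ (12 * n)"
        using mA n by (intro mult_left_mono power_increasing) auto
      ultimately show ?thesis by linarith
    qed
    then show "\<exists>C. \<forall>\<tau>\<in>K. \<forall>A\<in>SL2Z. norm (h1 (moebius_action A \<tau>) ^ n) * mnorm A ^ m \<le> C" by blast
  qed
  define E where "E = (\<lambda>n \<tau>. infsum (\<lambda>A. h1 (moebius_action A \<tau>) ^ n) SL2Z)"
  have sums: "E n holomorphic_on upper_half_plane"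
    "\<And>\<tau>. \<tau> \<in> upper_half_plane \<Longrightarrow> (\<lambda>A. norm (h1 (moebius_action A \<tau>) ^ n)) summable_on SL2Z"
    "\<And>\<tau>. \<tau> \<in> upper_half_plane \<Longrightarrow> ((\<lambda>A. h1 (moebius_action A \<tau>) ^ n) has_sum E n \<tau>) SL2Z"
    "\<And>A \<tau>. A \<in> SL2Z \<Longrightarrow> \<tau> \<in> upper_half_plane \<Longrightarrow> E n (moebius_action A \<tau>) = E n \<tau>"
    if "8 \<le> 12 * n" for n
    unfolding E_def by (rule orbit_decay_infsum[OF decay[OF that]]; assumption)+
  have per: "E n (\<tau> + 1) = E n \<tau>" if "8 \<le> 12 * n" "\<tau> \<in> upper_half_plane" for n \<tau>
    using sums(4)[OF that(1) matT_SL2Z that(2)] by (simp add: moebius_action_matT)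
  \<comment> \<open>Near the cusp only 1/D(\<tau>)^n grows, like q^(-n), and the rest of the sum is
    bounded uniformly; so the pole has order at most n.\<close>
  have mod: "\<exists>\<psi>. modular_function n \<psi> (E n)" if n: "n \<ge> 1" for n
  proof -
    \<comment> \<open>The constant for \<open>cone_region 1 2\<close>: if Im \<tau> \<ge> 1 and |Re
      \<tau>| \<le> 1/2, then |\<tau>| \<le> 2 Im \<tau>.\<close>
    define C where "C = (1 / 1 + 1 + 2) * (1 + (1 + norm \<tau>0) / Im \<tau>0)"
    define S where "S = infsum (\<lambda>A. 1 / mnorm A ^ 8) SL2Z"
    have C0: "C > 0" unfolding C_def using t0 by (intro mult_pos_pos add_pos_nonneg) auto
    have n8: "8 \<le> 12 * n" using n by simp
    have sub: "cball 0 (exp (- 2 * pi)) \<subseteq> ball (0::complex) 1"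
      by (rule cball_subset_ball_iff[THEN iffD2]) simp
    have "continuous_on (cball 0 (exp (- 2 * pi))) (\<lambda>q. 1 / u q)"
      by (intro continuous_intros holomorphic_on_imp_continuous_on holomorphic_on_subset[OF u(1)] sub ballI u(2)) (use sub in blast)
    then obtain B where B: "B > 0" "\<And>q. q \<in> cball 0 (exp (- 2 * pi)) \<Longrightarrow> norm (1 / u q) \<le> B"
      using continuous_on_compact_norm_bound[OF compact_cball] by metis
    define f where "f = (\<lambda>\<tau>. E n \<tau> * nome \<tau> ^ n)"
    have f_hol: "f holomorphic_on upper_half_plane"
      unfolding f_def by (intro holomorphic_intros sums(1)[OF n8] holomorphic_on_nome)
    have f_per: "f (\<tau> + 1) = f \<tau>" if "\<tau> \<in> upper_half_plane" for \<tau>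
      by (simp add: f_def per[OF n8 that] nome_plus_1)
    have f_bd0: "norm (f \<tau>) \<le> (C ^ 12 * B) ^ n * S" if \<tau>: "Im \<tau> \<ge> 1" "\<bar>Re \<tau>\<bar> \<le> 1/2" for \<tau>
    proof -
      have th: "\<tau> \<in> upper_half_plane" using \<tau> by (simp add: upper_half_plane_def)
      have "norm \<tau> \<le> \<bar>Re \<tau>\<bar> + \<bar>Im \<tau>\<bar>" by (rule cmod_le)
      then have tc: "\<tau> \<in> cone_region 1 2" using \<tau> by (simp add: cone_region_def)
      have le: "norm (h1 (moebius_action A \<tau>) ^ n) \<le> (C ^ 12 / norm (D \<tau>)) ^ n * (1 / mnorm A ^ 8)" if A: "A \<in> SL2Z" for A
      proof -
        have m: "mnorm A \<ge> 1" using mnorm_ge_1[OF A] .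
        have "norm (h1 (moebius_action A \<tau>)) ^ n \<le> (C ^ 12 / norm (D \<tau>) * (1 / mnorm A ^ 12)) ^ n"
          by (intro power_mono bound[OF A tc] C_def) auto
        also have "\<dots> = (C ^ 12 / norm (D \<tau>)) ^ n * (1 / mnorm A ^ (12 * n))"
          by (simp only: power_mult_distrib power_one_over power_mult)
        also have "\<dots> \<le> (C ^ 12 / norm (D \<tau>)) ^ n * (1 / mnorm A ^ 8)"
          using m n8 C0 by (intro mult_left_mono divide_left_mono power_increasing mult_pos_pos zero_less_power) auto
        finally show ?thesis by (simp add: norm_power)
      qed
      have "norm (E n \<tau>) \<le> (C ^ 12 / norm (D \<tau>)) ^ n * S"
        by (rule norm_infsum_le[OF sums(3)[OF n8 th] has_sum_cmult_right[OF has_sum_infsum[OF summable_on_mnorm], folded S_def] le])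
      then have "norm (f \<tau>) \<le> (C ^ 12 / norm (D \<tau>)) ^ n * S * norm (nome \<tau>) ^ n"
        unfolding f_def norm_mult norm_power by (intro mult_right_mono) auto
      also have "\<dots> = (C ^ 12 * norm (1 / u (nome \<tau>))) ^ n * S"
        by (simp add: u(3) norm_mult norm_divide power_mult_distrib power_divide)
      also have "\<dots> \<le> (C ^ 12 * B) ^ n * S"
      proof (intro mult_right_mono power_mono mult_left_mono B(2))
        show "nome \<tau> \<in> cball 0 (exp (- 2 * pi))" using \<tau> by (simp add: norm_nome)
        show "S \<ge> 0" unfolding S_def by (intro infsum_nonneg) (simp add: mnorm_nonneg)
      qed (use C0 in auto)
      finally show ?thesis .
    qed
    have f_bd: "norm (f \<tau>) \<le> (C ^ 12 * B) ^ n * S" if \<tau>: "Im \<tau> \<ge> 1" for \<tau>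
    proof -
      have "f (\<tau> + of_int (- round (Re \<tau>))) = f \<tau>"
        by (rule periodic_int[of f, OF f_per]) (use \<tau> in \<open>auto simp: upper_half_plane_def\<close>)
      moreover have "norm (f (\<tau> + of_int (- round (Re \<tau>)))) \<le> (C ^ 12 * B) ^ n * S"
        using \<tau> of_int_round_abs_le[of "Re \<tau>"] by (intro f_bd0) (auto simp: abs_minus_commute)
      ultimately show ?thesis by simp
    qed
    obtain \<psi> where \<psi>: "\<psi> holomorphic_on ball 0 1" "\<And>\<tau>. \<tau> \<in> upper_half_plane \<Longrightarrow> f \<tau> = \<psi> (nome \<tau>)"
      using periodic_disc_function[OF f_hol f_per f_bd] by blast
    then have "modular_function n \<psi> (E n)"
      unfolding modular_function_def using sums(4)[OF n8] by (auto simp: f_def)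
    then show ?thesis by blast
  qed
  \<comment> \<open>Normalised so that the stabiliser of \<open>\<tau>0\<close> gives exactly 1. In
    general the ratio is the 12th power of (\<tau>0 - cnj \<tau>0)/W, of norm below 1 as soon as A
    moves \<open>\<tau>0\<close>.\<close>
  define r where "r = (\<lambda>A. h1 (moebius_action A \<tau>0) / h1 \<tau>0)"
  have sm: "(\<lambda>A. norm (r A)) summable_on SL2Z"
    using summable_on_cmult_left[OF sums(2)[OF _ \<tau>0, of 1], of "1 / norm (h1 \<tau>0)"]
    by (simp add: r_def norm_divide)
  have r1: "r (mat 1) = 1" using h1_nz[OF \<tau>0] by (simp add: r_def moebius_action_one)
  have lt: "norm (r A) < 1" if A: "A \<in> SL2Z" "r A \<noteq> 1" for A
  proof -
    have ne: "moebius_action A \<tau>0 \<noteq> \<tau>0" using A(2) h1_nz[OF \<tau>0] by (auto simp: r_def)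
    have l: "norm (\<tau>0 - cnj \<tau>0) < norm (W A \<tau>0)"
      using reproducing_ratio[OF \<tau>0 A(1)] ne unfolding W_def by force
    have "norm (W A \<tau>0) > 0" using le_less_trans[OF norm_ge_zero l] .
    then have "norm (\<tau>0 - cnj \<tau>0) / norm (W A \<tau>0) < 1" using l by simp
    moreover have "r A = ((\<tau>0 - cnj \<tau>0) / W A \<tau>0) ^ 12"
      unfolding r_def h1A[OF A(1) \<tau>0] using D(2)[OF \<tau>0] by (simp add: h1_def power_divide)
    ultimately show ?thesis
      by (simp add: norm_power norm_divide power_less_one_iff)
  qed
  obtain n0 where n0: "\<And>n. n \<ge> n0 \<Longrightarrow> infsum (\<lambda>A. r A ^ n) SL2Z \<noteq> 0"
    using infsum_power_nonzero[OF sm SL2Z_one r1 lt] by blast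
  define n where "n = max n0 M"
  have n: "n \<ge> 1" "M \<le> 12 * n" "8 \<le> 12 * n" "n \<ge> n0" using M by (auto simp: n_def)
  obtain \<psi> where \<psi>: "modular_function n \<psi> (E n)" using mod[OF n(1)] by blast
  show ?thesis
  proof (rule that[of "\<lambda>z. h1 z ^ n" n \<psi> "E n"])
    have "E n \<tau>0 = infsum (\<lambda>A. h1 \<tau>0 ^ n * r A ^ n) SL2Z"
      using h1_nz[OF \<tau>0] by (simp add: E_def r_def power_divide)
    also have "\<dots> = h1 \<tau>0 ^ n * infsum (\<lambda>A. r A ^ n) SL2Z" by (rule infsum_cmult_right')
    finally show "E n \<tau>0 \<noteq> 0" using n0[OF n(4)] h1_nz[OF \<tau>0] by simp
  qed (use decay[OF n(2)] sums(3)[OF n(3)] \<psi> in auto)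
qed

theorem ex_orbit_partition:
  assumes M: "M \<ge> 8"
  obtains h where "orbit_decay M h"
    "\<And>\<tau>. \<tau> \<in> upper_half_plane \<Longrightarrow> ((\<lambda>A. h (moebius_action A \<tau>)) has_sum 1) SL2Z"
proof -
  obtain D u j \<phi> where D: "D holomorphic_on upper_half_plane" "\<And>\<tau>. \<tau> \<in> upper_half_plane \<Longrightarrow> D \<tau> \<noteq> 0"
    and u: "u holomorphic_on ball 0 1" "\<And>q. q \<in> ball 0 1 \<Longrightarrow> u q \<noteq> 0" "\<And>\<tau>. D \<tau> = nome \<tau> * u (nome \<tau>)"
    and DA: "\<And>A \<tau>. A \<in> SL2Z \<Longrightarrow> \<tau> \<in> upper_half_plane \<Longrightarrow> D (moebius_action A \<tau>) = aut_factor A \<tau> ^ 12 * D \<tau>"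
    and j: "modular_function 1 \<phi> j" "\<phi> 0 \<noteq> 0" "j holomorphic_on upper_half_plane"
    using ex_modular_functions by metis
  have jA: "j (moebius_action A \<tau>) = j \<tau>" if "A \<in> SL2Z" "\<tau> \<in> upper_half_plane" for A \<tau>
    using j(1) that by (simp add: modular_function_def)
  \<comment> \<open>The polynomials in j that are orbit sums. They form an ideal, and an element of
    least degree will be shown to be constant.\<close>
  define V where "V = {P. \<exists>h. orbit_decay M h \<and>
     (\<forall>\<tau>\<in>upper_half_plane. ((\<lambda>A. h (moebius_action A \<tau>)) has_sum poly P (j \<tau>)) SL2Z)}"
  have V_diff: "P - Q \<in> V" if "P \<in> V" "Q \<in> V" for P Q
  proof -
    obtain h where h: "orbit_decay M h" "\<And>\<tau>. \<tau> \<in> upper_half_plane \<Longrightarrow> ((\<lambda>A. h (moebius_action A \<tau>)) has_sum poly P (j \<tau>)) SL2Z"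
      using \<open>P \<in> V\<close> by (auto simp: V_def)
    obtain h' where h': "orbit_decay M h'" "\<And>\<tau>. \<tau> \<in> upper_half_plane \<Longrightarrow> ((\<lambda>A. h' (moebius_action A \<tau>)) has_sum poly Q (j \<tau>)) SL2Z"
      using \<open>Q \<in> V\<close> by (auto simp: V_def)
    have "((\<lambda>A. h (moebius_action A \<tau>) - h' (moebius_action A \<tau>)) has_sum poly (P - Q) (j \<tau>)) SL2Z"
      if "\<tau> \<in> upper_half_plane" for \<tau>
      using has_sum_add[OF h(2)[OF that] has_sum_uminusI[OF h'(2)[OF that]]] by simp
    then show ?thesis using orbit_decay_diff[OF h(1) h'(1)] by (auto simp: V_def)
  qed
  have V_mult: "R * P \<in> V" if "P \<in> V" for P R
  proof -
    obtain h where h: "orbit_decay M h" "\<And>\<tau>. \<tau> \<in> upper_half_plane \<Longrightarrow> ((\<lambda>A. h (moebius_action A \<tau>)) has_sum poly P (j \<tau>)) SL2Z"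
      using \<open>P \<in> V\<close> by (auto simp: V_def)
    have "orbit_decay M (\<lambda>\<tau>. poly R (j \<tau>) * h \<tau>)"
      by (rule orbit_decay_mult_invariant[OF h(1)]) (auto intro!: holomorphic_intros j(3) simp: jA)
    moreover have "((\<lambda>A. poly R (j (moebius_action A \<tau>)) * h (moebius_action A \<tau>)) has_sum poly (R * P) (j \<tau>)) SL2Z"
      if t: "\<tau> \<in> upper_half_plane" for \<tau>
    proof -
      have "((\<lambda>A. poly R (j \<tau>) * h (moebius_action A \<tau>)) has_sum poly (R * P) (j \<tau>)) SL2Z"
        unfolding poly_mult by (rule has_sum_cmult_right[OF h(2)[OF t]])
      also have "?this \<longleftrightarrow> ?thesis" by (rule has_sum_cong) (simp add: jA t)
      finally show ?thesis .
    qed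
    ultimately show ?thesis by (auto simp: V_def)
  qed
  have V_nz: "\<exists>P\<in>V. poly P (j \<tau>0) \<noteq> 0" if \<tau>0: "\<tau>0 \<in> upper_half_plane" for \<tau>0
  proof -
    obtain h E N \<psi> where h: "orbit_decay M h" "modular_function N \<psi> E"
      "\<And>\<tau>. \<tau> \<in> upper_half_plane \<Longrightarrow> ((\<lambda>A. h (moebius_action A \<tau>)) has_sum E \<tau>) SL2Z" "E \<tau>0 \<noteq> 0"
      using ex_orbit_decay_kernel[OF D DA u \<tau>0 M] by metis
    obtain P where P: "\<And>\<tau>. \<tau> \<in> upper_half_plane \<Longrightarrow> E \<tau> = poly P (j \<tau>)"
      using modular_function_poly[OF j(1,2) h(2)] by blast
    have "P \<in> V" using h(1,3) P by (auto simp: V_def)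
    then show ?thesis using P[OF \<tau>0] h(4) by auto
  qed
  \<comment> \<open>If j omitted the value a, then 1/(j - a) would be holomorphic everywhere and
    zero at the cusp, hence constantly 0.\<close>
  have j_surj: "\<exists>\<tau>\<in>upper_half_plane. j \<tau> = a" for a
  proof (rule ccontr)
    assume "\<not> (\<exists>\<tau>\<in>upper_half_plane. j \<tau> = a)"
    then have ne: "j \<tau> - a \<noteq> 0" if "\<tau> \<in> upper_half_plane" for \<tau> using that by auto
    have hol: "\<phi> holomorphic_on ball 0 1" and jq: "\<And>\<tau>. \<tau> \<in> upper_half_plane \<Longrightarrow> \<phi> (nome \<tau>) = j \<tau> * nome \<tau>"
      using j(1) by (auto simp: modular_function_def)
    define \<psi> where "\<psi> = (\<lambda>q. q / (\<phi> q - a * q))"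
    have nz: "\<phi> q - a * q \<noteq> 0" if q: "q \<in> ball 0 1" for q
    proof (cases "q = 0")
      case False
      then obtain \<tau> where \<tau>: "\<tau> \<in> upper_half_plane" "nome \<tau> = q" using nome_surj[of q] q by auto
      have "\<phi> q - a * q = (j \<tau> - a) * q" using jq[OF \<tau>(1)] \<tau>(2) by (simp add: algebra_simps)
      then show ?thesis using ne[OF \<tau>(1)] False by simp
    qed (use j(2) in simp)
    have "modular_function 0 \<psi> (\<lambda>\<tau>. 1 / (j \<tau> - a))"
      unfolding modular_function_def
    proof (intro conjI ballI)
      show "\<psi> holomorphic_on ball 0 1" unfolding \<psi>_def by (intro holomorphic_intros hol) (use nz in auto)
      fix \<tau> assume \<tau>: "\<tau> \<in> upper_half_plane"
      have "\<phi> (nome \<tau>) - a * nome \<tau> = nome \<tau> * (j \<tau> - a)" using jq[OF \<tau>] by (simp add: algebra_simps)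
      then show "1 / (j \<tau> - a) * nome \<tau> ^ 0 = \<psi> (nome \<tau>)" by (simp add: \<psi>_def)
      show "1 / (j (moebius_action A \<tau>) - a) = 1 / (j \<tau> - a)" if "A \<in> SL2Z" for A
        using jA[OF that \<tau>] by simp
    qed
    from modular_function_0_constant[OF this nome_in_ball[of \<i>]] have "\<psi> (nome \<i>) = 0"
      by (simp add: \<psi>_def upper_half_plane_def)
    moreover have "\<psi> (nome \<i>) \<noteq> 0" using nz[OF nome_in_ball[of \<i>]] by (simp add: \<psi>_def upper_half_plane_def)
    ultimately show False by simp
  qed
  have "\<exists>P. P \<in> V \<and> P \<noteq> 0" using V_nz[of \<i>] by (force simp: upper_half_plane_def)
  then obtain P where P: "P \<in> V" "P \<noteq> 0" and Pmin: "\<And>Q. Q \<in> V \<Longrightarrow> Q \<noteq> 0 \<Longrightarrow> degree P \<le> degree Q"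
    using ex_has_least_nat[of "\<lambda>P. P \<in> V \<and> P \<noteq> 0" _ degree] by metis
  have "degree P = 0"
  proof (rule ccontr)
    assume "degree P \<noteq> 0"
    then obtain a where a: "poly P a = 0" using Fundamental_Theorem_Algebra.fundamental_theorem_of_algebra[of P] by (auto simp: constant_degree)
    obtain \<tau>0 where \<tau>0: "\<tau>0 \<in> upper_half_plane" "j \<tau>0 = a" using j_surj by blast
    obtain Q where Q: "Q \<in> V" "poly Q a \<noteq> 0" using V_nz[OF \<tau>0(1)] \<tau>0(2) by auto
    \<comment> \<open>P vanishes at a, so the remainder keeps the value of Q there: it is a nonzero
      element of V of smaller degree.\<close>
    have "Q mod P = Q - (Q div P) * P" by (simp add: minus_div_mult_eq_mod)
    then have "Q mod P \<in> V" using V_diff[OF Q(1) V_mult[OF P(1)]] by simp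
    moreover have "poly (Q mod P) a = poly Q a"
      using a by (simp add: \<open>Q mod P = Q - (Q div P) * P\<close>)
    then have "Q mod P \<noteq> 0" using Q(2) by auto
    moreover from this have "degree (Q mod P) < degree P" using degree_mod_less'[OF P(2)] by blast
    ultimately show False using Pmin by fastforce
  qed
  then obtain c where c: "P = [:c:]" using degree_eq_zeroE by blast
  then have "[:1 / c:] * P = 1" using P(2) by (simp add: one_pCons)
  then have "1 \<in> V" using V_mult[OF P(1), of "[:1 / c:]"] by simp
  then show ?thesis using that by (auto simp: V_def)
qed

subsection \<open>Words in finitely generated subgroups of the modular group\<close>

text \<open>Both endpoints of the edge are 0 or infinity, so the edge is the imaginary axis and A
  belongs to its stabiliser.\<close>

lemma S_group_I:
  assumes "A \<in> SL2Z" "A$1$1 * A$2$1 = 0" "A$1$2 * A$2$2 = 0"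
  shows "A \<in> S_group"
proof -
  obtain a b c d :: int where A: "A = mat2 (of_int a) (of_int b) (of_int c) (of_int d)" "a * d - b * c = 1"
    using assms(1) by (rule SL2Z_cases)
  have z: "a = 0 \<or> c = 0" "b = 0 \<or> d = 0" using assms(2,3) by (auto simp: A)
  consider "a = 0" "d = 0" "b * - c = 1" | "b = 0" "c = 0" "a * d = 1" using z A(2) by auto
  then show ?thesis
  proof cases
    case 1
    then have "(b = 1 \<and> c = -1) \<or> (b = -1 \<and> c = 1)" using zmult_eq_1_iff[of b "- c"] by auto
    then show ?thesis unfolding S_group_def A(1) using 1 by (auto simp: mat2_simps matS_def)
  next
    case 2
    then have "(a = 1 \<and> d = 1) \<or> (a = -1 \<and> d = -1)" using zmult_eq_1_iff[of a d] by auto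
    then show ?thesis unfolding S_group_def A(1) using 2 by (auto simp: mat2_simps matS_def)
  qed
qed

definition SL2Z_steps :: "(real^2^2) set" where
  "SL2Z_steps = {matT, adj2 matT, matS, adj2 matS}"

lemma SL2Z_steps_SL2Z: "t \<in> SL2Z_steps \<Longrightarrow> t \<in> SL2Z"
  by (auto simp: SL2Z_steps_def SL2Z_adj2 matS_SL2Z matT_SL2Z)

lemma adj2_SL2Z_steps: "t \<in> SL2Z_steps \<Longrightarrow> adj2 t \<in> SL2Z_steps"
  by (auto simp: SL2Z_steps_def)

text \<open>An edge and its translate by a step are sides of a common Farey triangle, so a step can enter
  a half-plane only through its boundary geodesic.\<close>

lemma half_plane_mat_step:
  assumes "A \<in> SL2Z" "\<not> half_plane_mat A" "half_plane_mat (A ** t)" "t \<in> SL2Z_steps"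
  shows "A ** t \<in> S_group"
proof -
  obtain a b c d :: int where A: "A = mat2 (of_int a) (of_int b) (of_int c) (of_int d)" "a * d - b * c = 1"
    using assms(1) by (rule SL2Z_cases)
  have nh: "a * c < 0 \<or> b * d < 0"
    using assms(2) by (auto simp: half_plane_mat_def A not_le simp flip: of_int_mult)
  have "real_of_int ((a * c) * (b * d)) \<ge> 0" using SL2Z_column_signs[OF assms(1)] by (simp add: A)
  then have cs: "(a * c) * (b * d) \<ge> 0" by (simp only: of_int_0_le_iff)
  have At: "A ** t \<in> SL2Z" by (rule SL2Z_mult[OF assms(1) SL2Z_steps_SL2Z[OF assms(4)]])
  consider "t = matT" | "t = adj2 matT" | "t = matS \<or> t = adj2 matS" using assms(4) by (auto simp: SL2Z_steps_def)
  then show ?thesis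
  proof cases
    case 1
    have At2: "A ** t = mat2 (of_int a) (of_int (a + b)) (of_int c) (of_int (c + d))"
      by (simp add: 1 A(1) matT_def mat2_simps)
    have h: "a * c \<ge> 0" "(a + b) * (c + d) \<ge> 0"
      using assms(3) unfolding At2 half_plane_mat_def mat2_nth
      by (simp_all only: of_int_mult[symmetric] of_int_0_le_iff)
    then have bd: "b * d < 0" using nh by simp
    \<comment> \<open>The products ac and bd never have strictly opposite signs, so bd < 0 leaves ac
      = 0: one endpoint already lies on the boundary geodesic.\<close>
    then have ac: "a * c = 0" using cs h(1) by (metis mult_pos_neg not_less order_antisym_conv)
    have "(a + b) * (c + d) = 1 + 2 * (b * c) + b * d" using A(2) ac by (simp add: algebra_simps)
    moreover have "b * c = 0 \<or> a = 0" using ac by auto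
    ultimately have "(a + b) * (c + d) = 0"
    proof (cases "a = 0")
      case True
      then have "b * c = -1" using A(2) by simp
      then show ?thesis using h(2) bd \<open>(a + b) * (c + d) = 1 + 2 * (b * c) + b * d\<close> by linarith
    next
      case False
      then have "b * c = 0" using \<open>b * c = 0 \<or> a = 0\<close> by simp
      then show ?thesis using h(2) bd \<open>(a + b) * (c + d) = 1 + 2 * (b * c) + b * d\<close> by linarith
    qed
    then show ?thesis
      using ac by (intro S_group_I[OF At]) (simp_all only: At2 mat2_nth of_int_mult[symmetric] of_int_eq_0_iff)
  next
    case 2
    have At2: "A ** t = mat2 (of_int a) (of_int (b - a)) (of_int c) (of_int (d - c))"
      by (simp add: 2 A(1) matT_def mat2_simps adj2_def)
    have h: "a * c \<ge> 0" "(b - a) * (d - c) \<ge> 0"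
      using assms(3) unfolding At2 half_plane_mat_def mat2_nth
      by (simp_all only: of_int_mult[symmetric] of_int_0_le_iff)
    then have bd: "b * d < 0" using nh by simp
    then have ac: "a * c = 0" using cs h(1) by (metis mult_pos_neg not_less order_antisym_conv)
    have e: "(b - a) * (d - c) = b * d - 1 - 2 * (b * c)" using A(2) ac by (simp add: algebra_simps)
    have "b * c = 0 \<or> b * c = -1" using ac A(2) by auto
    then have "(b - a) * (d - c) = 0" using h(2) bd e by linarith
    then show ?thesis
      using ac by (intro S_group_I[OF At]) (simp_all only: At2 mat2_nth of_int_mult[symmetric] of_int_eq_0_iff)
  next
    case 3
    then have "half_plane_mat (A ** t) \<longleftrightarrow> half_plane_mat A"
      by (auto simp: half_plane_mat_def matrix_mult_nth2 matS_def adj2_def)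
    then show ?thesis using assms by simp
  qed
qed

text \<open>Edges of the Cayley graph with both ends in Y. Steps multiply on the right, so left
  translations map paths to paths.\<close>

definition step_in :: "(real^2^2) set \<Rightarrow> real^2^2 \<Rightarrow> real^2^2 \<Rightarrow> bool" where
  "step_in Y x y \<longleftrightarrow> x \<in> Y \<and> y \<in> Y \<and> (\<exists>t\<in>SL2Z_steps. y = x ** t)"

lemma step_in_mono: "(step_in X)\<^sup>*\<^sup>* x y \<Longrightarrow> X \<subseteq> Y \<Longrightarrow> (step_in Y)\<^sup>*\<^sup>* x y"
  by (erule rtranclp_mono[THEN predicate2D, rotated]) (auto simp: step_in_def)

lemma step_in_translate:
  "(step_in X)\<^sup>*\<^sup>* x y \<Longrightarrow> (step_in ((**) A ` X))\<^sup>*\<^sup>* (A ** x) (A ** y)"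
proof (induction rule: rtranclp_induct)
  case (step y z)
  then have "step_in ((**) A ` X) (A ** y) (A ** z)"
    by (auto simp: step_in_def matrix_mul_assoc)
  with step.IH show ?case by (rule rtranclp.rtrancl_into_rtrancl)
qed simp

lemma step_in_sym:
  assumes "(step_in X)\<^sup>*\<^sup>* x y"
  shows "(step_in X)\<^sup>*\<^sup>* y x"
  using assms
proof (induction rule: rtranclp_induct)
  case (step y z)
  have "step_in X z y" if yz: "step_in X y z"
  proof -
    obtain t where t: "t \<in> SL2Z_steps" "z = y ** t" using yz by (auto simp: step_in_def)
    then have "y = z ** adj2 t" by (simp add: adj2_mult_cancel SL2Z_steps_SL2Z)
    then show ?thesis using yz adj2_SL2Z_steps[OF t(1)] by (auto simp: step_in_def)
  qed
  with step show ?case by (meson converse_rtranclp_into_rtranclp)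
qed simp

lemma SL2Z_finite_path:
  assumes "A \<in> SL2Z"
  shows "\<exists>R. finite R \<and> R \<subseteq> SL2Z \<and> mat 1 \<in> R \<and> (step_in R)\<^sup>*\<^sup>* (mat 1) A"
proof -
  define P where "P = (\<lambda>A. \<exists>R. finite R \<and> R \<subseteq> SL2Z \<and> mat 1 \<in> R \<and> A \<in> R \<and> (step_in R)\<^sup>*\<^sup>* (mat 1) A)"
  have st: "P (B ** t)" if B: "B \<in> SL2Z" "P B" and t: "t \<in> SL2Z_steps" for B t
  proof -
    obtain R where R: "finite R" "R \<subseteq> SL2Z" "mat 1 \<in> R" "B \<in> R" "(step_in R)\<^sup>*\<^sup>* (mat 1) B"
      using B(2) by (auto simp: P_def)
    define R' where "R' = insert (B ** t) R"
    have "(step_in R')\<^sup>*\<^sup>* (mat 1) B" by (rule step_in_mono[OF R(5)]) (auto simp: R'_def)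
    moreover have "step_in R' B (B ** t)" using R(4) t by (auto simp: step_in_def R'_def)
    ultimately have "(step_in R')\<^sup>*\<^sup>* (mat 1) (B ** t)" by (rule rtranclp.rtrancl_into_rtrancl)
    then show ?thesis unfolding P_def
      using R SL2Z_mult[OF B(1) SL2Z_steps_SL2Z[OF t]] by (intro exI[of _ R']) (auto simp: R'_def)
  qed
  have "P A" using assms
  proof (induction rule: SL2Z_induct)
    case one
    show ?case unfolding P_def by (intro exI[of _ "{mat 1}"]) (auto simp: SL2Z_one)
  qed (auto intro!: st simp: SL2Z_steps_def)
  then show ?thesis by (auto simp: P_def)
qed

text \<open>Some step of the path enters the half-plane bounded by the edge of X, and by
  \<open>half_plane_mat_step\<close> the edge reached by this step is the boundary geodesic
  itself.\<close>

lemma step_in_crosses: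
  assumes "(step_in Y)\<^sup>*\<^sup>* x y" "Y \<subseteq> SL2Z" "X \<in> SL2Z"
    "\<not> half_plane_mat (adj2 X ** x)" "half_plane_mat (adj2 X ** y)"
  shows "\<exists>z\<in>Y. adj2 X ** z \<in> S_group"
  using assms(1,5)
proof (induction rule: rtranclp_induct)
  case base
  then show ?case using assms(4) by simp
next
  case (step y z)
  show ?case
  proof (cases "half_plane_mat (adj2 X ** y)")
    case False
    obtain t where t: "t \<in> SL2Z_steps" "z = y ** t" "y \<in> Y" "z \<in> Y" using step.hyps(2) by (auto simp: step_in_def)
    have "adj2 X ** y \<in> SL2Z" using t(3) assms(2,3) by (auto intro!: SL2Z_mult SL2Z_adj2)
    from half_plane_mat_step[OF this False _ t(1)] have "adj2 X ** z \<in> S_group"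
      using step.prems by (simp add: t(2) matrix_mul_assoc)
    then show ?thesis using t(4) by blast
  qed (use step.IH in simp)
qed

text \<open>Each generator is joined to 1 by a finite path. A product h1 h2 is reached by a path to
  h1 followed by the translate by h1 of a path to h2, and \<Gamma>R, being stable under left
  multiplication by \<Gamma>, contains both.\<close>

lemma generate_path:
  assumes fin: "finite S" and \<Gamma>: "\<Gamma> = generate SL2R S" and sub: "\<Gamma> \<subseteq> SL2Z"
    and cl: "mat 1 \<in> \<Gamma>" "\<And>A B. A \<in> \<Gamma> \<Longrightarrow> B \<in> \<Gamma> \<Longrightarrow> A ** B \<in> \<Gamma>"
  obtains R where "finite R" "R \<subseteq> SL2Z" "mat 1 \<in> R"
    "\<And>A. A \<in> \<Gamma> \<Longrightarrow> (step_in {A ** r |A r. A \<in> \<Gamma> \<and> r \<in> R})\<^sup>*\<^sup>* (mat 1) A"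
proof -
  have S: "S \<subseteq> \<Gamma>" unfolding \<Gamma> by (auto intro: generate.incl)
  have "\<forall>s\<in>S. \<exists>R. finite R \<and> R \<subseteq> SL2Z \<and> mat 1 \<in> R \<and> (step_in R)\<^sup>*\<^sup>* (mat 1) s"
    using SL2Z_finite_path S sub by blast
  then obtain Rs where Rs: "\<And>s. s \<in> S \<Longrightarrow> finite (Rs s) \<and> Rs s \<subseteq> SL2Z \<and> mat 1 \<in> Rs s \<and> (step_in (Rs s))\<^sup>*\<^sup>* (mat 1) s"
    by metis
  define R where "R = insert (mat 1) (\<Union>s\<in>S. Rs s)"
  define Y where "Y = {A ** r |A r. A \<in> \<Gamma> \<and> r \<in> R}"
  have YR: "(**) A ` Rs s \<subseteq> Y" if "A \<in> \<Gamma>" "s \<in> S" for A s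
    using that by (auto simp: Y_def R_def)
  have Y\<Gamma>: "(**) A ` Y \<subseteq> Y" if "A \<in> \<Gamma>" for A
  proof safe
    fix y assume "y \<in> Y"
    then obtain B r where "y = B ** r" "B \<in> \<Gamma>" "r \<in> R" by (auto simp: Y_def)
    then show "A ** y \<in> Y" unfolding Y_def using cl(2)[OF that, of B] by (auto simp: matrix_mul_assoc)
  qed
  have s_path: "(step_in Y)\<^sup>*\<^sup>* A (A ** s)" if "A \<in> \<Gamma>" "s \<in> S" for A s
    using step_in_mono[OF step_in_translate[of "Rs s" "mat 1" s A] YR[OF that]] Rs[OF that(2)] by simp
  have path: "(step_in Y)\<^sup>*\<^sup>* (mat 1) A" if "A \<in> \<Gamma>" for A
    using that unfolding \<Gamma>
  proof (induction rule: generate.induct)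
    case one
    then show ?case by (simp add: SL2R_def)
  next
    case (incl h)
    then show ?case using s_path[OF cl(1), of h] by simp
  next
    case (inv h)
    have h: "h \<in> SL2Z" "h \<in> \<Gamma>" using inv S sub by auto
    have inv\<Gamma>: "adj2 h \<in> \<Gamma>" using generate.inv[OF inv, of SL2R] inv_SL2R_eq_adj2[OF h(1)] by (simp add: \<Gamma>)
    have "(step_in Y)\<^sup>*\<^sup>* (adj2 h) (mat 1)" using s_path[OF inv\<Gamma> inv] by (simp add: adj2_mult_left h)
    then show ?case using step_in_sym inv_SL2R_eq_adj2[OF h(1)] by simp
  next
    case (eng h1 h2)
    have "h1 \<in> \<Gamma>" using eng by (simp add: \<Gamma>)
    from step_in_mono[OF step_in_translate[OF eng.IH(2), of h1] Y\<Gamma>[OF this]]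
    have "(step_in Y)\<^sup>*\<^sup>* h1 (h1 ** h2)" by simp
    with eng.IH(1) show ?case by (simp add: SL2R_def)
  qed
  show ?thesis
  proof (rule that[of R])
    show "finite R" using fin Rs by (auto simp: R_def)
    show "R \<subseteq> SL2Z" using Rs SL2Z_one unfolding R_def by blast
    show "mat 1 \<in> R" by (simp add: R_def)
  qed (use path in \<open>auto simp: Y_def\<close>)
qed

text \<open>The degenerate start of a path: if the base edge already lies in the closed half-plane
  of a nonnegative x, the signs of the entries force it onto the boundary.\<close>

lemma S_group_of_nonneg_adj2:
  assumes "x \<in> SL2Z" "nonneg_mat x" "\<sigma> \<in> S_group" "half_plane_mat (adj2 x ** \<sigma>)"
  shows "adj2 x ** \<sigma> \<in> S_group"
proof (rule S_group_I)
  have p: "x$1$1 * x$2$1 \<ge> 0" "x$2$2 * x$2$1 \<ge> 0" "x$1$2 * x$1$1 \<ge> 0"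
    using assms(2) by (simp_all add: nonneg_mat_def)
  show "adj2 x ** \<sigma> \<in> SL2Z" by (rule SL2Z_mult[OF SL2Z_adj2[OF assms(1)] S_group_SL2Z[OF assms(3)]])
  show "(adj2 x ** \<sigma>)$1$1 * (adj2 x ** \<sigma>)$2$1 = 0" "(adj2 x ** \<sigma>)$1$2 * (adj2 x ** \<sigma>)$2$2 = 0"
    using assms(3,4) p
    by (auto simp: S_group_def half_plane_mat_def matrix_mult_nth2 mat_1_nth2 matS_def adj2_def)
qed

lemma half_plane_mat_nonneg_mult:
  assumes "nonneg_mat q" "\<sigma> \<in> S_group"
  shows "half_plane_mat (q ** \<sigma>)"
  using assms by (auto simp: S_group_def half_plane_mat_def nonneg_mat_def matrix_mult_nth2 mat_1_nth2 matS_def)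

lemma finite_uniform_exponent:
  fixes P :: "'a \<Rightarrow> nat \<Rightarrow> bool"
  assumes "finite B" "\<And>s. s \<in> B \<Longrightarrow> \<exists>M. P s M" "\<And>s m n. P s m \<Longrightarrow> m \<le> n \<Longrightarrow> P s n"
  shows "\<exists>M. \<forall>s\<in>B. P s M"
proof -
  obtain f where f: "\<And>s. s \<in> B \<Longrightarrow> P s (f s)" using assms(2) by metis
  have "P s (Max (f ` B))" if "s \<in> B" for s
    using assms(3)[OF f[OF that]] assms(1) that by (meson Max_ge finite_imageI imageI)
  then show ?thesis by blast
qed

text \<open>In \<open>step\<close> the exponent may depend on s but not on K. Along the prefixes of
  the Euclidean factorisation only finitely many s occur, so one exponent serves for all; adding up
  the increments costs one further power, since the norm rises by at least 1 with each
  letter.\<close>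

lemma polynomial_growth_of_generated:
  fixes F :: "real^2^2 \<Rightarrow> complex \<Rightarrow> real"
  assumes fin: "finite S" and \<Gamma>: "\<Gamma> = generate SL2R S" and sub: "\<Gamma> \<subseteq> SL2Z"
    and cl: "mat 1 \<in> \<Gamma>" "\<And>A B. A \<in> \<Gamma> \<Longrightarrow> B \<in> \<Gamma> \<Longrightarrow> A ** B \<in> \<Gamma>" "\<And>A. A \<in> \<Gamma> \<Longrightarrow> adj2 A \<in> \<Gamma>"
    and bd: "\<And>A K. A \<in> \<Gamma> \<Longrightarrow> K \<in> \<K> \<Longrightarrow> \<exists>C. \<forall>\<tau>\<in>K. F A \<tau> \<le> C"
    and step: "\<And>s. s \<in> \<Gamma> \<Longrightarrow> \<exists>M. \<forall>K\<in>\<K>. \<exists>C. \<forall>A\<in>\<Gamma>. \<forall>\<tau>\<in>K. F (A ** s) \<tau> \<le> F A \<tau> + C * mnorm A ^ M"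
  shows "\<exists>M. \<forall>K\<in>\<K>. \<exists>C. \<forall>A\<in>\<Gamma>. \<forall>\<tau>\<in>K. F A \<tau> \<le> C * mnorm A ^ M"
proof -
  obtain R0 where R0: "finite R0" "R0 \<subseteq> SL2Z" "mat 1 \<in> R0"
    "\<And>A. A \<in> \<Gamma> \<Longrightarrow> (step_in {A ** r |A r. A \<in> \<Gamma> \<and> r \<in> R0})\<^sup>*\<^sup>* (mat 1) A"
  proof (rule generate_path[OF fin \<Gamma> sub cl(1,2)])
    fix R assume R: "finite R" "R \<subseteq> SL2Z" "mat 1 \<in> R"
      "\<And>A. A \<in> \<Gamma> \<Longrightarrow> (step_in {A ** r |A r. A \<in> \<Gamma> \<and> r \<in> R})\<^sup>*\<^sup>* (mat 1) A"
    show thesis by (rule that[OF R])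
  qed
  define Y where "Y = {A ** r |A r. A \<in> \<Gamma> \<and> r \<in> R0}"
  have Y: "Y \<subseteq> SL2Z" using sub R0(2) by (auto simp: Y_def intro!: SL2Z_mult)
  have Y1: "mat 1 \<in> Y" unfolding Y_def using cl(1) R0(3) by (auto intro!: exI[of _ "mat 1"])
  have finS: "finite S_group" by (simp add: S_group_def)
  \<comment> \<open>A crossing determines a prefix only up to the stabiliser of the imaginary axis,
    hence the products with \<open>S_group\<close>.\<close>
  define R1 where "R1 = (\<lambda>(r, \<sigma>). r ** \<sigma>) ` (R0 \<times> S_group)"
  have R1: "finite R1" unfolding R1_def using R0(1) finS by blast
  have R1_sub: "R1 \<subseteq> SL2Z" using R0(2) SL2Z_mult S_group_SL2Z by (fastforce simp: R1_def)
  have S_R1: "S_group \<subseteq> R1"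
  proof
    fix \<sigma> assume "\<sigma> \<in> S_group"
    then show "\<sigma> \<in> R1" unfolding R1_def using R0(3) by (intro image_eqI[of _ _ "(mat 1, \<sigma>)"]) auto
  qed
  \<comment> \<open>A lies in the half-plane of X, while 1 lies outside it or on its boundary. So
    the path from 1 to A passes through the edge of X, and this puts X close to \<Gamma>.\<close>
  have visit: "\<exists>B\<in>\<Gamma>. \<exists>r\<in>R1. X = B ** r"
    if X: "X \<in> SL2Z" and A: "A \<in> \<Gamma>" "half_plane_mat (adj2 X ** A)" and h1: "half_plane_mat (adj2 X) \<longrightarrow> adj2 X \<in> S_group" for X A
  proof -
    have "\<exists>z\<in>Y. adj2 X ** z \<in> S_group"
    proof (cases "half_plane_mat (adj2 X)")
      case True
      then show ?thesis using h1 Y1 by (intro bexI[of _ "mat 1"]) auto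
    next
      case False
      then show ?thesis
        using step_in_crosses[OF R0(4)[OF A(1), folded Y_def] Y X _ A(2)] by simp
    qed
    then obtain B r where z: "B \<in> \<Gamma>" "r \<in> R0" "adj2 X ** (B ** r) \<in> S_group" by (auto simp: Y_def)
    define \<sigma> where "\<sigma> = adj2 X ** (B ** r)"
    have \<sigma>: "\<sigma> \<in> S_group" using z by (simp add: \<sigma>_def)
    have "X ** \<sigma> = B ** r" using X by (simp add: \<sigma>_def adj2_mult_cancel)
    then have "X = B ** r ** adj2 \<sigma>" using adj2_mult_cancel(3)[OF S_group_SL2Z[OF \<sigma>], of X] by simp
    then have "X = B ** (r ** adj2 \<sigma>)" by (simp add: matrix_mul_assoc)
    moreover have "r ** adj2 \<sigma> \<in> R1" unfolding R1_def using z(2) adj2_S_group[OF \<sigma>] by auto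
    ultimately show ?thesis using z(1) by blast
  qed
  \<comment> \<open>The elements of \<Gamma> relating consecutive prefixes: from X = A' r' and X t =
    A r follows A = A' (r' t r^(-1)). \<open>B0\<close> collects the elements that belong to the
    empty prefix.\<close>
  define B1 where "B1 = (\<lambda>(r', t, r). r' ** t ** adj2 r) ` (R1 \<times> {matT, matL} \<times> R1) \<inter> \<Gamma>"
  have B1: "finite B1" unfolding B1_def using R1 by blast
  define B0 where "B0 = (\<lambda>(\<sigma>, r). \<sigma> ** adj2 r) ` (S_group \<times> R1) \<inter> \<Gamma>"
  have B0: "finite B0" unfolding B0_def using R1 finS by blast
  define PM where "PM = (\<lambda>s M. \<forall>K\<in>\<K>. \<exists>C. \<forall>A\<in>\<Gamma>. \<forall>\<tau>\<in>K. F (A ** s) \<tau> \<le> F A \<tau> + C * mnorm A ^ M)"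
  have "\<exists>M. \<forall>s\<in>B1. PM s M"
  proof (rule finite_uniform_exponent[OF B1])
    show "\<exists>M. PM s M" if "s \<in> B1" for s using step[of s] that by (auto simp: PM_def B1_def)
    fix s m n assume PM: "PM s m" and mn: "m \<le> (n::nat)"
    show "PM s n" unfolding PM_def
    proof
      fix K assume "K \<in> \<K>"
      then obtain C where C: "\<And>A \<tau>. A \<in> \<Gamma> \<Longrightarrow> \<tau> \<in> K \<Longrightarrow> F (A ** s) \<tau> \<le> F A \<tau> + C * mnorm A ^ m"
        using PM unfolding PM_def by metis
      have "F (A ** s) \<tau> \<le> F A \<tau> + \<bar>C\<bar> * mnorm A ^ n" if "A \<in> \<Gamma>" "\<tau> \<in> K" for A \<tau>
      proof -
        have "mnorm A \<ge> 1" using that sub mnorm_ge_1 by blast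
        then have "C * mnorm A ^ m \<le> \<bar>C\<bar> * mnorm A ^ n"
          using mn by (intro mult_mono power_increasing) auto
        then show ?thesis using C[OF that] by linarith
      qed
      then show "\<exists>C. \<forall>A\<in>\<Gamma>. \<forall>\<tau>\<in>K. F (A ** s) \<tau> \<le> F A \<tau> + C * mnorm A ^ n" by blast
    qed
  qed
  then obtain M where M: "\<And>s. s \<in> B1 \<Longrightarrow> PM s M" by blast
  have "\<exists>C. \<forall>A\<in>\<Gamma>. \<forall>\<tau>\<in>K. F A \<tau> \<le> C * mnorm A ^ Suc M" if K: "K \<in> \<K>" for K
  proof -
    have "\<forall>s\<in>B1. \<exists>C. \<forall>A\<in>\<Gamma>. \<forall>\<tau>\<in>K. F (A ** s) \<tau> \<le> F A \<tau> + C * mnorm A ^ M"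
      using M K by (auto simp: PM_def)
    then obtain Cs where Cs: "\<And>s A \<tau>. s \<in> B1 \<Longrightarrow> A \<in> \<Gamma> \<Longrightarrow> \<tau> \<in> K \<Longrightarrow> F (A ** s) \<tau> \<le> F A \<tau> + Cs s * mnorm A ^ M"
      by metis
    define C' where "C' = (\<Sum>s\<in>B1. \<bar>Cs s\<bar>)"
    have C'0: "C' \<ge> 0" by (auto simp: C'_def intro: sum_nonneg)
    have Cs': "Cs s \<le> C'" if "s \<in> B1" for s
      unfolding C'_def using member_le_sum[OF that, of "\<lambda>s. \<bar>Cs s\<bar>"] B1 by simp
    have "\<forall>A\<in>B0. \<exists>C. \<forall>\<tau>\<in>K. F A \<tau> \<le> C" using bd K by (auto simp: B0_def)
    then obtain Ds where Ds: "\<And>A \<tau>. A \<in> B0 \<Longrightarrow> \<tau> \<in> K \<Longrightarrow> F A \<tau> \<le> Ds A" by metis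
    define C0 where "C0 = (\<Sum>A\<in>B0. \<bar>Ds A\<bar>)"
    have C00: "C0 \<ge> 0" by (auto simp: C0_def intro: sum_nonneg)
    have C0: "F A \<tau> \<le> C0" if "A \<in> B0" "\<tau> \<in> K" for A \<tau>
      unfolding C0_def using member_le_sum[OF that(1), of "\<lambda>s. \<bar>Ds s\<bar>"] B0 Ds[OF that] by simp
    \<comment> \<open>For A' = \<sigma> B r'^(-1): the factor 2 is the norm of an element of
      \<open>S_group\<close>, and the sum dominates the norm of every r'.\<close>
    define c2 where "c2 = 2 * (\<Sum>r\<in>R1. mnorm r)"
    define C1 where "C1 = C' * c2 ^ M"
    have c20: "c2 \<ge> 0" by (auto simp: c2_def mnorm_nonneg intro!: sum_nonneg)
    have C10: "C1 \<ge> 0" unfolding C1_def using C'0 c20 by simp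
    \<comment> \<open>All prefixes x of p are assumed close to \<Gamma>, and A and r are arbitrary,
      so that the assumption passes to the shorter word.\<close>
    have main: "F A \<tau> \<le> C0 + C1 * mnorm p ^ Suc M"
      if p: "p \<in> SL2Z" "nonneg_mat p" and \<sigma>: "\<sigma> \<in> S_group" and \<tau>: "\<tau> \<in> K"
        and pre: "\<And>x. x \<in> SL2Z \<Longrightarrow> nonneg_mat x \<Longrightarrow> nonneg_mat (adj2 x ** p) \<Longrightarrow> \<exists>B\<in>\<Gamma>. \<exists>r\<in>R1. \<sigma> ** x = B ** r"
        and A: "A \<in> \<Gamma>" "r \<in> R1" "\<sigma> ** p = A ** r" for p \<sigma> A r \<tau>
      using p pre A
    proof (induction arbitrary: A r rule: nonneg_mat_induct)
      case one
      have "A = \<sigma> ** adj2 r"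
        using one.prems(2-4) R1_sub adj2_mult_cancel(3)[of r A] by auto
      then have "A \<in> B0" unfolding B0_def using \<sigma> one.prems(2,3) by auto
      then have "F A \<tau> \<le> C0" using C0 \<tau> by blast
      then show ?case using C10 mnorm_nonneg[of "mat 1"] by (smt (verit) mult_nonneg_nonneg zero_le_power)
    next
      case (step B t)
      have tS: "t \<in> SL2Z" "nonneg_mat t" using step.hyps(3) matT_SL2Z matL_SL2Z
        by (auto simp: nonneg_mat_def matT_def matL_def)
      have "nonneg_mat (adj2 B ** (B ** t))" using step.hyps(1) tS by (simp add: adj2_mult_cancel)
      then obtain A' r' where A': "A' \<in> \<Gamma>" "r' \<in> R1" "\<sigma> ** B = A' ** r'"
        using step.prems(1)[OF step.hyps(1,2)] by blast
      have preB: "\<exists>A\<in>\<Gamma>. \<exists>r\<in>R1. \<sigma> ** x = A ** r" if "x \<in> SL2Z" "nonneg_mat x" "nonneg_mat (adj2 x ** B)" for x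
        using step.prems(1)[OF that(1,2)] nonneg_mat_mult[OF that(3) tS(2)] by (simp add: matrix_mul_assoc)
      have IH: "F A' \<tau> \<le> C0 + C1 * mnorm B ^ Suc M"
        using step.IH[OF preB A'] by blast
      define s where "s = r' ** t ** adj2 r"
      have rS: "r \<in> SL2Z" "r' \<in> SL2Z" using step.prems(3) A'(2) R1_sub by auto
      have "A = \<sigma> ** (B ** t) ** adj2 r"
        using step.prems(4) rS adj2_mult_cancel(3)[of r A] by simp
      also have "\<dots> = (\<sigma> ** B) ** t ** adj2 r" by (simp add: matrix_mul_assoc)
      also have "\<dots> = A' ** s" by (simp add: A'(3) s_def matrix_mul_assoc)
      finally have As: "A = A' ** s" .
      then have "s = adj2 A' ** A" using A'(1) sub by (auto simp: adj2_mult_cancel)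
      then have "s \<in> \<Gamma>" using cl(2)[OF cl(3)[OF A'(1)] step.prems(2)] by simp
      moreover have "s \<in> (\<lambda>(r', t, r). r' ** t ** adj2 r) ` (R1 \<times> {matT, matL} \<times> R1)"
        using A'(2) step.hyps(3) step.prems(3) by (intro image_eqI[of _ _ "(r', t, r)"]) (auto simp: s_def)
      ultimately have sB: "s \<in> B1" by (simp add: B1_def)
      have "A' = \<sigma> ** B ** adj2 r'" using A'(3) rS adj2_mult_cancel(3)[of r' A'] by simp
      then have "mnorm A' \<le> mnorm \<sigma> * mnorm B * mnorm (adj2 r')"
        using mnorm_mult[of "\<sigma> ** B" "adj2 r'"] mnorm_mult[of \<sigma> B] mnorm_nonneg[of "adj2 r'"]
        by (metis mult_right_mono order_trans)
      also have "mnorm \<sigma> = 2" using \<sigma> by (auto simp: S_group_def mnorm_def matS_def mat_1_nth2)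
      also have "2 * mnorm B * mnorm (adj2 r') \<le> 2 * mnorm B * (\<Sum>r\<in>R1. mnorm r)"
        using member_le_sum[OF A'(2), of mnorm] R1 mnorm_nonneg by (intro mult_left_mono) (auto simp: mnorm_nonneg)
      finally have mA': "mnorm A' \<le> c2 * mnorm B" by (simp add: c2_def mult_ac)
      have mB: "mnorm B \<ge> 1" using mnorm_ge_1[OF step.hyps(1)] .
      have "F A \<tau> \<le> F A' \<tau> + Cs s * mnorm A' ^ M" unfolding As by (rule Cs[OF sB A'(1) \<tau>])
      also have "Cs s * mnorm A' ^ M \<le> C' * (c2 * mnorm B) ^ M"
        using Cs'[OF sB] mA' mnorm_nonneg C'0 by (intro mult_mono power_mono) auto
      also have "\<dots> = C1 * mnorm B ^ M" by (simp add: C1_def power_mult_distrib)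
      \<comment> \<open>Old bound and increment combine to
        \<open>mnorm B ^ M * (mnorm B + 1)\<close>, which the growth of the norm by 1 keeps below
        the next power of \<open>mnorm (B ** t)\<close>.\<close>
      also have "F A' \<tau> + C1 * mnorm B ^ M \<le> C0 + C1 * (mnorm B ^ M * (mnorm B + 1))"
        using IH by (simp add: algebra_simps)
      also have "C1 * (mnorm B ^ M * (mnorm B + 1)) \<le> C1 * (mnorm (B ** t) ^ M * mnorm (B ** t))"
        using step.hyps(4) mB C10 by (intro mult_left_mono mult_mono power_mono) auto
      finally show ?case by (simp add: mult_ac)
    qed
    have "F A \<tau> \<le> (C0 + C1) * mnorm A ^ Suc M" if A: "A \<in> \<Gamma>" and \<tau>: "\<tau> \<in> K" for A \<tau>
    proof -
      have AS: "A \<in> SL2Z" using A sub by blast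
      obtain \<sigma> p \<sigma>' where d: "\<sigma> \<in> S_group" "p \<in> SL2Z" "nonneg_mat p" "\<sigma>' \<in> S_group" "A = \<sigma> ** p ** \<sigma>'" "mnorm p = mnorm A"
        using SL2Z_decomp[OF AS] by metis
      have pre: "\<exists>B\<in>\<Gamma>. \<exists>r\<in>R1. \<sigma> ** x = B ** r"
        if x: "x \<in> SL2Z" "nonneg_mat x" "nonneg_mat (adj2 x ** p)" for x
      proof (rule visit[OF _ A])
        show "\<sigma> ** x \<in> SL2Z" by (rule SL2Z_mult[OF S_group_SL2Z[OF d(1)] x(1)])
        have "adj2 (\<sigma> ** x) ** A = adj2 x ** (adj2 \<sigma> ** (\<sigma> ** (p ** \<sigma>')))"
          by (simp add: adj2_mult d(5) matrix_mul_assoc)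
        also have "\<dots> = (adj2 x ** p) ** \<sigma>'"
          using S_group_SL2Z[OF d(1)] by (simp add: adj2_mult_cancel) (simp add: matrix_mul_assoc)
        finally show "half_plane_mat (adj2 (\<sigma> ** x) ** A)"
          using half_plane_mat_nonneg_mult[OF x(3) d(4)] by simp
        show "half_plane_mat (adj2 (\<sigma> ** x)) \<longrightarrow> adj2 (\<sigma> ** x) \<in> S_group"
          unfolding adj2_mult using S_group_of_nonneg_adj2[OF x(1,2) adj2_S_group[OF d(1)]] by blast
      qed
      have "\<sigma> ** p = A ** adj2 \<sigma>'" using S_group_SL2Z[OF d(4)] by (simp add: d(5) adj2_mult_cancel)
      moreover have "adj2 \<sigma>' \<in> R1" using S_R1 adj2_S_group[OF d(4)] by blast
      ultimately have "F A \<tau> \<le> C0 + C1 * mnorm p ^ Suc M"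
        using main[OF d(2,3,1) \<tau> pre A] by blast
      also have "C0 \<le> C0 * mnorm A ^ Suc M"
        using mult_left_mono[OF one_le_power[OF mnorm_ge_1[OF AS], of "Suc M"] C00] by simp
      finally show ?thesis by (simp add: d(6) distrib_right)
    qed
    then show ?thesis by blast
  qed
  then show ?thesis by blast
qed

subsection \<open>Growth of cocycles\<close>

lemma matrix_inv_eqI:
  fixes A B :: "'a::semiring_1^'n^'n"
  assumes "A ** B = mat 1" "B ** A = mat 1"
  shows "matrix_inv A = B"
proof -
  have "A ** matrix_inv A = mat 1 \<and> matrix_inv A ** A = mat 1"
    unfolding matrix_inv_def by (rule someI[of _ B]) (use assms in simp)
  then have "matrix_inv A = (B ** A) ** matrix_inv A" "A ** matrix_inv A = mat 1" using assms by simp_all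
  then show ?thesis by (simp add: matrix_mul_assoc[symmetric])
qed

text \<open>The inverse is the conjugate transpose, and the rows of a unitary matrix have norm
  1.\<close>

lemma unitary_matrix_inv_entry:
  fixes U :: "complex^'p::finite^'p"
  assumes "U \<in> carrier unitary_group"
  shows "norm (matrix_inv U $ i $ j) \<le> 1"
proof -
  have U: "U ** conj_transpose U = mat 1" "conj_transpose U ** U = mat 1"
    using assms by (auto simp: unitary_group_def)
  have inv: "matrix_inv U = conj_transpose U" using U by (rule matrix_inv_eqI)
  have "(U ** conj_transpose U) $ j $ j = 1" by (simp add: U mat_def)
  then have "(\<Sum>k\<in>UNIV. U $ j $ k * cnj (U $ j $ k)) = 1"
    by (simp add: matrix_matrix_mult_def conj_transpose_def)
  then have "(\<Sum>k\<in>UNIV. complex_of_real ((norm (U $ j $ k))\<^sup>2)) = 1"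
    by (simp only: complex_norm_square)
  then have "complex_of_real (\<Sum>k\<in>UNIV. (norm (U $ j $ k))\<^sup>2) = complex_of_real 1" by simp
  then have "(\<Sum>k\<in>UNIV. (norm (U $ j $ k))\<^sup>2) = 1" by (simp only: of_real_eq_iff)
  moreover have "(norm (U $ j $ i))\<^sup>2 \<le> (\<Sum>k\<in>UNIV. (norm (U $ j $ k))\<^sup>2)"
    by (rule member_le_sum) auto
  ultimately have "(norm (U $ j $ i))\<^sup>2 \<le> 1\<^sup>2" by simp
  then have "norm (U $ j $ i) \<le> 1" by (rule power2_le_imp_le) simp
  then show ?thesis by (simp add: inv conj_transpose_def)
qed

lemma norm_real_power: "z \<noteq> 0 \<Longrightarrow> norm (real_power z r) = norm z powr r"
  by (simp add: real_power_def norm_mult)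

text \<open>Bounds on y from both sides are used because the exponent is a weight of either
  sign.\<close>

lemma powr_le_of_bounds:
  fixes y B r :: real
  assumes "B \<ge> 1" "y > 0" "1 / y \<le> B" "y \<le> B"
  shows "y powr r \<le> B powr \<bar>r\<bar>"
proof (cases "r \<ge> 0")
  case True
  then show ?thesis using assms by (simp add: powr_mono2)
next
  case False
  have "y powr r = (1 / y) powr \<bar>r\<bar>" using assms False by (simp add: powr_divide powr_minus_divide)
  also have "\<dots> \<le> B powr \<bar>r\<bar>" using assms by (intro powr_mono2) auto
  finally show ?thesis .
qed

lemma powr_le_power_ceiling:
  fixes B r :: real
  assumes "B \<ge> 1"
  shows "B powr r \<le> B ^ nat \<lceil>r\<rceil>"
proof -
  have "B powr r \<le> B powr real (nat \<lceil>r\<rceil>)" using assms by (intro powr_mono) linarith+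
  then show ?thesis using assms by (simp add: powr_realpow)
qed

lemma slash_nth:
  "slash w v \<rho> f A \<tau> $ i =
     (\<Sum>j\<in>UNIV. inverse (v A) * real_power (aut_factor A \<tau>) (- w) * matrix_inv (\<rho> A) $ i $ j * f (moebius_action A \<tau>) $ j)"
  by (simp add: slash_def matrix_vector_mult_def sum_distrib_left mult.assoc)

text \<open>On a compact set |c\<tau> + d|, its inverse and |A\<tau>| are at most a multiple B of
  the norm of A, and 1/Im(A\<tau>) is at most B^3, whence the 3 \<sigma> in the exponent. Only the
  constant depends on the compact set; the exponent comes from \<alpha>, \<sigma> and the
  weight.\<close>

lemma slash_polynomial_growth:
  fixes \<rho> :: "real^2^2 \<Rightarrow> complex^'p::finite^'p" and Q :: "complex \<Rightarrow> complex^'p"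
  assumes sub: "\<Gamma> \<subseteq> SL2Z" and v: "\<And>A. A \<in> \<Gamma> \<Longrightarrow> norm (v A) = 1"
    and \<rho>: "\<And>A. A \<in> \<Gamma> \<Longrightarrow> \<rho> A \<in> carrier unitary_group" and Q: "Q \<in> growth_space"
  shows "\<exists>M. \<forall>K\<in>{K. compact K \<and> K \<subseteq> upper_half_plane}. \<exists>C. \<forall>A\<in>\<Gamma>. \<forall>\<tau>\<in>K.
           norm (slash w v \<rho> Q A \<tau>) \<le> C * mnorm A ^ M"
proof -
  obtain k \<alpha> \<sigma> where k: "k > 0" "\<alpha> > 0" "\<sigma> > 0"
    and gr: "\<And>j \<tau>. \<tau> \<in> upper_half_plane \<Longrightarrow> norm (Q \<tau> $ j) < k * (norm \<tau> powr \<alpha> + Im \<tau> powr (- \<sigma>))"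
    using Q unfolding growth_space_def by auto
  define m1 where "m1 = nat \<lceil>\<alpha>\<rceil> + nat \<lceil>3 * \<sigma>\<rceil>"
  define m2 where "m2 = nat \<lceil>\<bar>w\<bar>\<rceil>"
  have "\<exists>C. \<forall>A\<in>\<Gamma>. \<forall>\<tau>\<in>K. norm (slash w v \<rho> Q A \<tau>) \<le> C * mnorm A ^ (m1 + m2)"
    if K: "compact K" "K \<subseteq> upper_half_plane" for K
  proof -
    obtain y R where yR: "y > 0" "R > 0" "K \<subseteq> cone_region y R" "\<And>\<tau>. \<tau> \<in> K \<Longrightarrow> norm \<tau> \<le> R"
      using compact_subset_cone_region[OF K] by metis
    define c where "c = 1 / y + 1 + R"
    have c: "c \<ge> 1" using yR by (simp add: c_def)
    \<comment> \<open>A product of factors \<ge> 1, so that it dominates each of the constants R +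
      1, c, (R + 1) c and 1/y met below.\<close>
    define b where "b = (R + 1) * c * (1 + 1 / y)"
    have Rc: "1 \<le> (R + 1) * c" using mult_mono[of 1 "R + 1" 1 c] yR c by simp
    have y1: "1 \<le> 1 + 1 / y" using yR by simp
    have b_ge: "b \<ge> (R + 1) * c" using mult_left_mono[OF y1, of "(R + 1) * c"] Rc by (simp add: b_def)
    have "1 * (1 + 1 / y) \<le> (R + 1) * c * (1 + 1 / y)" by (rule mult_right_mono[OF Rc]) (use y1 in linarith)
    then have b_ge2: "b \<ge> 1 + 1 / y" by (simp only: b_def mult_1)
    have "(R + 1) * 1 \<le> (R + 1) * c" by (rule mult_left_mono[OF c]) (use yR in simp)
    from order_trans[OF this b_ge] have b_ge3: "b \<ge> R + 1" by simp
    have "1 * c \<le> (R + 1) * c" by (rule mult_right_mono) (use yR c in simp_all)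
    from order_trans[OF this b_ge] have b_ge4: "b \<ge> c" by simp
    have b1: "b \<ge> 1" using Rc b_ge by linarith
    have main: "norm (slash w v \<rho> Q A \<tau>) \<le> (of_nat CARD('p) * of_nat CARD('p) * (2 * k) * b ^ (m1 + m2)) * mnorm A ^ (m1 + m2)"
      if A: "A \<in> \<Gamma>" and \<tau>: "\<tau> \<in> K" for A \<tau>
    proof -
      have AS: "A \<in> SL2Z" and th: "\<tau> \<in> upper_half_plane" using A \<tau> sub K by auto
      have tc: "\<tau> \<in> cone_region y R" using yR(3) \<tau> by blast
      have m: "mnorm A \<ge> 1" using mnorm_ge_1[OF AS] .
      define B where "B = b * mnorm A"
      have bB: "b \<le> B" using mult_left_mono[OF m, of b] b1 by (simp add: B_def)
      have B1: "B \<ge> 1" using bB b1 by linarith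
      define X where "X = num_factor A \<tau>"
      define Y where "Y = aut_factor A \<tau>"
      define z where "z = moebius_action A \<tau>"
      have Y0: "Y \<noteq> 0" using aut_factor_nonzero[OF AS th] by (simp add: Y_def)
      have zX: "z = X / Y" by (simp add: z_def X_def Y_def moebius_action_eq)
      have zh: "z \<in> upper_half_plane" using moebius_action_in_uhp[OF AS th] by (simp add: z_def)
      have lin: "norm (of_real p * \<tau> + of_real q) \<le> (R + 1) * (\<bar>p\<bar> + \<bar>q\<bar>)" for p q :: real
      proof -
        have "norm (of_real p * \<tau> + of_real q) \<le> \<bar>p\<bar> * norm \<tau> + \<bar>q\<bar>"
          by (metis norm_mult norm_of_real norm_triangle_ineq)
        also have "\<dots> \<le> \<bar>p\<bar> * R + \<bar>q\<bar>" using yR(4)[OF \<tau>] by (intro add_mono mult_left_mono) auto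
        also have "\<dots> \<le> (R + 1) * (\<bar>p\<bar> + \<bar>q\<bar>)" using yR(2) by (simp add: algebra_simps)
        finally show ?thesis .
      qed
      have le_m: "(R + 1) * (\<bar>A$2$1\<bar> + \<bar>A$2$2\<bar>) \<le> (R + 1) * mnorm A" "(R + 1) * (\<bar>A$1$1\<bar> + \<bar>A$1$2\<bar>) \<le> (R + 1) * mnorm A"
        using yR(2) by (intro mult_left_mono; simp add: mnorm_def)+
      have nY: "norm Y \<le> (R + 1) * mnorm A" "norm X \<le> (R + 1) * mnorm A"
        unfolding X_def Y_def num_factor_def aut_factor_def using lin le_m order_trans by blast+
      have "1 \<le> \<bar>A$2$1\<bar> + \<bar>A$2$2\<bar>" by (rule SL2Z_bottom_row[OF AS])
      also have "\<dots> \<le> c * norm Y" unfolding Y_def aut_factor_def c_def by (rule linear_form_bound[OF yR(1) tc])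
      finally have Yc: "1 / norm Y \<le> c" using Y0 by (simp add: field_simps)
      have YB: "norm Y \<le> B"
        unfolding B_def by (rule order_trans[OF nY(1) mult_right_mono[OF b_ge3]]) (use m in simp)
      have bm: "(R + 1) * c * mnorm A \<le> b * mnorm A" by (rule mult_right_mono[OF b_ge]) (use m in simp)
      have iYB: "1 / norm Y \<le> B" using Yc b_ge4 bB by linarith
      have "norm z = norm X * (1 / norm Y)" by (simp add: zX norm_divide)
      also have "\<dots> \<le> ((R + 1) * mnorm A) * c" using nY(2) Yc yR(2) m by (intro mult_mono) auto
      also have "\<dots> \<le> B" using bm by (simp only: B_def mult_ac)
      finally have zB: "norm z \<le> B" .
      have Imt: "Im \<tau> \<ge> y" using tc by (simp add: cone_region_def)
      have "1 / Im z = (norm Y)\<^sup>2 * (1 / Im \<tau>)"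
        using Im_moebius_action[OF AS th] by (simp add: z_def Y_def)
      also have "\<dots> \<le> B\<^sup>2 * B"
      proof (intro mult_mono power_mono YB)
        have "1 / Im \<tau> \<le> 1 / y" using Imt yR(1) by (simp add: frac_le)
        then show "1 / Im \<tau> \<le> B" using b_ge2 bB by linarith
      qed (use Imt yR(1) B1 in auto)
      finally have izB: "1 / Im z \<le> B ^ 3" by (simp add: power2_eq_square power3_eq_cube)
      have zpos: "Im z > 0" using zh by (simp add: upper_half_plane_def)
      have 1: "norm z powr \<alpha> \<le> B ^ m1"
      proof -
        have "norm z powr \<alpha> \<le> B powr \<alpha>" using zB k by (intro powr_mono2) auto
        also have "\<dots> \<le> B ^ nat \<lceil>\<alpha>\<rceil>" by (rule powr_le_power_ceiling[OF B1])
        also have "\<dots> \<le> B ^ m1" using B1 by (intro power_increasing) (auto simp: m1_def)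
        finally show ?thesis .
      qed
      have 2: "Im z powr (- \<sigma>) \<le> B ^ m1"
      proof -
        have "Im z powr (- \<sigma>) = (1 / Im z) powr \<sigma>" using zpos by (simp add: powr_minus_divide powr_divide)
        also have "\<dots> \<le> (B ^ 3) powr \<sigma>" using izB zpos k by (intro powr_mono2) auto
        also have "B ^ 3 = B powr 3" using B1 by (simp add: powr_numeral)
        also have "(B powr 3) powr \<sigma> = B powr (3 * \<sigma>)" by (simp add: powr_powr)
        also have "\<dots> \<le> B ^ nat \<lceil>3 * \<sigma>\<rceil>" by (rule powr_le_power_ceiling[OF B1])
        also have "\<dots> \<le> B ^ m1" using B1 by (intro power_increasing) (auto simp: m1_def)
        finally show ?thesis .
      qed
      have Qb: "norm (Q z $ j) \<le> 2 * k * B ^ m1" for j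
      proof -
        have "norm (Q z $ j) \<le> k * (norm z powr \<alpha> + Im z powr (- \<sigma>))" using gr[OF zh] less_imp_le by blast
        also have "\<dots> \<le> k * (B ^ m1 + B ^ m1)" using 1 2 k by (intro mult_left_mono add_mono) auto
        finally show ?thesis by simp
      qed
      have cb: "norm (inverse (v A) * real_power Y (- w)) \<le> B ^ m2"
      proof -
        have "norm (inverse (v A) * real_power Y (- w)) = norm Y powr (- w)"
          using v[OF A] by (simp add: norm_mult norm_inverse norm_real_power[OF Y0])
        also have "\<dots> \<le> B powr \<bar>- w\<bar>" using B1 Y0 iYB YB by (intro powr_le_of_bounds) auto
        also have "\<dots> \<le> B ^ m2" unfolding m2_def using powr_le_power_ceiling[OF B1, of "\<bar>w\<bar>"] by simp
        finally show ?thesis .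
      qed
      have comp: "norm (slash w v \<rho> Q A \<tau> $ i) \<le> of_nat CARD('p) * (B ^ m2 * (2 * k * B ^ m1))" for i
      proof -
        have "norm (slash w v \<rho> Q A \<tau> $ i) \<le> (\<Sum>j\<in>(UNIV::'p set). B ^ m2 * (2 * k * B ^ m1))"
          unfolding slash_nth Y_def[symmetric] z_def[symmetric]
        proof (rule sum_norm_le)
          fix j :: 'p
          have "norm (inverse (v A) * real_power Y (- w) * matrix_inv (\<rho> A) $ i $ j * Q z $ j) \<le> B ^ m2 * 1 * (2 * k * B ^ m1)"
            unfolding norm_mult[of _ "Q z $ j"] norm_mult[of _ "matrix_inv (\<rho> A) $ i $ j"]
            using cb Qb unitary_matrix_inv_entry[OF \<rho>[OF A]] B1 by (intro mult_mono) auto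
          then show "norm (inverse (v A) * real_power Y (- w) * matrix_inv (\<rho> A) $ i $ j * Q z $ j) \<le> B ^ m2 * (2 * k * B ^ m1)"
            by simp
        qed
        then show ?thesis by simp
      qed
      have "norm (slash w v \<rho> Q A \<tau>) \<le> (\<Sum>i\<in>UNIV. norm (slash w v \<rho> Q A \<tau> $ i))"
        by (simp add: norm_vec_def L2_set_le_sum)
      also have "\<dots> \<le> (\<Sum>i\<in>(UNIV::'p set). of_nat CARD('p) * (B ^ m2 * (2 * k * B ^ m1)))"
        by (intro sum_mono comp)
      also have "\<dots> = (of_nat CARD('p) * of_nat CARD('p) * (2 * k) * b ^ (m1 + m2)) * mnorm A ^ (m1 + m2)"
        by (simp add: B_def power_mult_distrib power_add mult_ac)
      finally show ?thesis .
    qed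
    then show ?thesis by blast
  qed
  then show ?thesis by blast
qed

lemma vholomorphic_continuous_on:
  fixes f :: "complex \<Rightarrow> complex^'p::finite"
  assumes "vholomorphic f"
  shows "continuous_on upper_half_plane f"
proof -
  have "continuous_on upper_half_plane (\<lambda>\<tau>. \<chi> j. f \<tau> $ j)"
    using assms by (intro continuous_on_vec_lambda holomorphic_on_imp_continuous_on) (simp add: vholomorphic_def)
  then show ?thesis by simp
qed

text \<open>The induction is run on g at A^(-1): passing from A to As then adds the fixed function g
  at s^(-1), slashed by A^(-1), which \<open>slash_polynomial_growth\<close> bounds. For g at A
  itself, the new letter would act on everything accumulated so far.\<close>

lemma cocycle_polynomial_growth:
  fixes g :: "real^2^2 \<Rightarrow> complex \<Rightarrow> complex^'p::finite"
  assumes fin: "finite S" and \<Gamma>: "\<Gamma> = generate SL2R S" and sub: "\<Gamma> \<subseteq> SL2Z"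
    and cl: "mat 1 \<in> \<Gamma>" "\<And>A B. A \<in> \<Gamma> \<Longrightarrow> B \<in> \<Gamma> \<Longrightarrow> A ** B \<in> \<Gamma>" "\<And>A. A \<in> \<Gamma> \<Longrightarrow> adj2 A \<in> \<Gamma>"
    and v: "\<And>A. A \<in> \<Gamma> \<Longrightarrow> norm (v A) = 1"
    and \<rho>: "\<And>A. A \<in> \<Gamma> \<Longrightarrow> \<rho> A \<in> carrier unitary_group"
    and g: "cocycle \<Gamma> w v \<rho> g"
  shows "\<exists>M. \<forall>K\<in>{K. compact K \<and> K \<subseteq> upper_half_plane}. \<exists>C. \<forall>A\<in>\<Gamma>. \<forall>\<tau>\<in>K.
           norm (g A \<tau>) \<le> C * mnorm A ^ M"
proof -
  let ?KK = "{K. compact K \<and> K \<subseteq> upper_half_plane}"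
  have gs: "g A \<in> growth_space" if "A \<in> \<Gamma>" for A using g that by (simp add: cocycle_def)
  have gc: "g (A ** B) \<tau> = g B \<tau> + slash w v \<rho> (g A) B \<tau>"
    if "A \<in> \<Gamma>" "B \<in> \<Gamma>" "\<tau> \<in> upper_half_plane" for A B \<tau>
    using g that by (simp add: cocycle_def)
  have "\<exists>M. \<forall>K\<in>?KK. \<exists>C. \<forall>A\<in>\<Gamma>. \<forall>\<tau>\<in>K. norm (g (adj2 A) \<tau>) \<le> C * mnorm A ^ M"
  proof (rule polynomial_growth_of_generated[OF fin \<Gamma> sub cl])
    fix A K assume A: "A \<in> \<Gamma>" and K: "K \<in> ?KK"
    have "vholomorphic (g (adj2 A))" using gs[OF cl(3)[OF A]] by (simp add: growth_space_def)
    then have "continuous_on K (g (adj2 A))" using K vholomorphic_continuous_on continuous_on_subset by blast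
    then show "\<exists>C. \<forall>\<tau>\<in>K. norm (g (adj2 A) \<tau>) \<le> C"
      using continuous_on_compact_norm_bound[of K "g (adj2 A)"] K by (metis mem_Collect_eq)
  next
    fix s assume s: "s \<in> \<Gamma>"
    obtain M where M: "\<And>K. K \<in> ?KK \<Longrightarrow> \<exists>C. \<forall>A\<in>\<Gamma>. \<forall>\<tau>\<in>K. norm (slash w v \<rho> (g (adj2 s)) A \<tau>) \<le> C * mnorm A ^ M"
      using slash_polynomial_growth[where w = w and v = v and \<rho> = \<rho>, OF sub v \<rho> gs[OF cl(3)[OF s]]] by blast
    show "\<exists>M. \<forall>K\<in>?KK. \<exists>C. \<forall>A\<in>\<Gamma>. \<forall>\<tau>\<in>K. norm (g (adj2 (A ** s)) \<tau>) \<le> norm (g (adj2 A) \<tau>) + C * mnorm A ^ M"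
    proof (rule exI[of _ M], rule ballI)
      fix K assume K: "K \<in> ?KK"
      obtain C where C: "\<And>A \<tau>. A \<in> \<Gamma> \<Longrightarrow> \<tau> \<in> K \<Longrightarrow> norm (slash w v \<rho> (g (adj2 s)) A \<tau>) \<le> C * mnorm A ^ M"
        using M[OF K] by blast
      have "norm (g (adj2 (A ** s)) \<tau>) \<le> norm (g (adj2 A) \<tau>) + C * mnorm A ^ M" if A: "A \<in> \<Gamma>" and \<tau>: "\<tau> \<in> K" for A \<tau>
      proof -
        have "\<tau> \<in> upper_half_plane" using K \<tau> by blast
        then have "g (adj2 (A ** s)) \<tau> = g (adj2 A) \<tau> + slash w v \<rho> (g (adj2 s)) (adj2 A) \<tau>"
          unfolding adj2_mult using A s cl(3) by (intro gc) auto
        then have "norm (g (adj2 (A ** s)) \<tau>) \<le> norm (g (adj2 A) \<tau>) + norm (slash w v \<rho> (g (adj2 s)) (adj2 A) \<tau>)"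
          by (simp add: norm_triangle_ineq)
        then show ?thesis using C[OF cl(3)[OF A] \<tau>] by simp
      qed
      then show "\<exists>C. \<forall>A\<in>\<Gamma>. \<forall>\<tau>\<in>K. norm (g (adj2 (A ** s)) \<tau>) \<le> norm (g (adj2 A) \<tau>) + C * mnorm A ^ M" by blast
    qed
  qed
  then obtain M where M: "\<And>K. K \<in> ?KK \<Longrightarrow> \<exists>C. \<forall>A\<in>\<Gamma>. \<forall>\<tau>\<in>K. norm (g (adj2 A) \<tau>) \<le> C * mnorm A ^ M" by blast
  have "\<exists>C. \<forall>A\<in>\<Gamma>. \<forall>\<tau>\<in>K. norm (g A \<tau>) \<le> C * mnorm A ^ M" if K: "K \<in> ?KK" for K
  proof -
    obtain C where C: "\<And>A \<tau>. A \<in> \<Gamma> \<Longrightarrow> \<tau> \<in> K \<Longrightarrow> norm (g (adj2 A) \<tau>) \<le> C * mnorm A ^ M" using M[OF K] by blast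
    have "norm (g A \<tau>) \<le> C * mnorm A ^ M" if "A \<in> \<Gamma>" "\<tau> \<in> K" for A \<tau>
      using C[OF cl(3)[OF that(1)] that(2)] by simp
    then show ?thesis by blast
  qed
  then show ?thesis by blast
qed

text \<open>A representative of A\<Gamma> chosen by the coset alone makes the complementary factor c
  equivariant under \<Gamma>. Taking it shortest makes it no longer than A up to rounding, and the
  norm of c is then at most quadratic.\<close>

lemma ex_short_coset_component:
  assumes sub: "\<Gamma> \<subseteq> SL2Z"
    and cl: "mat 1 \<in> \<Gamma>" "\<And>A B. A \<in> \<Gamma> \<Longrightarrow> B \<in> \<Gamma> \<Longrightarrow> A ** B \<in> \<Gamma>" "\<And>A. A \<in> \<Gamma> \<Longrightarrow> adj2 A \<in> \<Gamma>"
  obtains c where "\<And>A. A \<in> SL2Z \<Longrightarrow> c A \<in> \<Gamma>"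
    "\<And>A B. A \<in> SL2Z \<Longrightarrow> B \<in> \<Gamma> \<Longrightarrow> c (A ** B) = c A ** B"
    "\<And>A. A \<in> SL2Z \<Longrightarrow> mnorm (c A) \<le> 2 * (mnorm A)\<^sup>2"
proof -
  define coset :: "real^2^2 \<Rightarrow> (real^2^2) set" where "coset = (\<lambda>A. (**) A ` \<Gamma>)"
  define s where "s = (\<lambda>A. arg_min (\<lambda>x. nat \<lfloor>mnorm x\<rfloor>) (\<lambda>x. x \<in> coset A))"
  have self: "A \<in> coset A" for A unfolding coset_def using cl(1) by (intro image_eqI[of _ _ "mat 1"]) auto
  have s: "s A \<in> coset A" "nat \<lfloor>mnorm (s A)\<rfloor> \<le> nat \<lfloor>mnorm A\<rfloor>" for A
    unfolding s_def using arg_min_nat_lemma[of "\<lambda>x. x \<in> coset A" A "\<lambda>x. nat \<lfloor>mnorm x\<rfloor>"] self by auto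
  have coset_eq: "coset (A ** B) = coset A" if "B \<in> \<Gamma>" for A B
  proof
    show "coset (A ** B) \<subseteq> coset A"
      using cl(2)[OF that] by (auto simp: coset_def image_iff matrix_mul_assoc[symmetric])
    show "coset A \<subseteq> coset (A ** B)"
    proof
      fix x assume "x \<in> coset A"
      then obtain C where C: "C \<in> \<Gamma>" "x = A ** C" by (auto simp: coset_def)
      have "B \<in> SL2Z" using that sub by blast
      then have "x = (A ** B) ** (adj2 B ** C)"
        by (simp add: C matrix_mul_assoc[symmetric] adj2_mult_cancel)
      moreover have "adj2 B ** C \<in> \<Gamma>" using cl that C by blast
      ultimately show "x \<in> coset (A ** B)" by (auto simp: coset_def)
    qed
  qed
  define c where "c = (\<lambda>A. adj2 (s A) ** A)"
  show ?thesis
  proof (rule that[of c])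
    fix A assume A: "A \<in> SL2Z"
    obtain B where B: "B \<in> \<Gamma>" "s A = A ** B" using s(1)[of A] by (auto simp: coset_def)
    have "c A = adj2 B ** (adj2 A ** A)" by (simp add: c_def B adj2_mult matrix_mul_assoc)
    then have "c A = adj2 B" using A by (simp add: adj2_mult_left)
    then show "c A \<in> \<Gamma>" using cl(3)[OF B(1)] by simp
    have m: "mnorm A \<ge> 1" using mnorm_ge_1[OF A] .
    \<comment> \<open>Minimality holds for the integer part, hence the 1.\<close>
    have "mnorm (s A) \<le> mnorm A + 1" using s(2)[of A] mnorm_nonneg[of A] mnorm_nonneg[of "s A"] by linarith
    then have sA: "mnorm (s A) \<le> 2 * mnorm A" using m by linarith
    have "mnorm (c A) \<le> mnorm (s A) * mnorm A" using mnorm_mult[of "adj2 (s A)" A] by (simp add: c_def)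
    also have "\<dots> \<le> (2 * mnorm A) * mnorm A" using sA m by (intro mult_right_mono) auto
    finally show "mnorm (c A) \<le> 2 * (mnorm A)\<^sup>2" by (simp add: power2_eq_square)
  next
    fix A B assume "A \<in> SL2Z" "B \<in> \<Gamma>"
    then show "c (A ** B) = c A ** B" using coset_eq[of B A] by (simp add: c_def s_def matrix_mul_assoc)
  qed
qed

theorem theorem3p9:
  fixes \<Gamma> :: "(real^2^2) set"
    and k :: real
    and v :: "real^2^2 \<Rightarrow> complex"
    and \<rho> :: "real^2^2 \<Rightarrow> complex^'p::finite^'p"
    and g :: "real^2^2 \<Rightarrow> complex \<Rightarrow> complex^'p"
  assumes "\<Gamma> \<subseteq> SL2Z"
    and "fuchsian_group \<Gamma>" and "first_kind \<Gamma>" and "finitely_generated \<Gamma>"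
    and "parabolic_classes \<Gamma> \<noteq> {}"
    and "multiplier_system \<Gamma> (- k) v"
    and "unitary_representation \<Gamma> \<rho>"
    and "parabolic_cocycle \<Gamma> (- k) v \<rho> g"
  shows "\<exists>\<Phi> :: complex \<Rightarrow> complex^'p. vholomorphic \<Phi> \<and>
           (\<forall>A\<in>\<Gamma>. \<forall>\<tau>\<in>upper_half_plane. slash (- k) v \<rho> \<Phi> A \<tau> - \<Phi> \<tau> = g A \<tau>)"
proof -
  have sub: "\<Gamma> \<subseteq> SL2Z" by fact
  have sg: "subgroup \<Gamma> SL2R" using assms(2) by (simp add: fuchsian_group_def)
  have cl: "mat 1 \<in> \<Gamma>" "\<And>A B. A \<in> \<Gamma> \<Longrightarrow> B \<in> \<Gamma> \<Longrightarrow> A ** B \<in> \<Gamma>" "\<And>A. A \<in> \<Gamma> \<Longrightarrow> adj2 A \<in> \<Gamma>"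
  proof -
    show "mat 1 \<in> \<Gamma>" using subgroup.one_closed[OF sg] by (simp add: SL2R_def)
    show "A ** B \<in> \<Gamma>" if "A \<in> \<Gamma>" "B \<in> \<Gamma>" for A B
      using subgroup.m_closed[OF sg that] by (simp add: SL2R_def)
    show "adj2 A \<in> \<Gamma>" if "A \<in> \<Gamma>" for A
      using subgroup.m_inv_closed[OF sg that] inv_SL2R_eq_adj2[of A] that sub by auto
  qed
  obtain S where S: "finite S" "\<Gamma> = generate SL2R S" using assms(4) by (auto simp: finitely_generated_def)
  have v: "norm (v A) = 1" if "A \<in> \<Gamma>" for A using assms(6) that by (simp add: multiplier_system_def)
  have \<rho>: "\<rho> A \<in> carrier unitary_group" if "A \<in> \<Gamma>" for A
    using assms(7) that by (auto simp: unitary_representation_def hom_def)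
  have g: "cocycle \<Gamma> (- k) v \<rho> g" using assms(8) by (simp add: parabolic_cocycle_def)
  have gc: "g (A ** B) \<tau> = g B \<tau> + slash (- k) v \<rho> (g A) B \<tau>"
    if "A \<in> \<Gamma>" "B \<in> \<Gamma>" "\<tau> \<in> upper_half_plane" for A B \<tau>
    using g that by (simp add: cocycle_def)
  have g_hol: "(\<lambda>\<tau>. g A \<tau> $ j) holomorphic_on upper_half_plane" if "A \<in> \<Gamma>" for A j
    using g that by (auto simp: cocycle_def growth_space_def vholomorphic_def)
  obtain M where M: "\<And>K. compact K \<Longrightarrow> K \<subseteq> upper_half_plane \<Longrightarrow>
      \<exists>C. \<forall>A\<in>\<Gamma>. \<forall>\<tau>\<in>K. norm (g A \<tau>) \<le> C * mnorm A ^ M"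
    using cocycle_polynomial_growth[where v = v and \<rho> = \<rho> and g = g and w = "- k", OF S sub cl v \<rho> g] by blast
  \<comment> \<open>The quadratic bound on c doubles the exponent M of the cocycle; the remaining 8
    makes the series summable.\<close>
  obtain h where h: "orbit_decay (2 * M + 8) h"
    "\<And>\<tau>. \<tau> \<in> upper_half_plane \<Longrightarrow> ((\<lambda>A. h (moebius_action A \<tau>)) has_sum 1) SL2Z"
    using ex_orbit_partition[of "2 * M + 8"] by auto
  obtain c where c: "\<And>A. A \<in> SL2Z \<Longrightarrow> c A \<in> \<Gamma>"
    "\<And>A B. A \<in> SL2Z \<Longrightarrow> B \<in> \<Gamma> \<Longrightarrow> c (A ** B) = c A ** B"
    "\<And>A. A \<in> SL2Z \<Longrightarrow> mnorm (c A) \<le> 2 * (mnorm A)\<^sup>2"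
    using ex_short_coset_component[OF sub cl] by metis
  define F where "F = (\<lambda>j A \<tau>. h (moebius_action A \<tau>) * g (c A) \<tau> $ j)"
  have F_hol: "F j A holomorphic_on upper_half_plane" if "A \<in> SL2Z" for j A
  proof -
    have "(h \<circ> moebius_action A) holomorphic_on upper_half_plane"
      by (rule holomorphic_on_compose_gen[OF holomorphic_moebius_action[OF that] orbit_decay_holomorphic[OF h(1)]])
         (use moebius_action_in_uhp[OF that] in auto)
    then have "(\<lambda>\<tau>. h (moebius_action A \<tau>)) holomorphic_on upper_half_plane" by (simp add: o_def)
    then show ?thesis unfolding F_def by (intro holomorphic_on_mult g_hol c that)
  qed
  have F_bd: "\<exists>C. \<forall>\<tau>\<in>K. \<forall>A\<in>SL2Z. norm (F j A \<tau>) * mnorm A ^ 8 \<le> C"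
    if K: "compact K" "K \<subseteq> upper_half_plane" for K j
  proof -
    obtain C where C: "\<And>\<tau> A. \<tau> \<in> K \<Longrightarrow> A \<in> SL2Z \<Longrightarrow> norm (h (moebius_action A \<tau>)) * mnorm A ^ (2 * M + 8) \<le> C"
      using orbit_decayE[OF h(1) K] by metis
    obtain C' where C': "\<And>\<tau> A. A \<in> \<Gamma> \<Longrightarrow> \<tau> \<in> K \<Longrightarrow> norm (g A \<tau>) \<le> C' * mnorm A ^ M"
      using M[OF K] by blast
    have "norm (F j A \<tau>) * mnorm A ^ 8 \<le> \<bar>C'\<bar> * 2 ^ M * C" if \<tau>: "\<tau> \<in> K" and A: "A \<in> SL2Z" for \<tau> A
    proof -
      have m: "mnorm A \<ge> 0" by (rule mnorm_nonneg)
      have "norm (g (c A) \<tau> $ j) \<le> norm (g (c A) \<tau>)" by (rule Finite_Cartesian_Product.norm_nth_le)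
      also have "\<dots> \<le> C' * mnorm (c A) ^ M" by (rule C'[OF c(1)[OF A] \<tau>])
      also have "\<dots> \<le> \<bar>C'\<bar> * (2 * (mnorm A)\<^sup>2) ^ M"
        using c(3)[OF A] mnorm_nonneg by (intro mult_mono power_mono) auto
      also have "\<dots> = \<bar>C'\<bar> * 2 ^ M * mnorm A ^ (2 * M)" by (simp add: power_mult_distrib power_mult)
      finally have "norm (F j A \<tau>) * mnorm A ^ 8 \<le>
          norm (h (moebius_action A \<tau>)) * (\<bar>C'\<bar> * 2 ^ M * mnorm A ^ (2 * M)) * mnorm A ^ 8"
        unfolding F_def norm_mult using m by (intro mult_right_mono mult_left_mono) auto
      also have "\<dots> = \<bar>C'\<bar> * 2 ^ M * (norm (h (moebius_action A \<tau>)) * mnorm A ^ (2 * M + 8))"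
        by (simp add: power_add mult_ac)
      also have "\<dots> \<le> \<bar>C'\<bar> * 2 ^ M * C" by (intro mult_left_mono C \<tau> A) auto
      finally show ?thesis .
    qed
    then show ?thesis by blast
  qed
  \<comment> \<open>The minus sign matches the cocycle relation, in which g at A is subtracted from
    g at c(BA).\<close>
  define \<Phi> :: "complex \<Rightarrow> complex^'p" where "\<Phi> = (\<lambda>\<tau>. \<chi> j. - infsum (\<lambda>A. F j A \<tau>) SL2Z)"
  have \<Phi>_hol: "vholomorphic \<Phi>"
    unfolding vholomorphic_def
  proof
    fix j
    have "(\<lambda>\<tau>. infsum (\<lambda>A. F j A \<tau>) SL2Z) holomorphic_on upper_half_plane"
      using F_hol F_bd by (rule infsum_SL2Z_holomorphic(1))
    then show "(\<lambda>\<tau>. \<Phi> \<tau> $ j) holomorphic_on upper_half_plane"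
      by (simp add: \<Phi>_def holomorphic_on_minus)
  qed
  have \<Phi>_sum: "((\<lambda>A. F j A \<tau>) has_sum (- \<Phi> \<tau> $ j)) SL2Z" if "\<tau> \<in> upper_half_plane" for \<tau> j
  proof -
    have "(\<lambda>A. norm (F j A \<tau>)) summable_on SL2Z"
      by (rule infsum_SL2Z_holomorphic(2)[of "F j", OF F_hol F_bd that])
    then have "((\<lambda>A. F j A \<tau>) has_sum infsum (\<lambda>A. F j A \<tau>) SL2Z) SL2Z"
      by (rule has_sum_infsum[OF abs_summable_summable])
    then show ?thesis by (simp add: \<Phi>_def)
  qed
  have "slash (- k) v \<rho> \<Phi> A \<tau> $ i - \<Phi> \<tau> $ i = g A \<tau> $ i" if A: "A \<in> \<Gamma>" and \<tau>: "\<tau> \<in> upper_half_plane" for A \<tau> i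
  proof -
    have AS: "A \<in> SL2Z" using A sub by blast
    define z where "z = moebius_action A \<tau>"
    have z: "z \<in> upper_half_plane" using moebius_action_in_uhp[OF AS \<tau>] by (simp add: z_def)
    define a where "a = (\<lambda>j. inverse (v A) * real_power (aut_factor A \<tau>) (- (- k)) * matrix_inv (\<rho> A) $ i $ j)"
    have sl: "slash (- k) v \<rho> f A \<tau> $ i = (\<Sum>j\<in>UNIV. a j * f z $ j)" for f :: "complex \<Rightarrow> complex^'p"
      unfolding slash_nth a_def z_def ..
    have "((\<lambda>B. \<Sum>j\<in>UNIV. a j * F j B z) has_sum (\<Sum>j\<in>UNIV. a j * (- \<Phi> z $ j))) SL2Z"
      by (intro has_sum_finite_sum has_sum_cmult_right \<Phi>_sum z) auto
    also have "(\<Sum>j\<in>UNIV. a j * (- \<Phi> z $ j)) = - slash (- k) v \<rho> \<Phi> A \<tau> $ i"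
      by (simp add: sl sum_negf)
    \<comment> \<open>The cocycle relation together with c(BA) = c(B)A makes every term a function
      of the product BA, with A fixed, so that the sum can be reindexed.\<close>
    also have "((\<lambda>B. \<Sum>j\<in>UNIV. a j * F j B z) has_sum - slash (- k) v \<rho> \<Phi> A \<tau> $ i) SL2Z \<longleftrightarrow>
       ((\<lambda>B. h (moebius_action (B ** A) \<tau>) * (g (c (B ** A)) \<tau> $ i - g A \<tau> $ i)) has_sum - slash (- k) v \<rho> \<Phi> A \<tau> $ i) SL2Z"
    proof (rule has_sum_cong)
      fix B assume B: "B \<in> SL2Z"
      have "(\<Sum>j\<in>UNIV. a j * F j B z) = h (moebius_action B z) * slash (- k) v \<rho> (g (c B)) A \<tau> $ i"
        by (simp add: sl F_def sum_distrib_left mult_ac)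
      also have "slash (- k) v \<rho> (g (c B)) A \<tau> = g (c (B ** A)) \<tau> - g A \<tau>"
        using gc[OF c(1)[OF B] A \<tau>] c(2)[OF B A] by simp
      also have "moebius_action B z = moebius_action (B ** A) \<tau>"
        by (simp add: z_def moebius_action_mult[OF B AS \<tau>])
      finally show "(\<Sum>j\<in>UNIV. a j * F j B z) = h (moebius_action (B ** A) \<tau>) * (g (c (B ** A)) \<tau> $ i - g A \<tau> $ i)"
        by simp
    qed
    also have "\<dots> \<longleftrightarrow> ((\<lambda>B. h (moebius_action B \<tau>) * (g (c B) \<tau> $ i - g A \<tau> $ i)) has_sum - slash (- k) v \<rho> \<Phi> A \<tau> $ i) SL2Z"
      by (rule has_sum_SL2Z_translate[OF AS])
    finally have 1: "((\<lambda>B. h (moebius_action B \<tau>) * (g (c B) \<tau> $ i - g A \<tau> $ i)) has_sum - slash (- k) v \<rho> \<Phi> A \<tau> $ i) SL2Z" .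
    \<comment> \<open>The same series evaluated directly: the weights sum to 1, so subtracting g at
      A in each term subtracts it once.\<close>
    have "((\<lambda>B. F i B \<tau> + - (h (moebius_action B \<tau>) * g A \<tau> $ i)) has_sum (- \<Phi> \<tau> $ i + - (1 * g A \<tau> $ i))) SL2Z"
      by (intro has_sum_add has_sum_uminusI has_sum_cmult_left \<Phi>_sum h(2) \<tau>)
    then have "((\<lambda>B. h (moebius_action B \<tau>) * (g (c B) \<tau> $ i - g A \<tau> $ i)) has_sum (- \<Phi> \<tau> $ i - g A \<tau> $ i)) SL2Z"
      by (simp add: F_def right_diff_distrib)
    from has_sum_unique[OF 1 this] show ?thesis by (simp add: algebra_simps)
  qed
  then show ?thesis using \<Phi>_hol by (intro exI[of _ \<Phi>]) (auto simp: vec_eq_iff)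
qed

end
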